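(* For $\mu\in\mathcal P_2(\Theta)$ let $m_2(\mu):=\int_\Theta\|\theta\|^2\mu(\mathrm d\theta)$. Let $\boldsymbol\mu=(\mu_t)_{t\ge0}$ be the closed-loop flow generated by the feedback control $\alpha_t$ with initial distribution $\mu\in\mathcal P_2(\Theta)$, i.e. $(\boldsymbol\mu,\alpha)$ solves the continuity equation $\partial_t\mu_t+\nabla\cdot(\alpha_t\mu_t)=0$ with $\mu_0=\mu$. Then, for almost every $T>0$, $$m_2(\mu_T)\le e^T m_2(\mu)+\int_0^Te^{T-t}\|\alpha_t\|^2_{L^2(\mu_t)}\,\mathrm dt.$$ If $\boldsymbol\mu$ is a gradient flow of the empirical loss functional $L$, then $$m_2(\mu_T)\le e^Tm_2(\mu)+\int_0^Te^{T-t}G(\mu_t)^2\,\mathrm dt\le e^T\big(m_2(\mu)+L(\mu)-L(\mu_T)\big).$$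
   Context: Parameter space $\Theta=\mathbb R\times\mathbb R^d\times\mathbb R$ with $\theta=(w,a,b)$; $\mathcal P_2(\Theta)$ is the set of probability measures on $\Theta$ with finite second moment, with the Wasserstein-2 metric $\mathcal W_2$. Admissible pairs $(\boldsymbol\mu,\alpha)$ for the continuity equation: $\boldsymbol\mu=(\mu_t)_{t\ge0}$ is a continuous curve in $\mathcal P_2(\Theta)$ with $\mu_0=\mu$, $\alpha$ is a Borel velocity field on $[0,\infty)\times\Theta$ with $\int_0^\infty e^{-t}\|\alpha_t\|^2_{L^2(\mu_t)}\mathrm dt<\infty$, and $\partial_t\mu_t+\nabla\cdot(\alpha_t\mu_t)=0$ in the sense of distributions. For an absolutely continuous curve the control is identified with its unique velocity of minimal $L^2$-norm. Given an activation $\sigma:\mathbb R\to\mathbb R$, a loss $\tilde L:\mathbb R\to\mathbb R_{\ge0}$ and data $(x_k,y_k)_{k=1}^M\subset\mathbb R^d\times\mathbb R$, set $f_\mu(x)=\int_\Theta w\,\sigma(a\cdot x+b)\,\mu(\mathrm dw,\mathrm da,\mathrm db)$ and $L(\mu)=\frac1M\sum_{k=1}^M\tilde L(f_\mu(x_k)-y_k)$. Standing assumptions: $\min_{\mathcal P_2(\Theta)}L=0$; (i) there is $S_0\ge0$ with $|\sigma(z)-\sigma(z')|\le S_0|z-z'|$, $|\sigma(z)|\le S_0$, $|\sigma'(z)|\le S_0$ for all $z,z'$; (ii) $R:=\max_k\|x_k\|<\infty$; (iii) $\tilde L\in\mathcal C^1(\mathbb R)$ is convex and $|\tilde L'(r)-\tilde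 L'(s)|\le\beta|r-s|$ for some $\beta>0$; (iv) $\min_{\mathbb R}\tilde L=0$. $G(\mu)=\big(\int_\Theta\|\nabla_\theta\partial_\mu L(\mu)(\theta)\|^2\mu(\mathrm d\theta)\big)^{1/2}$ with linear derivative $\partial_\mu L(\mu)(\theta)=\frac1M\sum_k\tilde L'(f_\mu(x_k)-y_k)\,w\,\sigma(a\cdot x_k+b)$; $G$ is a strong upper gradient of $L$: $|L(\mu_t)-L(\mu_s)|\le\int_s^tG(\mu_r)|\mu'|(r)\mathrm dr$ along absolutely continuous curves, where $|\mu'|(t)=\lim_{s\to t}\mathcal W_2(\mu_s,\mu_t)/|s-t|$. A gradient flow of $L$ started at $\mu$ is a curve of maximal slope: a curve $\boldsymbol\mu\in AC^2_{loc}([0,\infty);\mathcal P_2(\Theta))$ (on each compact interval $\mathcal W_2(\mu_s,\mu_t)\le\int_s^tm_u\mathrm du$ with $m\in L^2$), $\mu_0=\mu$, with $-\frac{\mathrm d}{\mathrm dt}L(\mu_t)=|\mu'|^2(t)=G^2(\mu_t)$ for a.e. $t>0$. *)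

theory Defs
  imports "HOL-Probability.Probability"
begin

text \<open>The norm of the product type is the Euclidean norm of \<open>(w, a, b)\<close>.\<close>

type_synonym 'd param = "real \<times> (real ^ 'd) \<times> real"

section \<open>The Wasserstein space\<close>

definition P2 :: "'a::euclidean_space measure set" where
  "P2 = {\<mu>. prob_space \<mu> \<and> sets \<mu> = sets borel \<and> integrable \<mu> (\<lambda>\<theta>. (norm \<theta>)\<^sup>2)}"

definition m2 :: "'a::euclidean_space measure \<Rightarrow> real" where
  "m2 \<mu> = (\<integral>\<theta>. (norm \<theta>)\<^sup>2 \<partial>\<mu>)"

definition couplings ::
    "'a::euclidean_space measure \<Rightarrow> 'a measure \<Rightarrow> ('a \<times> 'a) measure set" where
  "couplings \<mu> \<nu> = {\<gamma>. prob_space \<gamma> \<and> sets \<gamma> = sets borel \<and>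
     distr \<gamma> borel fst = \<mu> \<and> distr \<gamma> borel snd = \<nu>}"

text \<open>Only meant for arguments in \<^term>\<open>P2\<close>, where the cost is integrable for every coupling
  and the product measure is a coupling.\<close>

definition W2 :: "'a::euclidean_space measure \<Rightarrow> 'a measure \<Rightarrow> real" where
  "W2 \<mu> \<nu> = sqrt (INF \<gamma>\<in>couplings \<mu> \<nu>. \<integral>z. (dist (fst z) (snd z))\<^sup>2 \<partial>\<gamma>)"

text \<open>Curves are functions on all of \<open>\<real>\<close>; only their values at times \<open>t \<ge> 0\<close> matter.\<close>

definition continuous_P2_curve :: "(real \<Rightarrow> 'a::euclidean_space measure) \<Rightarrow> bool" where
  "continuous_P2_curve \<mu> \<longleftrightarrow> (\<forall>t\<ge>0. \<mu> t \<in> P2) \<and>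
     (\<forall>t\<ge>0. ((\<lambda>s. W2 (\<mu> s) (\<mu> t)) \<longlongrightarrow> 0) (at t within {0..}))"

definition AC2_loc_curve :: "(real \<Rightarrow> 'a::euclidean_space measure) \<Rightarrow> bool" where
  "AC2_loc_curve \<mu> \<longleftrightarrow> (\<forall>t\<ge>0. \<mu> t \<in> P2) \<and>
     (\<forall>a b. 0 \<le> a \<and> a \<le> b \<longrightarrow>
       (\<exists>m::real \<Rightarrow> real. set_borel_measurable lebesgue {a..b} m \<and>
          set_integrable lebesgue {a..b} (\<lambda>u. (m u)\<^sup>2) \<and>
          (\<forall>s t. a \<le> s \<and> s \<le> t \<and> t \<le> b \<longrightarrow>
             W2 (\<mu> s) (\<mu> t) \<le> (LINT u:{s..t}|lebesgue. m u))))"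

definition has_metric_derivative ::
    "(real \<Rightarrow> 'a::euclidean_space measure) \<Rightarrow> real \<Rightarrow> real \<Rightarrow> bool" where
  "has_metric_derivative \<mu> v t \<longleftrightarrow> ((\<lambda>s. W2 (\<mu> s) (\<mu> t) / \<bar>s - t\<bar>) \<longlongrightarrow> v) (at t)"

section \<open>The continuity equation\<close>

definition gradient :: "('a::real_inner \<Rightarrow> real) \<Rightarrow> 'a \<Rightarrow> 'a" where
  "gradient f z = (THE D. GDERIV f z :> D)"

text \<open>\<open>Ck n\<close> is the class \<open>C\<^sup>n\<close>: differentiability is required at every stage, and the last
  partial derivatives are continuous.\<close>

primrec Ck :: "nat \<Rightarrow> ('a::euclidean_space \<Rightarrow> real) \<Rightarrow> bool" where
  "Ck 0 f \<longleftrightarrow> continuous_on UNIV f"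
| "Ck (Suc n) f \<longleftrightarrow> (\<forall>z. f differentiable (at z)) \<and>
     (\<forall>i\<in>Basis. Ck n (\<lambda>z. frechet_derivative f (at z) i))"

text \<open>\<open>C\<^sub>c\<^sup>\<infinity>((0,\<infinity>) \<times> \<Theta>)\<close>, each function being extended by zero to \<open>\<real> \<times> \<Theta>\<close>.\<close>

definition test_function :: "(real \<times> 'a::euclidean_space \<Rightarrow> real) \<Rightarrow> bool" where
  "test_function \<phi> \<longleftrightarrow> (\<forall>n. Ck n \<phi>) \<and> compact (closure {z. \<phi> z \<noteq> 0}) \<and>
     closure {z. \<phi> z \<noteq> 0} \<subseteq> {0<..} \<times> UNIV"

definition continuity_equation ::
    "(real \<Rightarrow> 'a::euclidean_space measure) \<Rightarrow> (real \<Rightarrow> 'a \<Rightarrow> 'a) \<Rightarrow> bool" where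
  "continuity_equation \<mu> \<alpha> \<longleftrightarrow> (\<forall>\<phi>. test_function \<phi> \<longrightarrow>
     (LINT t:{0..}|lebesgue. (\<integral>\<theta>. deriv (\<lambda>s. \<phi> (s, \<theta>)) t
        + gradient (\<lambda>\<eta>. \<phi> (t, \<eta>)) \<theta> \<bullet> \<alpha> t \<theta> \<partial>\<mu> t)) = 0)"

definition L2_norm_sq :: "'a::euclidean_space measure \<Rightarrow> ('a \<Rightarrow> 'a) \<Rightarrow> ennreal" where
  "L2_norm_sq \<nu> v = (\<integral>\<^sup>+\<theta>. ennreal ((norm (v \<theta>))\<^sup>2) \<partial>\<nu>)"

definition admissible_pair ::
    "'a::euclidean_space measure \<Rightarrow> (real \<Rightarrow> 'a measure) \<Rightarrow> (real \<Rightarrow> 'a \<Rightarrow> 'a) \<Rightarrow> bool" where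
  "admissible_pair \<mu>0 \<mu> \<alpha> \<longleftrightarrow>
     continuous_P2_curve \<mu> \<and> \<mu> 0 = \<mu>0 \<and>
     (\<lambda>(t, \<theta>). \<alpha> t \<theta>) \<in> borel_measurable (restrict_space borel ({0..} \<times> UNIV)) \<and>
     (\<integral>\<^sup>+t\<in>{0..}. ennreal (exp (- t)) * L2_norm_sq (\<mu> t) (\<alpha> t) \<partial>lebesgue) < \<infinity> \<and>
     continuity_equation \<mu> \<alpha>"

section \<open>The empirical loss and its gradient flows\<close>

definition network :: "(real \<Rightarrow> real) \<Rightarrow> ('d::finite) param measure \<Rightarrow> real ^ 'd \<Rightarrow> real" where
  "network \<sigma> \<mu> x = (\<integral>\<theta>. (case \<theta> of (w, a, b) \<Rightarrow> w * \<sigma> (a \<bullet> x + b)) \<partial>\<mu>)"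

definition loss :: "(real \<Rightarrow> real) \<Rightarrow> (real \<Rightarrow> real) \<Rightarrow> nat \<Rightarrow>
    (nat \<Rightarrow> real ^ 'd::finite) \<Rightarrow> (nat \<Rightarrow> real) \<Rightarrow> 'd param measure \<Rightarrow> real" where
  "loss \<sigma> Lt M x y \<mu> = (1 / real M) * (\<Sum>k=1..M. Lt (network \<sigma> \<mu> (x k) - y k))"

definition linear_derivative_loss :: "(real \<Rightarrow> real) \<Rightarrow> (real \<Rightarrow> real) \<Rightarrow> nat \<Rightarrow>
    (nat \<Rightarrow> real ^ 'd::finite) \<Rightarrow> (nat \<Rightarrow> real) \<Rightarrow> 'd param measure \<Rightarrow> 'd param \<Rightarrow> real" where
  "linear_derivative_loss \<sigma> Lt M x y \<mu> \<theta> = (case \<theta> of (w, a, b) \<Rightarrow>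
     (1 / real M) * (\<Sum>k=1..M. deriv Lt (network \<sigma> \<mu> (x k) - y k) * w * \<sigma> (a \<bullet> x k + b)))"

definition loss_slope :: "(real \<Rightarrow> real) \<Rightarrow> (real \<Rightarrow> real) \<Rightarrow> nat \<Rightarrow>
    (nat \<Rightarrow> real ^ 'd::finite) \<Rightarrow> (nat \<Rightarrow> real) \<Rightarrow> 'd param measure \<Rightarrow> real" where
  "loss_slope \<sigma> Lt M x y \<mu> =
     sqrt (\<integral>\<theta>. (norm (gradient (linear_derivative_loss \<sigma> Lt M x y \<mu>) \<theta>))\<^sup>2 \<partial>\<mu>)"

definition gradient_flow :: "('a::euclidean_space measure \<Rightarrow> real) \<Rightarrow> ('a measure \<Rightarrow> real) \<Rightarrow>
    'a measure \<Rightarrow> (real \<Rightarrow> 'a measure) \<Rightarrow> bool" where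
  "gradient_flow L G \<mu>0 \<mu> \<longleftrightarrow> AC2_loc_curve \<mu> \<and> \<mu> 0 = \<mu>0 \<and>
     (AE t in lebesgue. t > 0 \<longrightarrow>
        (\<exists>v. has_metric_derivative \<mu> v t \<and>
             ((\<lambda>s. L (\<mu> s)) has_real_derivative - (v\<^sup>2)) (at t) \<and>
             v\<^sup>2 = (G (\<mu> t))\<^sup>2))"

end

theory Submission
  imports Defs
begin

text \<open>Both inequalities express that \<open>e\<^sup>-\<^sup>t m\<^sub>2(\<mu>\<^sub>t)\<close> grows at most at the rate \<open>e\<^sup>-\<^sup>t\<close> times the squared
  speed of the curve.  Formally \<open>d/dt m\<^sub>2(\<mu>\<^sub>t) = \<integral> 2 \<theta> \<bullet> \<alpha>\<^sub>t d\<mu>\<^sub>t \<le> m\<^sub>2(\<mu>\<^sub>t) + \<integral> |\<alpha>\<^sub>t|\<^sup>2 d\<mu>\<^sub>t\<close>, and the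
  weight \<open>e\<^sup>-\<^sup>t\<close> removes the term \<open>m\<^sub>2(\<mu>\<^sub>t)\<close> without an appeal to Gronwall's lemma.

  For a solution of the continuity equation, the derivative is replaced by testing against
  \<open>e\<^sup>-\<^sup>t \<chi>(t) \<psi>(\<theta>)\<close>, where \<open>\<chi>\<close> is a smooth approximation of the indicator of \<open>[0, T]\<close> and \<open>\<psi>\<close> a smooth
  truncation of \<open>|\<theta>|\<^sup>2\<close>.  As \<open>\<chi>\<close> sharpens, \<open>\<chi>'\<close> tends to the difference of the point masses at \<open>0\<close> and
  \<open>T\<close>, because \<open>t \<mapsto> \<integral> \<psi> d\<mu>\<^sub>t\<close> is continuous; this gives the identity \<open>weighted_moment_identity\<close>.
  The truncation is removed afterwards by dominated convergence in \<open>weighted_m2_le_speed\<close>: the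
  error \<open>|\<nabla>\<psi>|\<^sup>2 / 4 - \<psi>\<close> of Young's inequality vanishes on a growing ball and stays below a multiple
  of \<open>|\<theta>|\<^sup>2\<close>.

  For a gradient flow no velocity field is used.  The square root of \<open>m\<^sub>2\<close> is the Wasserstein distance
  to the Dirac mass at \<open>0\<close>, hence 1-Lipschitz (\<open>abs_sqrt_m2_diff_le_W2\<close>), so \<open>e\<^sup>-\<^sup>t m\<^sub>2(\<mu>\<^sub>t)\<close> is absolutely
  continuous and its upper derivative is at most \<open>e\<^sup>-\<^sup>t |\<mu>'|\<^sup>2\<close> almost everywhere.  The loss is
  Lipschitz on bounded sets (\<open>loss_increment_le_W2\<close>), so it is absolutely continuous along the flow,
  and its derivative \<open>- G\<^sup>2\<close> integrates to at most the loss decrement.  Both conclusions come from one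
  lemma, \<open>increment_le_integral_upper_derivative\<close>: an absolutely continuous function increases by
  at most the integral of any integrable bound on its upper derivative.\<close>

section \<open>Integrals along couplings\<close>

lemma integral_mult_le_sqrt:
  fixes f g :: "'a \<Rightarrow> real"
  assumes [measurable]: "f \<in> borel_measurable M" "g \<in> borel_measurable M"
    and f2: "integrable M (\<lambda>x. (f x)\<^sup>2)" and g2: "integrable M (\<lambda>x. (g x)\<^sup>2)"
  shows "integrable M (\<lambda>x. f x * g x)"
    and "(\<integral>x. f x * g x \<partial>M) \<le> sqrt (\<integral>x. (f x)\<^sup>2 \<partial>M) * sqrt (\<integral>x. (g x)\<^sup>2 \<partial>M)"
proof -
  show fg: "integrable M (\<lambda>x. f x * g x)"
  proof (rule Bochner_Integration.integrable_bound[OF Bochner_Integration.integrable_add[OF f2 g2]])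
    have "\<bar>f x * g x\<bar> \<le> (f x)\<^sup>2 + (g x)\<^sup>2" for x
      using sum_squares_bound[of "\<bar>f x\<bar>" "\<bar>g x\<bar>"] mult_nonneg_nonneg[of "\<bar>f x\<bar>" "\<bar>g x\<bar>"]
      unfolding abs_mult power2_abs by linarith
    then show "AE x in M. norm (f x * g x) \<le> norm ((f x)\<^sup>2 + (g x)\<^sup>2)" by simp
  qed simp
  define a where "a = sqrt (\<integral>x. (f x)\<^sup>2 \<partial>M)"
  define b where "b = sqrt (\<integral>x. (g x)\<^sup>2 \<partial>M)"
  have a2: "a\<^sup>2 = (\<integral>x. (f x)\<^sup>2 \<partial>M)" and b2: "b\<^sup>2 = (\<integral>x. (g x)\<^sup>2 \<partial>M)" and ab: "a \<ge> 0" "b \<ge> 0"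
    by (simp_all add: a_def b_def)
  have zero: "(\<integral>x. f x * g x \<partial>M) = 0"
    if "(\<integral>x. (h x)\<^sup>2 \<partial>M) = 0" "integrable M (\<lambda>x. (h x)\<^sup>2)" "h = f \<or> h = g" for h
  proof -
    have "AE x in M. (h x)\<^sup>2 = 0"
      using integral_nonneg_eq_0_iff_AE[OF that(2)] that(1) by simp
    then have "AE x in M. f x * g x = 0"
      by (rule AE_mp) (use that(3) in \<open>intro AE_I2, auto\<close>)
    then show ?thesis
      by (rule integral_eq_zero_AE)
  qed
  have "(\<integral>x. f x * g x \<partial>M) \<le> a * b"
  proof (cases "a = 0 \<or> b = 0")
    case True
    then have "(\<integral>x. (f x)\<^sup>2 \<partial>M) = 0 \<or> (\<integral>x. (g x)\<^sup>2 \<partial>M) = 0"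
      unfolding a2[symmetric] b2[symmetric] by simp
    then have "(\<integral>x. f x * g x \<partial>M) = 0"
      using zero[OF _ f2] zero[OF _ g2] by blast
    then show ?thesis using True by auto
  next
    case False
    define c where "c = (\<integral>x. f x * g x \<partial>M)"
    have "0 \<le> (\<integral>x. (b * f x - a * g x)\<^sup>2 \<partial>M)"
      by (rule Bochner_Integration.integral_nonneg) simp
    also have "\<dots> = (\<integral>x. b\<^sup>2 * (f x)\<^sup>2 - 2 * a * b * (f x * g x) + a\<^sup>2 * (g x)\<^sup>2 \<partial>M)"
      by (intro Bochner_Integration.integral_cong refl) (simp add: power2_eq_square algebra_simps)
    also have "\<dots> = b\<^sup>2 * (\<integral>x. (f x)\<^sup>2 \<partial>M) - 2 * a * b * c + a\<^sup>2 * (\<integral>x. (g x)\<^sup>2 \<partial>M)"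
      using f2 g2 fg by (simp add: c_def)
    also have "\<dots> = b\<^sup>2 * a\<^sup>2 - 2 * a * b * c + a\<^sup>2 * b\<^sup>2"
      by (simp only: a2 b2)
    finally have "(a * b) * c \<le> (a * b) * (a * b)"
      by (simp add: power2_eq_square algebra_simps)
    moreover have "a * b > 0" using False ab by simp
    ultimately show ?thesis
      unfolding c_def by (simp only: mult_le_cancel_left_pos)
  qed
  then show "(\<integral>x. f x * g x \<partial>M) \<le> sqrt (\<integral>x. (f x)\<^sup>2 \<partial>M) * sqrt (\<integral>x. (g x)\<^sup>2 \<partial>M)"
    by (simp add: a_def b_def)
qed

lemma P2_D:
  assumes "\<mu> \<in> P2"
  shows "prob_space \<mu>" "sets \<mu> = sets borel" "integrable \<mu> (\<lambda>\<theta>. (norm \<theta>)\<^sup>2)"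
  using assms by (auto simp: P2_def)

lemma m2_nonneg: "0 \<le> m2 \<mu>"
  by (simp add: m2_def)

lemma P2_integrable_quadratic_growth:
  fixes g :: "'a::euclidean_space \<Rightarrow> 'b::{banach, second_countable_topology}"
  assumes \<mu>: "\<mu> \<in> P2" and g: "g \<in> borel_measurable borel"
    and bound: "\<And>x. norm (g x) \<le> a + b * (norm x)\<^sup>2"
  shows "integrable \<mu> g"
proof -
  interpret prob_space \<mu> using \<mu> by (rule P2_D)
  show ?thesis
  proof (rule Bochner_Integration.integrable_bound[of _ "\<lambda>x. a + b * (norm x)\<^sup>2"])
    show "g \<in> borel_measurable \<mu>"
      using g measurable_cong_sets[OF P2_D(2)[OF \<mu>] refl] by blast
    show "AE x in \<mu>. norm (g x) \<le> norm (a + b * (norm x)\<^sup>2)"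
      using order_trans[OF bound abs_ge_self] by simp
  qed (use P2_D(3)[OF \<mu>] in auto)
qed

lemma couplings_nonempty:
  fixes \<mu> \<nu> :: "'a::euclidean_space measure"
  assumes "\<mu> \<in> P2" "\<nu> \<in> P2"
  shows "couplings \<mu> \<nu> \<noteq> {}"
proof -
  note D = assms[THEN P2_D(1)] assms[THEN P2_D(2)]
  interpret M: prob_space \<mu> by fact
  interpret N: prob_space \<nu> by fact
  interpret pair_prob_space \<mu> \<nu> ..
  have S: "sets (\<mu> \<Otimes>\<^sub>M \<nu>) = sets (borel :: ('a \<times> 'a) measure)"
    unfolding borel_prod[symmetric] using D by (intro sets_pair_measure_cong)
  have "distr (\<mu> \<Otimes>\<^sub>M \<nu>) borel fst = \<mu>"
    using N.distr_pair_fst[of \<mu>] distr_cong[OF refl D(3)[symmetric], of "\<mu> \<Otimes>\<^sub>M \<nu>" fst fst]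
    by simp
  moreover have "distr (\<mu> \<Otimes>\<^sub>M \<nu>) borel snd = \<nu>"
  proof -
    have "distr (\<mu> \<Otimes>\<^sub>M \<nu>) \<nu> snd = \<nu>"
    proof (rule measure_eqI)
      fix A assume "A \<in> sets (distr (\<mu> \<Otimes>\<^sub>M \<nu>) \<nu> snd)"
      then have A: "A \<in> sets \<nu>" by simp
      have "snd -` A \<inter> space (\<mu> \<Otimes>\<^sub>M \<nu>) = space \<mu> \<times> A"
        using sets.sets_into_space[OF A] by (auto simp: space_pair_measure)
      with A show "emeasure (distr (\<mu> \<Otimes>\<^sub>M \<nu>) \<nu> snd) A = emeasure \<nu> A"
        by (simp add: emeasure_distr N.emeasure_pair_measure_Times M.emeasure_space_1)
    qed simp
    then show ?thesis
      using distr_cong[OF refl D(4)[symmetric], of "\<mu> \<Otimes>\<^sub>M \<nu>" snd snd] by simp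
  qed
  ultimately have "\<mu> \<Otimes>\<^sub>M \<nu> \<in> couplings \<mu> \<nu>"
    using S by (simp add: couplings_def prob_space_axioms)
  then show ?thesis by blast
qed

text \<open>The central estimate for the Wasserstein distance: integrate the increment of \<open>g\<close> against a
  coupling and apply the Cauchy-Schwarz inequality to each of the three terms.  The constants are
  kept sharp, because for \<open>g = |x|\<^sup>2\<close> (\<open>A = 0\<close>, \<open>B = 1\<close>) the bound is
  \<open>(\<surd>m\<^sub>2(\<mu>) + \<surd>m\<^sub>2(\<nu>)) W\<^sub>2(\<mu>, \<nu>)\<close>, which divides to the Lipschitz constant \<open>1\<close> for \<open>\<surd>m\<^sub>2\<close>.\<close>

lemma abs_integral_diff_le_W2:
  fixes g :: "'a::euclidean_space \<Rightarrow> real"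
  assumes \<mu>: "\<mu> \<in> P2" and \<nu>: "\<nu> \<in> P2" and g[measurable]: "g \<in> borel_measurable borel"
    and A: "A \<ge> 0" and B: "B \<ge> 0"
    and lip: "\<And>x y. \<bar>g x - g y\<bar> \<le> (A + B * (norm x + norm y)) * dist x y"
  shows "\<bar>(\<integral>x. g x \<partial>\<mu>) - (\<integral>x. g x \<partial>\<nu>)\<bar> \<le> (A + B * (sqrt (m2 \<mu>) + sqrt (m2 \<nu>))) * W2 \<mu> \<nu>"
proof -
  let ?K = "A + B * (sqrt (m2 \<mu>) + sqrt (m2 \<nu>))"
  let ?I = "\<lambda>\<gamma>. \<integral>z. (dist (fst z) (snd z))\<^sup>2 \<partial>(\<gamma> :: ('a \<times> 'a) measure)"
  have K: "?K \<ge> 0" using A B by (simp add: m2_nonneg)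
  have growth: "norm (g x) \<le> (\<bar>g 0\<bar> + A) + (A + B) * (norm x)\<^sup>2" for x
  proof -
    have "norm x \<le> 1 + (norm x)\<^sup>2"
      using sum_squares_bound[of "norm x" 1] norm_ge_zero[of x] unfolding one_power2 by linarith
    then have "A * norm x \<le> A * (1 + (norm x)\<^sup>2)" using A by (rule mult_left_mono)
    then show ?thesis
      using lip[of x 0] by (simp add: power2_eq_square algebra_simps)
  qed
  have coupling: "\<bar>(\<integral>x. g x \<partial>\<mu>) - (\<integral>x. g x \<partial>\<nu>)\<bar> \<le> ?K * sqrt (?I \<gamma>)"
    if "\<gamma> \<in> couplings \<mu> \<nu>" for \<gamma>
  proof -
    from that have "prob_space \<gamma>" and S[measurable_cong]: "sets \<gamma> = sets borel"
      and fst: "distr \<gamma> borel fst = \<mu>" and snd: "distr \<gamma> borel snd = \<nu>"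
      by (auto simp: couplings_def)
    interpret \<gamma>: prob_space \<gamma> by fact
    have [measurable]: "fst \<in> \<gamma> \<rightarrow>\<^sub>M borel" "snd \<in> \<gamma> \<rightarrow>\<^sub>M borel"
      unfolding measurable_cong_sets[OF S refl] borel_prod[symmetric] by simp_all
    have int: "integrable \<gamma> (\<lambda>z. h (fst z))" "integrable \<gamma> (\<lambda>z. h (snd z))"
      and eq: "(\<integral>z. h (fst z) \<partial>\<gamma>) = (\<integral>x. h x \<partial>\<mu>)" "(\<integral>z. h (snd z) \<partial>\<gamma>) = (\<integral>x. h x \<partial>\<nu>)"
      if "integrable \<mu> h" "integrable \<nu> h" "h \<in> borel_measurable borel" for h :: "'a \<Rightarrow> real"
      using that integrable_distr[of fst \<gamma> borel h] integrable_distr[of snd \<gamma> borel h]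
        integral_distr[of fst \<gamma> borel h] integral_distr[of snd \<gamma> borel h]
      by (simp_all add: fst snd)
    note n2 = P2_D(3)[OF \<mu>] P2_D(3)[OF \<nu>]
    note gi = P2_integrable_quadratic_growth[OF \<mu> g growth] P2_integrable_quadratic_growth[OF \<nu> g growth]
    let ?d = "\<lambda>z. dist (fst z) (snd z :: 'a)"
    have d2: "integrable \<gamma> (\<lambda>z. (?d z)\<^sup>2)"
    proof (rule Bochner_Integration.integrable_bound)
      show "integrable \<gamma> (\<lambda>z. 2 * (norm (fst z))\<^sup>2 + 2 * (norm (snd z))\<^sup>2)"
        using int[OF n2] by simp
      have "(?d z)\<^sup>2 \<le> 2 * (norm (fst z))\<^sup>2 + 2 * (norm (snd z))\<^sup>2" for z :: "'a \<times> 'a"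
      proof -
        have "(?d z)\<^sup>2 \<le> (norm (fst z) + norm (snd z))\<^sup>2"
          by (intro power_mono) (auto simp: dist_norm norm_triangle_ineq4)
        also have "\<dots> \<le> 2 * (norm (fst z))\<^sup>2 + 2 * (norm (snd z))\<^sup>2"
          using sum_squares_bound[of "norm (fst z)" "norm (snd z)"] by (simp add: power2_sum)
        finally show ?thesis .
      qed
      then show "AE z in \<gamma>. norm ((?d z)\<^sup>2) \<le> norm (2 * (norm (fst z))\<^sup>2 + 2 * (norm (snd z))\<^sup>2)"
        by simp
    qed simp
    have cs: "integrable \<gamma> (\<lambda>z. norm (p z) * ?d z)"
        "(\<integral>z. norm (p z) * ?d z \<partial>\<gamma>) \<le> sqrt (\<integral>z. (norm (p z))\<^sup>2 \<partial>\<gamma>) * sqrt (?I \<gamma>)"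
      if "integrable \<gamma> (\<lambda>z. (norm (p z))\<^sup>2)" "p \<in> borel_measurable \<gamma>" for p :: "'a \<times> 'a \<Rightarrow> 'b::{real_normed_vector, second_countable_topology}"
      using integral_mult_le_sqrt[OF _ _ that(1) d2] that(2) by simp_all
    have c0: "integrable \<gamma> ?d" "(\<integral>z. ?d z \<partial>\<gamma>) \<le> sqrt (?I \<gamma>)"
      using cs[of "\<lambda>_. 1 :: real"] by (simp_all add: \<gamma>.prob_space)
    have c1: "integrable \<gamma> (\<lambda>z. norm (fst z) * ?d z)"
        "(\<integral>z. norm (fst z) * ?d z \<partial>\<gamma>) \<le> sqrt (m2 \<mu>) * sqrt (?I \<gamma>)"
      using cs[of fst] int[OF n2] eq[OF n2] by (simp_all add: m2_def)
    have c2: "integrable \<gamma> (\<lambda>z. norm (snd z) * ?d z)"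
        "(\<integral>z. norm (snd z) * ?d z \<partial>\<gamma>) \<le> sqrt (m2 \<nu>) * sqrt (?I \<gamma>)"
      using cs[of snd] int[OF n2] eq[OF n2] by (simp_all add: m2_def)
    have "\<bar>(\<integral>x. g x \<partial>\<mu>) - (\<integral>x. g x \<partial>\<nu>)\<bar> = \<bar>\<integral>z. g (fst z) - g (snd z) \<partial>\<gamma>\<bar>"
      using int[OF gi g] eq[OF gi g] by simp
    also have "\<dots> \<le> (\<integral>z. A * ?d z + B * (norm (fst z) * ?d z) + B * (norm (snd z) * ?d z) \<partial>\<gamma>)"
    proof (rule order_trans[OF integral_abs_bound integral_mono])
      show "\<bar>g (fst z) - g (snd z)\<bar> \<le> A * ?d z + B * (norm (fst z) * ?d z) + B * (norm (snd z) * ?d z)"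
        for z using lip[of "fst z" "snd z"] by (simp add: algebra_simps)
    qed (use int[OF gi g] c0 c1 c2 in auto)
    also have "\<dots> = A * (\<integral>z. ?d z \<partial>\<gamma>) + B * (\<integral>z. norm (fst z) * ?d z \<partial>\<gamma>) + B * (\<integral>z. norm (snd z) * ?d z \<partial>\<gamma>)"
      using c0 c1 c2 by simp
    also have "\<dots> \<le> A * sqrt (?I \<gamma>) + B * (sqrt (m2 \<mu>) * sqrt (?I \<gamma>)) + B * (sqrt (m2 \<nu>) * sqrt (?I \<gamma>))"
      using A B c0 c1 c2 by (intro add_mono mult_left_mono)
    also have "\<dots> = ?K * sqrt (?I \<gamma>)" by (simp add: algebra_simps)
    finally show ?thesis .
  qed
  \<comment> \<open>The infimum over couplings is taken under the square root, so \<open>?K\<close> has to be divided out first.\<close>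
  show ?thesis
  proof (cases "?K = 0")
    case True
    then show ?thesis using coupling couplings_nonempty[OF \<mu> \<nu>] by auto
  next
    case False
    then have Kpos: "?K > 0" using K by linarith
    let ?c = "\<bar>(\<integral>x. g x \<partial>\<mu>) - (\<integral>x. g x \<partial>\<nu>)\<bar>"
    have "(?c / ?K)\<^sup>2 \<le> (INF \<gamma>\<in>couplings \<mu> \<nu>. ?I \<gamma>)"
    proof (rule cINF_greatest[OF couplings_nonempty[OF \<mu> \<nu>]])
      fix \<gamma> assume "\<gamma> \<in> couplings \<mu> \<nu>"
      from coupling[OF this] Kpos have "?c / ?K \<le> sqrt (?I \<gamma>)"
        by (simp add: divide_le_eq mult.commute)
      then have "(?c / ?K)\<^sup>2 \<le> (sqrt (?I \<gamma>))\<^sup>2"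
        using Kpos by (intro power_mono) auto
      then show "(?c / ?K)\<^sup>2 \<le> ?I \<gamma>" by simp
    qed
    then have "?c / ?K \<le> W2 \<mu> \<nu>"
      unfolding W2_def by (rule real_le_rsqrt)
    then show ?thesis
      using Kpos by (simp add: divide_le_eq mult.commute)
  qed
qed

lemma W2_nonneg: "\<mu> \<in> P2 \<Longrightarrow> \<nu> \<in> P2 \<Longrightarrow> 0 \<le> W2 \<mu> \<nu>"
  unfolding W2_def by (intro real_sqrt_ge_zero cINF_greatest couplings_nonempty) auto

lemma abs_square_norm_diff_le:
  fixes x y :: "'a::real_normed_vector"
  shows "\<bar>(norm x)\<^sup>2 - (norm y)\<^sup>2\<bar> \<le> (norm x + norm y) * dist x y"
proof -
  have "\<bar>(norm x)\<^sup>2 - (norm y)\<^sup>2\<bar> = (norm x + norm y) * \<bar>norm x - norm y\<bar>"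
    by (simp add: power2_eq_square square_diff_square_factored abs_mult)
  also have "\<dots> \<le> (norm x + norm y) * dist x y"
    by (intro mult_left_mono) (auto simp: dist_norm norm_triangle_ineq3)
  finally show ?thesis .
qed

text \<open>Cancelling the sum of the roots replaces the usual argument through the distance to a Dirac mass,
  for which a triangle inequality would be needed.\<close>

lemma abs_sqrt_m2_diff_le_W2:
  fixes \<mu> \<nu> :: "'a::euclidean_space measure"
  assumes "\<mu> \<in> P2" "\<nu> \<in> P2"
  shows "\<bar>sqrt (m2 \<mu>) - sqrt (m2 \<nu>)\<bar> \<le> W2 \<mu> \<nu>"
proof (cases "sqrt (m2 \<mu>) + sqrt (m2 \<nu>) = 0")
  case True
  then have "sqrt (m2 \<mu>) = 0" "sqrt (m2 \<nu>) = 0"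
    using real_sqrt_ge_zero[OF m2_nonneg[of \<mu>]] real_sqrt_ge_zero[OF m2_nonneg[of \<nu>]]
    by linarith+
  then show ?thesis using W2_nonneg[OF assms] by simp
next
  case False
  let ?s = "sqrt (m2 \<mu>) + sqrt (m2 \<nu>)"
  have s: "?s > 0"
    using False real_sqrt_ge_zero[OF m2_nonneg[of \<mu>]] real_sqrt_ge_zero[OF m2_nonneg[of \<nu>]]
    by linarith
  have "?s * \<bar>sqrt (m2 \<mu>) - sqrt (m2 \<nu>)\<bar> = \<bar>m2 \<mu> - m2 \<nu>\<bar>"
    using s square_diff_square_factored[of "sqrt (m2 \<mu>)" "sqrt (m2 \<nu>)"]
    by (simp add: m2_nonneg abs_mult)
  also have "\<dots> \<le> ?s * W2 \<mu> \<nu>"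
    using abs_integral_diff_le_W2[OF assms, of "\<lambda>x. (norm x)\<^sup>2" 0 1]
    by (simp add: m2_def abs_square_norm_diff_le)
  finally show ?thesis using s by simp
qed

section \<open>Continuous curves of measures as kernels\<close>

lemma continuous_on_integral_P2_curve:
  fixes \<mu> :: "real \<Rightarrow> 'a::euclidean_space measure"
  assumes \<mu>: "continuous_P2_curve \<mu>" and g: "g \<in> borel_measurable borel"
    and A: "A \<ge> 0" and B: "B \<ge> 0"
    and lip: "\<And>x y. \<bar>g x - g y\<bar> \<le> (A + B * (norm x + norm y)) * dist x y"
  shows "continuous_on {0..} (\<lambda>t. \<integral>x. g x \<partial>\<mu> t)"
  unfolding continuous_on_def
proof
  fix t :: real assume t: "t \<in> {0..}"
  have P: "\<mu> s \<in> P2" if "s \<ge> 0" for s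
    using \<mu> that by (auto simp: continuous_P2_curve_def)
  have W: "((\<lambda>s. W2 (\<mu> s) (\<mu> t)) \<longlongrightarrow> 0) (at t within {0..})"
    using \<mu> t by (auto simp: continuous_P2_curve_def)
  have nonneg: "eventually (\<lambda>s. s \<in> {0..}) (at t within {0..})"
    by (simp add: eventually_at_filter)
  have "((\<lambda>s. sqrt (m2 (\<mu> s)) - sqrt (m2 (\<mu> t))) \<longlongrightarrow> 0) (at t within {0..})"
    by (rule Lim_null_comparison[OF eventually_mono[OF nonneg] W])
       (use t abs_sqrt_m2_diff_le_W2[OF P P] in auto)
  then have "((\<lambda>s. sqrt (m2 (\<mu> s)) - sqrt (m2 (\<mu> t)) + sqrt (m2 (\<mu> t))) \<longlongrightarrow> 0 + sqrt (m2 (\<mu> t))) (at t within {0..})"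
    by (intro tendsto_add tendsto_const)
  then have m: "((\<lambda>s. sqrt (m2 (\<mu> s))) \<longlongrightarrow> sqrt (m2 (\<mu> t))) (at t within {0..})"
    by simp
  have "((\<lambda>s. (A + B * (sqrt (m2 (\<mu> s)) + sqrt (m2 (\<mu> t)))) * W2 (\<mu> s) (\<mu> t)) \<longlongrightarrow>
      (A + B * (sqrt (m2 (\<mu> t)) + sqrt (m2 (\<mu> t)))) * 0) (at t within {0..})"
    by (intro tendsto_intros m W)
  then have "((\<lambda>s. (\<integral>x. g x \<partial>\<mu> s) - (\<integral>x. g x \<partial>\<mu> t)) \<longlongrightarrow> 0) (at t within {0..})"
    unfolding mult_zero_right
    by (rule Lim_null_comparison[OF eventually_mono[OF nonneg], rotated])
       (use t abs_integral_diff_le_W2[OF P P g A B lip] in auto)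
  then show "((\<lambda>s. \<integral>x. g x \<partial>\<mu> s) \<longlongrightarrow> (\<integral>x. g x \<partial>\<mu> t)) (at t within {0..})"
    by (rule LIM_zero_cancel)
qed

lemma continuous_extend_left:
  fixes u :: "real \<Rightarrow> real"
  assumes "continuous_on {0..} u"
  shows "continuous_on UNIV (\<lambda>t. u (max 0 t))"
  by (rule continuous_on_compose2[OF assms]) (auto intro!: continuous_intros)

text \<open>The indicator of an open set is the increasing limit of bounded Lipschitz functions, whose
  integrals are continuous in time; the open sets generate the Borel sets.  A curve is given only on
  \<open>[0, \<infinity>)\<close> and is extended by its initial value, so that Borel measurability can be stated on the
  whole line.\<close>

lemma P2_curve_measurable_kernel:
  fixes \<mu> :: "real \<Rightarrow> 'a::euclidean_space measure"
  assumes \<mu>: "continuous_P2_curve \<mu>"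
  shows "(\<lambda>t. \<mu> (max 0 t)) \<in> borel \<rightarrow>\<^sub>M prob_algebra borel"
proof -
  have P: "\<mu> (max 0 t) \<in> P2" for t
    using \<mu> by (auto simp: continuous_P2_curve_def)
  show ?thesis
  proof (rule measurable_prob_algebra_generated[where \<Omega>=UNIV and G="{S. open S}"])
    show "sets (borel :: 'a measure) = sigma_sets UNIV {S. open S}"
      by (simp add: borel_def)
    show "Int_stable {S :: 'a set. open S}"
      by (auto simp: Int_stable_def)
    show "prob_space (\<mu> (max 0 t))" "sets (\<mu> (max 0 t)) = sets borel" for t
      using P2_D[OF P] by auto
    fix U :: "'a set" assume "U \<in> {S. open S}"
    then have U: "open U" by simp
    show "(\<lambda>t. emeasure (\<mu> (max 0 t)) U) \<in> borel_measurable borel"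
    proof (cases "U = UNIV")
      case True
      have "emeasure (\<mu> (max 0 t)) U = 1" for t
        using prob_space.emeasure_space_1[OF P2_D(1)[OF P[of t]]] sets_eq_imp_space_eq[OF P2_D(2)[OF P[of t]]]
        by (simp add: True)
      then show ?thesis by simp
    next
      \<comment> \<open>\<open>infdist\<close> to the empty set is \<open>0\<close>, so the whole space had to be treated separately.\<close>
      case False
      define f where "f k x = min 1 (real k * infdist x (- U))" for k x
      have fm: "f k \<in> borel_measurable borel" for k
        unfolding f_def by (intro borel_measurable_continuous_onI continuous_intros)
      have lip: "\<bar>f k x - f k y\<bar> \<le> (real k + 0 * (norm x + norm y)) * dist x y" for k x y
      proof -
        have "\<bar>f k x - f k y\<bar> \<le> \<bar>real k * infdist x (- U) - real k * infdist y (- U)\<bar>"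
          unfolding f_def by (simp add: min_def)
        also have "\<dots> = real k * \<bar>infdist x (- U) - infdist y (- U)\<bar>"
          by (simp add: abs_mult flip: right_diff_distrib)
        also have "\<dots> \<le> real k * dist x y"
          by (intro mult_left_mono infdist_triangle_abs) simp
        finally show ?thesis by simp
      qed
      have lim: "(\<lambda>k. f k x) \<longlonglongrightarrow> indicator U x" for x
      proof (cases "x \<in> U")
        case True
        have "infdist x (- U) > 0"
          using U False True by (intro infdist_pos_not_in_closed) auto
        then have "filterlim (\<lambda>k. real k * infdist x (- U)) at_top sequentially"
          by (intro filterlim_at_top_mult_tendsto_pos[OF tendsto_const] filterlim_real_sequentially)
             (auto simp: mult.commute)
        then have "eventually (\<lambda>k. real k * infdist x (- U) \<ge> 1) sequentially"
          by (simp add: filterlim_at_top)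
        then show ?thesis
          using True by (intro tendsto_eventually) (auto simp: f_def elim!: eventually_mono)
      qed (simp add: f_def)
      have "(\<lambda>t. measure (\<mu> (max 0 t)) U) \<in> borel_measurable borel"
      proof (rule borel_measurable_LIMSEQ_real)
        fix t :: real
        interpret prob_space "\<mu> (max 0 t)" using P by (rule P2_D)
        have [measurable]: "f k \<in> borel_measurable (\<mu> (max 0 t))"
            "U \<in> sets (\<mu> (max 0 t))" for k
          using fm[of k] U unfolding P2_D(2)[OF P] measurable_cong_sets[OF P2_D(2)[OF P] refl] by auto
        have "(\<lambda>k. \<integral>x. f k x \<partial>\<mu> (max 0 t)) \<longlonglongrightarrow> (\<integral>x. indicator U x \<partial>\<mu> (max 0 t))"
          by (rule integral_dominated_convergence[where w="\<lambda>_. 1"])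
             (auto simp: lim, auto simp: f_def infdist_nonneg)
        then show "(\<lambda>k. \<integral>x. f k x \<partial>\<mu> (max 0 t)) \<longlonglongrightarrow> measure (\<mu> (max 0 t)) U"
          by simp
      next
        fix k
        show "(\<lambda>t. \<integral>x. f k x \<partial>\<mu> (max 0 t)) \<in> borel_measurable borel"
          using continuous_extend_left[OF continuous_on_integral_P2_curve[OF \<mu> fm _ _ lip]]
          by (intro borel_measurable_continuous_onI) auto
      qed
      moreover have "emeasure (\<mu> (max 0 t)) U = ennreal (measure (\<mu> (max 0 t)) U)" for t
        using P2_D(1)[OF P[of t]] by (simp add: prob_space_def finite_measure.emeasure_eq_measure)
      ultimately show ?thesis by simp
    qed
  qed auto
qed

text \<open>The integral is the difference of the integrals of the positive and the negative part where the
  integrand is integrable, and \<open>0\<close> elsewhere; both cases are separated by a measurable condition.\<close>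

lemma borel_measurable_integral_kernel:
  fixes f :: "'a \<Rightarrow> 'b \<Rightarrow> real"
  assumes f[measurable]: "(\<lambda>(x, y). f x y) \<in> borel_measurable (M \<Otimes>\<^sub>M N)"
    and L: "L \<in> M \<rightarrow>\<^sub>M subprob_algebra N"
  shows "(\<lambda>x. \<integral>y. f x y \<partial>L x) \<in> borel_measurable M"
proof -
  let ?n = "\<lambda>h x. \<integral>\<^sup>+y. ennreal (h (f x y)) \<partial>L x"
  have n: "?n h \<in> borel_measurable M" if [measurable]: "h \<in> borel_measurable borel" for h
    by (rule nn_integral_measurable_subprob_algebra2[OF _ L]) measurable
  have "(\<integral>y. f x y \<partial>L x) = (if ?n abs x < \<infinity> then enn2real (?n (\<lambda>r. r) x) - enn2real (?n uminus x) else 0)"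
    if x: "x \<in> space M" for x
  proof -
    have "f x \<in> borel_measurable (L x)"
      unfolding measurable_cong_sets[OF sets_kernel[OF L x] refl]
      using measurable_Pair_compose_split[OF f measurable_const[OF x] measurable_ident]
      by (simp add: id_def)
    then show ?thesis
      by (auto simp: integrable_iff_bounded real_lebesgue_integral_def not_integrable_integral_eq)
  qed
  moreover have "(\<lambda>x. if ?n abs x < \<infinity> then enn2real (?n (\<lambda>r. r) x) - enn2real (?n uminus x) else 0)
      \<in> borel_measurable M"
    using n[of abs] n[of "\<lambda>r. r"] n[of uminus] by measurable
  ultimately show ?thesis
    by (subst measurable_cong) auto
qed

section \<open>Differential inequalities for absolutely continuous functions\<close>

text \<open>Absolute continuity of the integral, in the form needed to neutralise an exceptional null set.\<close>

lemma open_cover_null_set_small_integral: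
  fixes f :: "'a::euclidean_space \<Rightarrow> real"
  assumes f: "integrable lebesgue f" and N: "N \<in> null_sets lebesgue" and e: "e > 0"
  obtains U where "open U" "N \<subseteq> U" "(LINT x:U|lebesgue. \<bar>f x\<bar>) < e"
proof -
  have "\<exists>T. open T \<and> N \<subseteq> T \<and> emeasure lebesgue (T - N) < ennreal (1 / real (Suc n))" for n
    using sets_lebesgue_outer_open[of N "1 / real (Suc n)"] null_setsD2[OF N] by (metis zero_less_divide_1_iff of_nat_0_less_iff zero_less_Suc)
  then obtain T where T: "\<And>n. open (T n)" "\<And>n. N \<subseteq> T n"
      "\<And>n. emeasure lebesgue (T n - N) < ennreal (1 / real (Suc n))"
    by metis
  define V where "V n = (\<Inter>k\<le>n. T k)" for n
  have V: "open (V n)" "N \<subseteq> V n" for n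
    using T by (auto simp: V_def)
  have [measurable]: "T n \<in> sets lebesgue" "V n \<in> sets lebesgue" for n
    using T(1) V(1) by (auto intro: borel_open sets_completionI_sets)
  have "emeasure lebesgue (\<Inter>k. T k) \<le> ennreal (1 / real (Suc n))" for n
  proof -
    have "emeasure lebesgue (\<Inter>k. T k) \<le> emeasure lebesgue (T n)"
      by (intro emeasure_mono) auto
    also have "\<dots> = emeasure lebesgue (T n - N)"
      using N by (simp add: emeasure_Diff_null_set)
    finally show ?thesis using T(3)[of n] by simp
  qed
  moreover have "(\<lambda>n. ennreal (1 / real (Suc n))) \<longlonglongrightarrow> ennreal 0"
    by (intro tendsto_ennrealI LIMSEQ_Suc lim_1_over_n)
  ultimately have "emeasure lebesgue (\<Inter>k. T k) \<le> 0"
    using LIMSEQ_le_const[of _ "ennreal 0"] by (metis ennreal_0)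
  then have "(\<Inter>k. T k) \<in> null_sets lebesgue"
    by (auto intro!: null_setsI)
  then have "AE x in lebesgue. x \<notin> (\<Inter>k. T k)"
    by (rule AE_not_in)
  then have lim: "AE x in lebesgue. (\<lambda>n. indicator (V n) x *\<^sub>R \<bar>f x\<bar>) \<longlonglongrightarrow> 0"
  proof (rule AE_mp, intro AE_I2 impI)
    fix x assume "x \<notin> (\<Inter>k. T k)"
    then obtain k where "x \<notin> T k" by blast
    then have "x \<notin> V n" if "n \<ge> k" for n
      using that by (auto simp: V_def)
    then have "indicator (V n) x *\<^sub>R \<bar>f x\<bar> = 0" if "n \<ge> k" for n
      using that by simp
    then show "(\<lambda>n. indicator (V n) x *\<^sub>R \<bar>f x\<bar>) \<longlonglongrightarrow> 0"
      by (intro tendsto_eventually) (auto simp: eventually_sequentially)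
  qed
  have "(\<lambda>n. \<integral>x. indicator (V n) x *\<^sub>R \<bar>f x\<bar> \<partial>lebesgue) \<longlonglongrightarrow> integral\<^sup>L lebesgue (\<lambda>x::'a. 0)"
  proof (rule integral_dominated_convergence[where w="\<lambda>x. \<bar>f x\<bar>"])
    show "(\<lambda>x. indicator (V n) x *\<^sub>R \<bar>f x\<bar>) \<in> borel_measurable lebesgue" for n
      using borel_measurable_integrable[OF f] by measurable
    show "AE x in lebesgue. norm (indicator (V n) x *\<^sub>R \<bar>f x\<bar>) \<le> \<bar>f x\<bar>" for n
      by (intro AE_I2) (simp add: indicator_def)
  qed (use f lim in auto)
  then have "eventually (\<lambda>n. (\<integral>x. indicator (V n) x *\<^sub>R \<bar>f x\<bar> \<partial>lebesgue) < e) sequentially"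
    using e by (auto intro: order_tendstoD)
  then obtain n where "(\<integral>x. indicator (V n) x *\<^sub>R \<bar>f x\<bar> \<partial>lebesgue) < e"
    using eventually_happens'[OF sequentially_bot] by blast
  then show ?thesis
    using that[OF V] by (simp add: set_lebesgue_integral_def)
qed

text \<open>The fundamental theorem of calculus for absolutely continuous functions, as an inequality.  It is
  proved with gauges instead of Lebesgue's differentiation theorem: on a sufficiently fine tagged
  partition, a cell with a good tag contributes at most \<open>g + e\<close> times its length, while the cells with
  tags in the null set lie in an open set on which \<open>|m|\<close> has integral below \<open>e\<close>, so absolute
  continuity bounds their total contribution.\<close>

lemma increment_le_integral_upper_derivative:
  fixes H g m :: "real \<Rightarrow> real"
  assumes ab: "a \<le> b"
    and m: "set_integrable lebesgue {a..b} m"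
    and AC: "\<And>s t. a \<le> s \<Longrightarrow> s \<le> t \<Longrightarrow> t \<le> b \<Longrightarrow> H t - H s \<le> (LINT u:{s..t}|lebesgue. m u)"
    and g: "set_integrable lebesgue {a..b} g"
    and D: "AE t in lebesgue. a < t \<and> t < b \<longrightarrow>
      (\<forall>e>0. \<forall>\<^sub>F s in at t. (H s - H t) / (s - t) \<le> g t + e)"
  shows "H b - H a \<le> (LINT t:{a..b}|lebesgue. g t)"
proof -
  let ?I = "LINT t:{a..b}|lebesgue. g t"
  obtain N0 where N0: "N0 \<in> null_sets lebesgue"
    and bad: "{t \<in> space lebesgue. \<not> (a < t \<and> t < b \<longrightarrow>
      (\<forall>e>0. \<forall>\<^sub>F s in at t. (H s - H t) / (s - t) \<le> g t + e))} \<subseteq> N0"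
    using D unfolding eventually_ae_filter by blast
  \<comment> \<open>The end points join the null set: the derivative bound concerns interior tags only.\<close>
  define N where "N = N0 \<union> {a, b}"
  have N: "N \<in> null_sets lebesgue"
    unfolding N_def using N0 by (intro null_sets.Un) (auto simp: null_sets_completionI)
  have good: "\<forall>\<^sub>F s in at t. (H s - H t) / (s - t) \<le> g t + e"
    if "t \<notin> N" "a < t" "t < b" "e > 0" for t e
    using that bad by (auto simp: N_def)
  define g' where "g' t = (if t \<in> N then 0 else g t)" for t
  have "(g has_integral ?I) {a..b}"
    using g set_lebesgue_integral_eq_integral[OF g] by (simp add: has_integral_integral)
  then have g': "(g' has_integral ?I) (cbox a b)"
    using has_integral_spike[of N "{a..b}" g' g ?I] N
    by (simp add: negligible_iff_null_sets g'_def)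
  have main: "H b - H a \<le> ?I + e * (2 + (b - a))" if e: "e > 0" for e
  proof -
    obtain U where U: "open U" "N \<subseteq> U"
      and small: "(LINT x:U|lebesgue. \<bar>indicator {a..b} x *\<^sub>R m x\<bar>) < e"
      using open_cover_null_set_small_integral[OF _ N e] m unfolding set_integrable_def by blast
    have Um[measurable]: "U \<in> sets lebesgue"
      using U(1) by (auto intro: borel_open sets_completionI_sets)
    \<comment> \<open>Adding the integral of \<open>m1\<close> over every cell, with good tag or bad, lets the sum telescope to a
      single small integral.\<close>
    define m1 where "m1 x = (if x \<in> U then \<bar>m x\<bar> else 0)" for x
    have eq: "indicator {a..b} x *\<^sub>R m1 x = indicator U x *\<^sub>R \<bar>indicator {a..b} x *\<^sub>R m x\<bar>" for x
      by (simp add: m1_def indicator_def)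
    have m1: "set_integrable lebesgue {a..b} m1"
      using m unfolding set_integrable_def eq
      by (intro integrable_mult_indicator Um) auto
    have m1_small: "integral {a..b} m1 < e"
      using small set_lebesgue_integral_eq_integral(2)[OF m1]
      unfolding set_lebesgue_integral_def eq by simp
    have sub: "set_integrable lebesgue {u..v} f"
      if "set_integrable lebesgue {a..b} f" "{u..v} \<subseteq> {a..b}" for u v and f :: "real \<Rightarrow> real"
      using set_integrable_subset[OF that(1) _ that(2)] by simp
    obtain \<gamma>1 where \<gamma>1: "gauge \<gamma>1"
      and riemann: "\<And>D. D tagged_division_of cbox a b \<Longrightarrow> \<gamma>1 fine D \<Longrightarrow>
          norm ((\<Sum>(x, K)\<in>D. measure lborel K *\<^sub>R g' x) - ?I) < e"
      using g' e unfolding has_integral by metis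
    have "\<exists>V. open V \<and> t \<in> V \<and> (t \<in> N \<longrightarrow> V \<subseteq> U) \<and>
        (t \<notin> N \<and> a < t \<and> t < b \<longrightarrow> (\<forall>s\<in>V. s \<noteq> t \<longrightarrow> (H s - H t) / (s - t) \<le> g t + e))" for t
    proof (cases "t \<in> N")
      case True
      then show ?thesis using U by blast
    next
      case False
      show ?thesis
      proof (cases "a < t \<and> t < b")
        case True
        then show ?thesis
          using good[OF False _ _ e] False unfolding eventually_at_topological by blast
      qed (use False in auto)
    qed
    then obtain \<gamma>2 where \<gamma>2: "\<And>t. open (\<gamma>2 t)" "\<And>t. t \<in> \<gamma>2 t" "\<And>t. t \<in> N \<Longrightarrow> \<gamma>2 t \<subseteq> U"
      and quot: "\<And>t s. t \<notin> N \<Longrightarrow> a < t \<Longrightarrow> t < b \<Longrightarrow> s \<in> \<gamma>2 t \<Longrightarrow> s \<noteq> t \<Longrightarrow>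
        (H s - H t) / (s - t) \<le> g t + e"
      by metis
    have "gauge (\<lambda>x. \<gamma>1 x \<inter> \<gamma>2 x)"
      using \<gamma>1 \<gamma>2 by (intro gauge_Int) (auto simp: gauge_def)
    then obtain D where D: "D tagged_division_of cbox a b" and "(\<lambda>x. \<gamma>1 x \<inter> \<gamma>2 x) fine D"
      using fine_division_exists by blast
    then have fine: "\<gamma>1 fine D" "\<gamma>2 fine D"
      by (simp_all add: fine_Int)
    have piece: "H (Sup K) - H (Inf K) \<le> measure lborel K *\<^sub>R g' x + e * (Sup K - Inf K) + integral K m1"
      if xK: "(x, K) \<in> D" for x K
    proof -
      obtain u v where K: "K = {u..v}"
        using tagged_division_ofD(4)[OF D xK] by auto
      have "x \<in> K" "K \<subseteq> {a..b}" "K \<subseteq> \<gamma>2 x"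
        using tagged_division_ofD(2,3)[OF D xK] fine(2) xK by (auto simp: fine_def)
      then have uv: "u \<le> x" "x \<le> v" "a \<le> u" "v \<le> b" "{u..v} \<subseteq> \<gamma>2 x"
        by (auto simp: K)
      have SI: "Sup K = v" "Inf K = u" "measure lborel K = v - u"
        using uv by (auto simp: K)
      have m1K: "m1 integrable_on {u..v}"
        using set_lebesgue_integral_eq_integral(1)[OF sub[OF m1]] uv by auto
      show ?thesis
      proof (cases "x \<in> N")
        case True
        then have inU: "{u..v} \<subseteq> U" using \<gamma>2(3) uv by blast
        have mK: "set_integrable lebesgue {u..v} m" using sub[OF m] uv by auto
        have "H v - H u \<le> (LINT t:{u..v}|lebesgue. m t)"
          using AC uv by auto
        also have "\<dots> = integral {u..v} m"
          by (rule set_lebesgue_integral_eq_integral(2)[OF mK])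
        also have "\<dots> \<le> integral {u..v} m1"
          using inU by (intro integral_le m1K set_lebesgue_integral_eq_integral(1)[OF mK])
            (auto simp: m1_def)
        finally have "H v - H u \<le> integral {u..v} m1" .
        moreover have "0 \<le> e * (v - u)" using uv e by simp
        moreover have "g' x = 0" using True by (simp add: g'_def)
        ultimately show ?thesis
          unfolding SI unfolding K by (simp only: scaleR_zero_right)
      next
        case False
        then have "x \<noteq> a" "x \<noteq> b" by (auto simp: N_def)
        then have x: "a < x" "x < b" using uv by auto
        have "H v - H x \<le> (g x + e) * (v - x)"
        proof (cases "v = x")
          case False
          then show ?thesis
            using quot[OF \<open>x \<notin> N\<close> x, of v] uv by (simp add: divide_le_eq subset_iff)
        qed simp
        moreover have "H x - H u \<le> (g x + e) * (x - u)"
        proof (cases "u = x")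
          case False
          then have "(H u - H x) / (u - x) \<le> g x + e"
            using quot[OF \<open>x \<notin> N\<close> x, of u] uv by (simp add: subset_iff)
          moreover have "(H u - H x) / (u - x) = (H x - H u) / (x - u)"
            by (simp add: divide_simps) (simp add: algebra_simps)
          ultimately show ?thesis
            using False uv by (simp add: divide_le_eq)
        qed simp
        ultimately have "H v - H u \<le> (g x + e) * (v - u)"
          by (simp add: algebra_simps)
        moreover have "integral {u..v} m1 \<ge> 0"
          by (intro integral_nonneg m1K) (auto simp: m1_def)
        ultimately show ?thesis
          using False unfolding SI unfolding K by (simp add: g'_def algebra_simps)
      qed
    qed
    have "H b - H a = (\<Sum>(x, K)\<in>D. H (Sup K) - H (Inf K))"
      using additive_tagged_division_1[OF ab, of D H] D by simp
    also have "\<dots> \<le> (\<Sum>(x, K)\<in>D. measure lborel K *\<^sub>R g' x + e * (Sup K - Inf K) + integral K m1)"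
      using piece by (intro sum_mono) auto
    also have "\<dots> = (\<Sum>(x, K)\<in>D. measure lborel K *\<^sub>R g' x) + e * (\<Sum>(x, K)\<in>D. Sup K - Inf K)
        + (\<Sum>(x, K)\<in>D. integral K m1)"
      by (simp add: case_prod_unfold sum.distrib sum_distrib_left)
    also have "(\<Sum>(x, K)\<in>D. Sup K - Inf K) = b - a"
      using additive_tagged_division_1[OF ab, of D "\<lambda>x. x"] D by simp
    also have "(\<Sum>(x, K)\<in>D. integral K m1) = integral {a..b} m1"
      using integral_combine_tagged_division_topdown[of m1 a b D] D
        set_lebesgue_integral_eq_integral(1)[OF m1] by simp
    also have "(\<Sum>(x, K)\<in>D. measure lborel K *\<^sub>R g' x) + e * (b - a) + integral {a..b} m1
        \<le> (?I + e) + e * (b - a) + e"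
      using riemann[OF D fine(1)] m1_small by (simp add: abs_if split: if_splits)
    finally show ?thesis by (simp add: algebra_simps)
  qed
  show ?thesis
  proof (rule field_le_epsilon)
    fix e :: real assume "e > 0"
    then show "H b - H a \<le> ?I + e"
      using main[of "e / (2 + (b - a))"] ab by simp
  qed
qed

text \<open>The integrability of \<open>w\<close> is a conclusion.  The upper bound \<open>0\<close> on the derivative makes \<open>h\<close>
  nonincreasing; then \<open>w\<close> is measurable as a limit of difference quotients, and the truncations
  \<open>- min w N\<close> are integrable upper bounds of the derivative, whose integrals are controlled by the
  decrement of \<open>h\<close> uniformly in \<open>N\<close>.\<close>

lemma decreasing_AC_derivative_integrable:
  fixes h w m :: "real \<Rightarrow> real"
  assumes ab: "a \<le> b"
    and m: "set_integrable lebesgue {a..b} m"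
    and AC: "\<And>s t. a \<le> s \<Longrightarrow> s \<le> t \<Longrightarrow> t \<le> b \<Longrightarrow> h t - h s \<le> (LINT u:{s..t}|lebesgue. m u)"
    and w: "\<And>t. 0 \<le> w t"
    and D: "AE t in lebesgue. a < t \<and> t < b \<longrightarrow> (h has_real_derivative - w t) (at t)"
  shows "set_integrable lebesgue {a..b} w" and "(LINT t:{a..b}|lebesgue. w t) \<le> h a - h b"
proof -
  have upper: "AE t in lebesgue. a < t \<and> t < b \<longrightarrow>
      (\<forall>e>0. \<forall>\<^sub>F s in at t. (h s - h t) / (s - t) \<le> g t + e)"
    if "\<And>t. - w t \<le> g t" for g
    using D
  proof (rule AE_mp, intro AE_I2 impI allI)
    fix t e :: real
    assume "a < t \<and> t < b \<longrightarrow> (h has_real_derivative - w t) (at t)" "a < t \<and> t < b" "0 < e"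
    then have "((\<lambda>s. (h s - h t) / (s - t)) \<longlongrightarrow> - w t) (at t)" "- w t < g t + e"
      using that[of t] by (auto simp: has_field_derivative_iff)
    from order_tendstoD(2)[OF this]
    show "\<forall>\<^sub>F s in at t. (h s - h t) / (s - t) \<le> g t + e"
      by (rule eventually_mono) simp
  qed
  have anti: "h t \<le> h s" if "a \<le> s" "s \<le> t" "t \<le> b" for s t
  proof -
    have "h t - h s \<le> (LINT u:{s..t}|lebesgue. 0)"
    proof (rule increment_le_integral_upper_derivative[OF \<open>s \<le> t\<close>])
      show "set_integrable lebesgue {s..t} m"
        using set_integrable_subset[OF m, of "{s..t}"] that by auto
      have "AE u in lebesgue. a < u \<and> u < b \<longrightarrow>
          (\<forall>e>0. \<forall>\<^sub>F r in at u. (h r - h u) / (r - u) \<le> 0 + e)"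
        using upper[of "\<lambda>_. 0"] w by simp
      then show "AE u in lebesgue. s < u \<and> u < t \<longrightarrow>
          (\<forall>e>0. \<forall>\<^sub>F r in at u. (h r - h u) / (r - u) \<le> 0 + e)"
        by (rule AE_mp) (intro AE_I2, use that in simp)
    qed (use that AC in \<open>auto simp: set_integrable_def\<close>)
    then show ?thesis by (simp add: set_lebesgue_integral_def)
  qed
  \<comment> \<open>Extending \<open>- h\<close> constantly keeps it monotone, hence Borel on the whole line.\<close>
  define k where "k t = - h (max a (min b t))" for t
  have "mono k"
    unfolding k_def using ab by (intro monoI) (auto intro!: anti)
  then have k[measurable]: "k \<in> borel_measurable borel"
    by (rule borel_measurable_mono)
  define q where "q n t = indicator {a<..<b} t * (real (Suc n) * (k (t + 1 / real (Suc n)) - k t))" for n t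
  have q: "q n \<in> borel_measurable lebesgue" for n
    unfolding q_def by (intro measurable_completion) measurable
  have "AE t in lebesgue. (\<lambda>n. q n t) \<longlonglongrightarrow> indicator {a<..<b} t * w t"
    using D
  proof (rule AE_mp, intro AE_I2 impI)
    fix t assume *: "a < t \<and> t < b \<longrightarrow> (h has_real_derivative - w t) (at t)"
    show "(\<lambda>n. q n t) \<longlonglongrightarrow> indicator {a<..<b} t * w t"
    proof (cases "a < t \<and> t < b")
      case True
      have "((\<lambda>t. - h t) has_real_derivative w t) (at t)"
        using DERIV_minus[of h "- w t"] * True by simp
      then have "(k has_real_derivative w t) (at t)"
        by (rule has_field_derivative_transform_within_open[where S="{a<..<b}"])
           (use True in \<open>auto simp: k_def\<close>)
      then have "((\<lambda>d. (k (t + d) - k t) / d) \<longlongrightarrow> w t) (at 0)"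
        by (simp add: DERIV_def)
      moreover have "filterlim (\<lambda>n. 1 / real (Suc n)) (at 0) sequentially"
        using LIMSEQ_Suc[OF lim_1_over_n] by (auto simp: filterlim_at)
      ultimately have "(\<lambda>n. (k (t + 1 / real (Suc n)) - k t) / (1 / real (Suc n))) \<longlonglongrightarrow> w t"
        by (rule filterlim_compose)
      then show ?thesis
        using True by (simp add: q_def mult.commute)
    qed (auto simp: q_def)
  qed
  then have "AE t in lebesgue. lim (\<lambda>n. q n t) = indicator {a<..<b} t * w t"
    by (rule AE_mp) (auto intro!: AE_I2 limI)
  moreover have "AE t in lebesgue. t \<notin> {a, b}"
    by (intro AE_not_in) (auto simp: null_sets_completionI)
  ultimately have "AE t in lebesgue. lim (\<lambda>n. q n t) = indicator {a..b} t *\<^sub>R w t"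
    by eventually_elim (auto simp: indicator_def)
  from borel_measurable_AE[OF borel_measurable_lim_metric[OF q] this]
  have wm[measurable]: "(\<lambda>t. indicator {a..b} t *\<^sub>R w t) \<in> borel_measurable lebesgue" .
  define r where "r N t = indicator {a..b} t *\<^sub>R min (w t) (real N)" for N t
  have r_alt: "r N t = min (indicator {a..b} t *\<^sub>R w t) (real N)" for N t
    using w[of t] by (auto simp: r_def indicator_def)
  have rm[measurable]: "r N \<in> borel_measurable lebesgue" for N
    unfolding r_alt[abs_def] by measurable
  have r_int: "integrable lebesgue (r N)" for N
  proof (rule Bochner_Integration.integrable_bound[of _ "\<lambda>t. indicator {a..b} t *\<^sub>R real N"])
    show "AE t in lebesgue. norm (r N t) \<le> norm (indicator {a..b} t *\<^sub>R real N)"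
      using w by (auto simp: r_def indicator_def)
    show "integrable lebesgue (\<lambda>t. indicator {a..b} t *\<^sub>R real N)"
      by (intro integrable_scaleR_left integrable_real_indicator) (auto simp: emeasure_lborel_Icc_eq)
  qed (rule rm)
  have r_le: "(\<integral>t. r N t \<partial>lebesgue) \<le> h a - h b" for N
  proof -
    have "h b - h a \<le> (LINT t:{a..b}|lebesgue. - min (w t) (real N))"
    proof (rule increment_le_integral_upper_derivative[OF ab m AC])
      show "set_integrable lebesgue {a..b} (\<lambda>t. - min (w t) (real N))"
        using r_int[of N] unfolding r_def[abs_def] by (simp add: set_integrable_def)
    qed (use upper[of "\<lambda>t. - min (w t) (real N)"] in auto)
    then show ?thesis by (simp add: set_lebesgue_integral_def r_def)
  qed
  have "(\<integral>\<^sup>+t. ennreal (indicator {a..b} t *\<^sub>R w t) \<partial>lebesgue) = (SUP N. \<integral>\<^sup>+t. ennreal (r N t) \<partial>lebesgue)"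
  proof -
    have "ennreal (indicator {a..b} t *\<^sub>R w t) = (SUP N. ennreal (r N t))" for t
    proof -
      obtain N where "w t \<le> real N" using real_arch_simple by blast
      then have "ennreal (indicator {a..b} t *\<^sub>R w t) \<le> (SUP N. ennreal (r N t))"
        by (intro SUP_upper2[of N]) (auto simp: r_def indicator_def)
      moreover have "(SUP N. ennreal (r N t)) \<le> ennreal (indicator {a..b} t *\<^sub>R w t)"
        by (intro SUP_least ennreal_leI) (simp add: r_alt)
      ultimately show ?thesis by (rule antisym)
    qed
    moreover have "(\<integral>\<^sup>+t. (SUP N. ennreal (r N t)) \<partial>lebesgue) = (SUP N. \<integral>\<^sup>+t. ennreal (r N t) \<partial>lebesgue)"
    proof (rule nn_integral_monotone_convergence_SUP)
      show "incseq (\<lambda>N t. ennreal (r N t))"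
        by (auto simp: incseq_def le_fun_def r_alt intro!: ennreal_leI)
    qed measurable
    ultimately show ?thesis by simp
  qed
  also have "\<dots> \<le> ennreal (h a - h b)"
  proof (rule SUP_least)
    fix N
    have "(\<integral>\<^sup>+t. ennreal (r N t) \<partial>lebesgue) = ennreal (\<integral>t. r N t \<partial>lebesgue)"
      using w by (intro nn_integral_eq_integral r_int) (auto simp: r_def)
    then show "(\<integral>\<^sup>+t. ennreal (r N t) \<partial>lebesgue) \<le> ennreal (h a - h b)"
      using r_le[of N] by (simp add: ennreal_leI)
  qed
  finally have le: "(\<integral>\<^sup>+t. ennreal (indicator {a..b} t *\<^sub>R w t) \<partial>lebesgue) \<le> ennreal (h a - h b)" .
  have int: "integrable lebesgue (\<lambda>t. indicator {a..b} t *\<^sub>R w t)"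
    by (rule integrableI_nonneg[OF wm]) (use w le in \<open>auto intro: le_less_trans\<close>)
  then show "set_integrable lebesgue {a..b} w" by (simp add: set_integrable_def)
  have "ennreal (\<integral>t. indicator {a..b} t *\<^sub>R w t \<partial>lebesgue) \<le> ennreal (h a - h b)"
    using le w by (subst nn_integral_eq_integral[OF int, symmetric]) auto
  then show "(LINT t:{a..b}|lebesgue. w t) \<le> h a - h b"
    using anti[of a b] ab by (simp add: set_lebesgue_integral_def)
qed

section \<open>The second moment along curves of finite metric speed\<close>

text \<open>One constant \<open>B\<close> serves both bounds because only the boundedness of the curve on \<open>[0, T]\<close> matters.\<close>

lemma AC2_loc_curve_speed:
  fixes \<mu> :: "real \<Rightarrow> 'a::euclidean_space measure"
  assumes \<mu>: "AC2_loc_curve \<mu>" and T: "0 \<le> T"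
  obtains m :: "real \<Rightarrow> real" and B where
    "set_integrable lebesgue {0..T} m"
    "\<And>s t. 0 \<le> s \<Longrightarrow> s \<le> t \<Longrightarrow> t \<le> T \<Longrightarrow> W2 (\<mu> s) (\<mu> t) \<le> (LINT u:{s..t}|lebesgue. m u)"
    "\<And>t. 0 \<le> t \<Longrightarrow> t \<le> T \<Longrightarrow> W2 (\<mu> 0) (\<mu> t) \<le> B"
    "\<And>t. 0 \<le> t \<Longrightarrow> t \<le> T \<Longrightarrow> sqrt (m2 (\<mu> t)) \<le> B"
proof -
  have P: "\<mu> t \<in> P2" if "t \<ge> 0" for t
    using \<mu> that by (simp add: AC2_loc_curve_def)
  obtain m :: "real \<Rightarrow> real" where mm: "set_borel_measurable lebesgue {0..T} m"
    and msq: "set_integrable lebesgue {0..T} (\<lambda>u. (m u)\<^sup>2)"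
    and W: "\<And>s t. 0 \<le> s \<Longrightarrow> s \<le> t \<Longrightarrow> t \<le> T \<Longrightarrow> W2 (\<mu> s) (\<mu> t) \<le> (LINT u:{s..t}|lebesgue. m u)"
    using \<mu>[unfolded AC2_loc_curve_def, THEN conjunct2, rule_format, of 0 T] T by auto
  have m: "set_integrable lebesgue {0..T} m"
    unfolding set_integrable_def
  proof (rule Bochner_Integration.integrable_bound)
    have "integrable lebesgue (\<lambda>u. indicator {0..T} u *\<^sub>R (1::real))"
      by (intro integrable_scaleR_left integrable_real_indicator) (auto simp: emeasure_lborel_Icc_eq)
    then show "integrable lebesgue (\<lambda>u. indicator {0..T} u *\<^sub>R (1::real) + indicator {0..T} u *\<^sub>R (m u)\<^sup>2)"
      by (intro Bochner_Integration.integrable_add msq[unfolded set_integrable_def])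
    show "(\<lambda>u. indicator {0..T} u *\<^sub>R m u) \<in> borel_measurable lebesgue"
      using mm by (simp add: set_borel_measurable_def)
    have "\<bar>m u\<bar> \<le> 1 + (m u)\<^sup>2" for u
      using sum_squares_bound[of "\<bar>m u\<bar>" 1] abs_ge_zero[of "m u"]
      unfolding one_power2 power2_abs by linarith
    then have "\<bar>m u\<bar> \<le> \<bar>1 + (m u)\<^sup>2\<bar>" for u
      by (rule order_trans[OF _ abs_ge_self])
    then have "norm (indicator {0..T} u *\<^sub>R m u)
        \<le> norm (indicator {0..T} u *\<^sub>R (1::real) + indicator {0..T} u *\<^sub>R (m u)\<^sup>2)" for u
      by (simp add: indicator_def)
    then show "AE u in lebesgue. norm (indicator {0..T} u *\<^sub>R m u)
        \<le> norm (indicator {0..T} u *\<^sub>R (1::real) + indicator {0..T} u *\<^sub>R (m u)\<^sup>2)"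
      by (rule AE_I2)
  qed
  define M where "M = (LINT u:{0..T}|lebesgue. \<bar>m u\<bar>)"
  have abs: "set_integrable lebesgue {0..T} (\<lambda>u. \<bar>m u\<bar>)"
    using set_integrable_abs[OF m] .
  have M: "W2 (\<mu> 0) (\<mu> t) \<le> M" if "0 \<le> t" "t \<le> T" for t
  proof -
    have "W2 (\<mu> 0) (\<mu> t) \<le> (LINT u:{0..t}|lebesgue. m u)"
      using W that by simp
    also have "\<dots> \<le> M"
      unfolding M_def set_lebesgue_integral_def
    proof (rule integral_mono)
      show "integrable lebesgue (\<lambda>u. indicator {0..t} u *\<^sub>R m u)"
        using set_integrable_subset[OF m, of "{0..t}"] that by (simp add: set_integrable_def)
      show "integrable lebesgue (\<lambda>u. indicator {0..T} u *\<^sub>R \<bar>m u\<bar>)"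
        using abs by (simp add: set_integrable_def)
      show "indicator {0..t} u *\<^sub>R m u \<le> indicator {0..T} u *\<^sub>R \<bar>m u\<bar>" for u
        using that by (cases "u \<in> {0..t}"; cases "u \<in> {0..T}") auto
    qed
    finally show ?thesis .
  qed
  show ?thesis
  proof (rule that[OF m W])
    fix t assume t: "0 \<le> t" "t \<le> T"
    show "W2 (\<mu> 0) (\<mu> t) \<le> M + sqrt (m2 (\<mu> 0))"
      using M[OF t] real_sqrt_ge_zero[OF m2_nonneg[of "\<mu> 0"]] by linarith
    show "sqrt (m2 (\<mu> t)) \<le> M + sqrt (m2 (\<mu> 0))"
      using M[OF t] abs_sqrt_m2_diff_le_W2[OF P P, of 0 t] t by linarith
  qed
qed

lemma has_metric_derivative_imp_W2_tendsto_0: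
  assumes "has_metric_derivative \<mu> v t"
  shows "((\<lambda>s. W2 (\<mu> s) (\<mu> t)) \<longlongrightarrow> 0) (at t)"
proof -
  have "((\<lambda>s. W2 (\<mu> s) (\<mu> t) / \<bar>s - t\<bar> * \<bar>s - t\<bar>) \<longlongrightarrow> v * \<bar>t - t\<bar>) (at t)"
    using assms by (intro tendsto_intros) (auto simp: has_metric_derivative_def)
  then have "((\<lambda>s. W2 (\<mu> s) (\<mu> t) / \<bar>s - t\<bar> * \<bar>s - t\<bar>) \<longlongrightarrow> 0) (at t)"
    by simp
  then show ?thesis
    by (rule Lim_transform_eventually) (auto simp: eventually_at_filter)
qed

lemma weighted_m2_upper_derivative:
  fixes \<mu> :: "real \<Rightarrow> 'a::euclidean_space measure"
  assumes P: "\<And>s. 0 \<le> s \<Longrightarrow> \<mu> s \<in> P2" and t: "0 < t"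
    and v: "has_metric_derivative \<mu> v t" and e: "0 < e"
  shows "\<forall>\<^sub>F s in at t. (exp (- s) * m2 (\<mu> s) - exp (- t) * m2 (\<mu> t)) / (s - t) \<le> exp (- t) * v\<^sup>2 + e"
proof -
  define f where "f s = sqrt (m2 (\<mu> s))" for s
  have f: "m2 (\<mu> s) = (f s)\<^sup>2" "f s \<ge> 0" for s
    by (simp_all add: f_def m2_nonneg)
  define Q where "Q s = exp (- s) * (f s + f t) * (W2 (\<mu> s) (\<mu> t) / \<bar>s - t\<bar>)
      + (f t)\<^sup>2 * ((exp (- s) - exp (- t)) / (s - t))" for s
  have pos: "\<forall>\<^sub>F s in at t. 0 < s"
    using t eventually_at_in_open'[of "{0<..}" t] by auto
  have lip: "\<forall>\<^sub>F s in at t. \<bar>f s - f t\<bar> \<le> W2 (\<mu> s) (\<mu> t)"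
    using pos by eventually_elim (use t abs_sqrt_m2_diff_le_W2[OF P P] in \<open>auto simp: f_def\<close>)
  have "((\<lambda>s. f s - f t) \<longlongrightarrow> 0) (at t)"
    by (rule Lim_null_comparison[OF _ has_metric_derivative_imp_W2_tendsto_0[OF v]]) (use lip in simp)
  then have ft: "(f \<longlongrightarrow> f t) (at t)"
    by (rule LIM_zero_cancel)
  have "((\<lambda>s. exp (- s)) has_real_derivative - exp (- t)) (at t)"
    by (auto intro!: derivative_eq_intros)
  then have "((\<lambda>s. (exp (- s) - exp (- t)) / (s - t)) \<longlongrightarrow> - exp (- t)) (at t)"
    by (simp add: has_field_derivative_iff)
  then have Q: "(Q \<longlongrightarrow> exp (- t) * (f t + f t) * v + (f t)\<^sup>2 * (- exp (- t))) (at t)"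
    unfolding Q_def using v by (intro tendsto_intros ft) (simp_all add: has_metric_derivative_def)
  \<comment> \<open>Young's inequality \<open>2 f v - f\<^sup>2 \<le> v\<^sup>2\<close>; this is where the weight \<open>exp (- t)\<close> absorbs \<open>m2\<close>.\<close>
  have "exp (- t) * (f t + f t) * v + (f t)\<^sup>2 * (- exp (- t)) = exp (- t) * (v\<^sup>2 - (f t - v)\<^sup>2)"
    by (simp add: power2_eq_square algebra_simps)
  also have "\<dots> \<le> exp (- t) * v\<^sup>2"
    by (intro mult_left_mono) auto
  finally have "exp (- t) * (f t + f t) * v + (f t)\<^sup>2 * (- exp (- t)) < exp (- t) * v\<^sup>2 + e"
    using e by linarith
  then have "\<forall>\<^sub>F s in at t. Q s < exp (- t) * v\<^sup>2 + e"
    using order_tendstoD(2)[OF Q] by blast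
  moreover have "\<forall>\<^sub>F s in at t. s \<noteq> t"
    by (simp add: eventually_at_filter)
  ultimately show ?thesis
    using lip
  proof eventually_elim
    case (elim s)
    have "((f s)\<^sup>2 - (f t)\<^sup>2) / (s - t) \<le> \<bar>((f s)\<^sup>2 - (f t)\<^sup>2) / (s - t)\<bar>"
      by (rule abs_ge_self)
    also have "\<dots> = (f s + f t) * (\<bar>f s - f t\<bar> / \<bar>s - t\<bar>)"
      using f(2)[of s] f(2)[of t] by (simp add: power2_eq_square square_diff_square_factored abs_mult)
    also have "\<dots> \<le> (f s + f t) * (W2 (\<mu> s) (\<mu> t) / \<bar>s - t\<bar>)"
      using f(2)[of s] f(2)[of t] elim by (intro mult_left_mono divide_right_mono) auto
    finally have "exp (- s) * (((f s)\<^sup>2 - (f t)\<^sup>2) / (s - t))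
        \<le> exp (- s) * ((f s + f t) * (W2 (\<mu> s) (\<mu> t) / \<bar>s - t\<bar>))"
      by (rule mult_left_mono) simp
    moreover have "(exp (- s) * (f s)\<^sup>2 - exp (- t) * (f t)\<^sup>2) / (s - t)
        = exp (- s) * (((f s)\<^sup>2 - (f t)\<^sup>2) / (s - t)) + (f t)\<^sup>2 * ((exp (- s) - exp (- t)) / (s - t))"
      by (simp add: add_divide_distrib diff_divide_distrib algebra_simps)
    ultimately have "(exp (- s) * (f s)\<^sup>2 - exp (- t) * (f t)\<^sup>2) / (s - t) \<le> Q s"
      unfolding Q_def mult.assoc by linarith
    then show ?case
      using elim(1) unfolding f(1) by linarith
  qed
qed

lemma m2_growth_along_AC2_curve:
  fixes \<mu> :: "real \<Rightarrow> 'a::euclidean_space measure"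
  assumes \<mu>: "AC2_loc_curve \<mu>" and T: "0 \<le> T"
    and w: "AE t in lebesgue. 0 < t \<longrightarrow> (\<exists>v. has_metric_derivative \<mu> v t \<and> v\<^sup>2 = w t)"
    and int: "set_integrable lebesgue {0..T} (\<lambda>t. exp (- t) * w t)"
  shows "exp (- T) * m2 (\<mu> T) - m2 (\<mu> 0) \<le> (LINT t:{0..T}|lebesgue. exp (- t) * w t)"
proof -
  have P: "\<mu> t \<in> P2" if "t \<ge> 0" for t
    using \<mu> that by (simp add: AC2_loc_curve_def)
  obtain m :: "real \<Rightarrow> real" and B where m: "set_integrable lebesgue {0..T} m"
    and W: "\<And>s t. 0 \<le> s \<Longrightarrow> s \<le> t \<Longrightarrow> t \<le> T \<Longrightarrow> W2 (\<mu> s) (\<mu> t) \<le> (LINT u:{s..t}|lebesgue. m u)"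
    and B: "\<And>t. 0 \<le> t \<Longrightarrow> t \<le> T \<Longrightarrow> sqrt (m2 (\<mu> t)) \<le> B"
    by (rule AC2_loc_curve_speed[OF \<mu> T]) blast
  let ?H = "\<lambda>t. exp (- t) * m2 (\<mu> t)"
  have "?H T - ?H 0 \<le> (LINT t:{0..T}|lebesgue. exp (- t) * w t)"
  proof (rule increment_le_integral_upper_derivative[OF T _ _ int])
    show "set_integrable lebesgue {0..T} (\<lambda>t. 2 * B * m t)"
      using m by simp
    show "?H t - ?H s \<le> (LINT u:{s..t}|lebesgue. 2 * B * m u)"
      if st: "0 \<le> s" "s \<le> t" "t \<le> T" for s t
    proof -
      let ?f = "\<lambda>s. sqrt (m2 (\<mu> s))"
      have B0: "0 \<le> ?f s" "?f s \<le> B" "0 \<le> ?f t" "?f t \<le> B"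
        using B st by (simp_all add: m2_nonneg)
      then have Bn: "0 \<le> B" by linarith
      have "?H t - ?H s \<le> exp (- t) * (m2 (\<mu> t) - m2 (\<mu> s))"
        using mult_right_mono[of "exp (- t)" "exp (- s)" "m2 (\<mu> s)"] st
        by (simp add: m2_nonneg algebra_simps)
      also have "\<dots> \<le> exp (- t) * \<bar>m2 (\<mu> t) - m2 (\<mu> s)\<bar>"
        by (intro mult_left_mono) auto
      also have "\<dots> \<le> 1 * \<bar>m2 (\<mu> t) - m2 (\<mu> s)\<bar>"
        using st by (intro mult_right_mono) auto
      also have "\<dots> = (?f t + ?f s) * \<bar>?f s - ?f t\<bar>"
        using B0 square_diff_square_factored[of "?f t" "?f s"]
        by (simp add: m2_nonneg abs_mult abs_minus_commute)
      also have "\<dots> \<le> (2 * B) * W2 (\<mu> s) (\<mu> t)"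
      proof (rule mult_mono)
        show "\<bar>?f s - ?f t\<bar> \<le> W2 (\<mu> s) (\<mu> t)"
          using st by (intro abs_sqrt_m2_diff_le_W2 P) auto
      qed (use Bn B0 in linarith)+
      also have "\<dots> \<le> (2 * B) * (LINT u:{s..t}|lebesgue. m u)"
        using Bn W[OF st] by (intro mult_left_mono) auto
      finally show ?thesis by simp
    qed
    show "AE t in lebesgue. 0 < t \<and> t < T \<longrightarrow>
        (\<forall>e>0. \<forall>\<^sub>F s in at t. (?H s - ?H t) / (s - t) \<le> exp (- t) * w t + e)"
      using w
    proof (rule AE_mp, intro AE_I2 impI allI)
      fix t e :: real
      assume "0 < t \<longrightarrow> (\<exists>v. has_metric_derivative \<mu> v t \<and> v\<^sup>2 = w t)"
        and t: "0 < t \<and> t < T" and e: "0 < e"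
      then obtain v where v: "has_metric_derivative \<mu> v t" "v\<^sup>2 = w t"
        by blast
      show "\<forall>\<^sub>F s in at t. (?H s - ?H t) / (s - t) \<le> exp (- t) * w t + e"
        using weighted_m2_upper_derivative[OF P _ v(1) e] t unfolding v(2) by blast
    qed
  qed
  then show ?thesis by simp
qed

section \<open>The loss along a gradient flow\<close>

text \<open>The weight \<open>w\<close> is unbounded, so a neuron is Lipschitz only with a constant growing linearly in the
  parameters; this is exactly the growth that finite second moments can absorb.\<close>

lemma neuron_local_lipschitz:
  fixes x a a' :: "real ^ 'd::finite"
  assumes S0: "S0 \<ge> 0"
    and lip: "\<And>z z'. \<bar>\<sigma> z - \<sigma> z'\<bar> \<le> S0 * \<bar>z - z'\<bar>"
    and bdd: "\<And>z. \<bar>\<sigma> z\<bar> \<le> S0"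
  shows "\<bar>w * \<sigma> (a \<bullet> x + b) - w' * \<sigma> (a' \<bullet> x + b')\<bar>
    \<le> (S0 + S0 * (norm x + 1) * (norm (w, a, b) + norm (w', a', b'))) * dist (w, a, b) (w', a', b')"
proof -
  let ?d = "dist (w, a, b) (w', a', b')"
  have d: "\<bar>w - w'\<bar> \<le> ?d" "norm (a - a') \<le> ?d" "\<bar>b - b'\<bar> \<le> ?d" "\<bar>w'\<bar> \<le> norm (w', a', b')"
  proof -
    have ab: "dist (a, b) (a', b') \<le> ?d"
      using dist_snd_le[of "(w, a, b)" "(w', a', b')"] by simp
    show "\<bar>w - w'\<bar> \<le> ?d"
      using dist_fst_le[of "(w, a, b)" "(w', a', b')"] by (simp add: dist_real_def)
    show "norm (a - a') \<le> ?d"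
      using dist_fst_le[of "(a, b)" "(a', b')"] ab by (simp add: dist_norm)
    show "\<bar>b - b'\<bar> \<le> ?d"
      using dist_snd_le[of "(a, b)" "(a', b')"] ab by (simp add: dist_real_def)
    show "\<bar>w'\<bar> \<le> norm (w', a', b')"
      using norm_fst_le[of w' "(a', b')"] by simp
  qed
  have "\<bar>(a \<bullet> x + b) - (a' \<bullet> x + b')\<bar> = \<bar>(a - a') \<bullet> x + (b - b')\<bar>"
    by (simp add: inner_diff_left)
  also have "\<dots> \<le> norm (a - a') * norm x + \<bar>b - b'\<bar>"
    using Cauchy_Schwarz_ineq2[of "a - a'" x] by linarith
  also have "\<dots> \<le> ?d * norm x + ?d"
    using d by (intro add_mono mult_right_mono) auto
  finally have z: "\<bar>(a \<bullet> x + b) - (a' \<bullet> x + b')\<bar> \<le> (norm x + 1) * ?d"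
    by (simp add: algebra_simps)
  have "w * \<sigma> (a \<bullet> x + b) - w' * \<sigma> (a' \<bullet> x + b')
      = (w - w') * \<sigma> (a \<bullet> x + b) + w' * (\<sigma> (a \<bullet> x + b) - \<sigma> (a' \<bullet> x + b'))"
    by (simp add: algebra_simps)
  also have "\<bar>\<dots>\<bar> \<le> \<bar>w - w'\<bar> * \<bar>\<sigma> (a \<bullet> x + b)\<bar> + \<bar>w'\<bar> * \<bar>\<sigma> (a \<bullet> x + b) - \<sigma> (a' \<bullet> x + b')\<bar>"
    by (rule order_trans[OF abs_triangle_ineq]) (simp add: abs_mult)
  also have "\<dots> \<le> ?d * S0 + norm (w', a', b') * (S0 * ((norm x + 1) * ?d))"
  proof (intro add_mono mult_mono)
    show "\<bar>\<sigma> (a \<bullet> x + b) - \<sigma> (a' \<bullet> x + b')\<bar> \<le> S0 * ((norm x + 1) * ?d)"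
      using lip[of "a \<bullet> x + b" "a' \<bullet> x + b'"] mult_left_mono[OF z S0] by linarith
  qed (use d bdd S0 in auto)
  also have "\<dots> \<le> ?d * S0 + (norm (w, a, b) + norm (w', a', b')) * (S0 * ((norm x + 1) * ?d))"
    using S0 by (intro add_left_mono mult_right_mono) auto
  finally show ?thesis by (simp add: algebra_simps)
qed

lemma local_lipschitz_if_lipschitz_derivative:
  fixes f :: "real \<Rightarrow> real"
  assumes diff: "\<And>r. f differentiable (at r)"
    and lip: "\<And>r s. \<bar>deriv f r - deriv f s\<bar> \<le> \<beta> * \<bar>r - s\<bar>" and \<beta>: "\<beta> \<ge> 0"
    and r: "\<bar>r\<bar> \<le> P" and s: "\<bar>s\<bar> \<le> P"
  shows "\<bar>f r - f s\<bar> \<le> (\<bar>deriv f 0\<bar> + \<beta> * P) * \<bar>r - s\<bar>"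
proof -
  have "norm (f r - f s) \<le> (\<bar>deriv f 0\<bar> + \<beta> * P) * norm (r - s)"
  proof (rule field_differentiable_bound[where S="{-P..P}" and f'="deriv f"])
    fix u assume u: "u \<in> {-P..P}"
    show "(f has_field_derivative deriv f u) (at u within {-P..P})"
      using diff[of u] by (simp add: DERIV_deriv_iff_real_differentiable has_field_derivative_at_within)
    have "\<bar>deriv f u\<bar> \<le> \<bar>deriv f 0\<bar> + \<beta> * \<bar>u\<bar>"
      using lip[of u 0] unfolding diff_zero by linarith
    also have "\<dots> \<le> \<bar>deriv f 0\<bar> + \<beta> * P"
      using u \<beta> by (intro add_left_mono mult_left_mono) auto
    finally show "norm (deriv f u) \<le> \<bar>deriv f 0\<bar> + \<beta> * P"
      by (simp only: real_norm_def)
  next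
    show "r \<in> {-P..P}" "s \<in> {-P..P}"
      using abs_le_D1[OF r] abs_le_D2[OF r] abs_le_D1[OF s] abs_le_D2[OF s] by simp_all
  qed simp
  then show ?thesis by (simp only: real_norm_def)
qed

text \<open>On sets that are bounded in the Wasserstein space, the network outputs stay in a compact interval,
  on which \<open>Lt\<close> is Lipschitz.  This gives the absolute continuity of the loss along a flow, without
  which an almost everywhere derivative would say nothing about increments.\<close>

lemma loss_increment_le_W2:
  fixes \<sigma> Lt :: "real \<Rightarrow> real" and x :: "nat \<Rightarrow> real ^ 'd::finite"
  assumes S0: "S0 \<ge> 0"
    and lip: "\<And>z z'. \<bar>\<sigma> z - \<sigma> z'\<bar> \<le> S0 * \<bar>z - z'\<bar>"
    and bdd: "\<And>z. \<bar>\<sigma> z\<bar> \<le> S0"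
    and diff: "\<And>r. Lt differentiable (at r)"
    and Lt': "\<And>r s. \<bar>deriv Lt r - deriv Lt s\<bar> \<le> \<beta> * \<bar>r - s\<bar>" and \<beta>: "\<beta> \<ge> 0"
    and \<mu>0: "\<mu>0 \<in> P2"
  shows "\<exists>C. \<forall>\<mu>\<in>P2. \<forall>\<nu>\<in>P2. sqrt (m2 \<mu>) \<le> B \<longrightarrow> sqrt (m2 \<nu>) \<le> B \<longrightarrow>
      W2 \<mu>0 \<mu> \<le> B \<longrightarrow> W2 \<mu>0 \<nu> \<le> B \<longrightarrow> sqrt (m2 \<mu>0) \<le> B \<longrightarrow>
      \<bar>loss \<sigma> Lt M x y \<mu> - loss \<sigma> Lt M x y \<nu>\<bar> \<le> C * W2 \<mu> \<nu>"
proof -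
  define c where "c k = S0 + S0 * (norm (x k) + 1) * (2 * B)" for k
  \<comment> \<open>\<open>P k\<close> bounds the residual at the \<open>k\<close>-th data point, uniformly over the bounded set.\<close>
  define P where "P k = \<bar>network \<sigma> \<mu>0 (x k) - y k\<bar> + c k * B" for k
  have net: "\<bar>network \<sigma> \<mu> (x k) - network \<sigma> \<nu> (x k)\<bar> \<le> c k * W2 \<mu> \<nu>"
    if P: "\<mu> \<in> P2" "\<nu> \<in> P2" and B: "sqrt (m2 \<mu>) \<le> B" "sqrt (m2 \<nu>) \<le> B" for \<mu> \<nu> k
  proof -
    have "continuous_on UNIV \<sigma>"
      using S0 lip by (intro lipschitz_on_continuous_on[of S0] lipschitz_onI) (auto simp: dist_real_def)
    then have "continuous_on UNIV (\<lambda>\<theta>::'d param. fst \<theta> * \<sigma> (fst (snd \<theta>) \<bullet> x k + snd (snd \<theta>)))"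
      by (auto intro!: continuous_intros continuous_on_compose2[of UNIV \<sigma>])
    then have "(\<lambda>\<theta>::'d param. case \<theta> of (w, a, b) \<Rightarrow> w * \<sigma> (a \<bullet> x k + b)) \<in> borel_measurable borel"
      by (auto intro!: borel_measurable_continuous_onI simp: case_prod_beta)
    then have "\<bar>network \<sigma> \<mu> (x k) - network \<sigma> \<nu> (x k)\<bar>
        \<le> (S0 + S0 * (norm (x k) + 1) * (sqrt (m2 \<mu>) + sqrt (m2 \<nu>))) * W2 \<mu> \<nu>"
      unfolding network_def using P S0 neuron_local_lipschitz[OF S0 lip bdd]
      by (intro abs_integral_diff_le_W2) (auto split: prod.split)
    also have "\<dots> \<le> c k * W2 \<mu> \<nu>"
      unfolding c_def using S0 B W2_nonneg[OF P]
      by (intro mult_right_mono add_left_mono mult_left_mono) auto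
    finally show ?thesis .
  qed
  show ?thesis
  proof (intro exI ballI impI)
    fix \<mu> \<nu> :: "'d param measure"
    assume P2: "\<mu> \<in> P2" "\<nu> \<in> P2" and B: "sqrt (m2 \<mu>) \<le> B" "sqrt (m2 \<nu>) \<le> B"
      "W2 \<mu>0 \<mu> \<le> B" "W2 \<mu>0 \<nu> \<le> B" "sqrt (m2 \<mu>0) \<le> B"
    have B0: "B \<ge> 0" using B(1) real_sqrt_ge_zero[OF m2_nonneg[of \<mu>]] by linarith
    have c: "c k \<ge> 0" for k using S0 B0 by (simp add: c_def)
    have bound: "\<bar>network \<sigma> \<rho> (x k) - y k\<bar> \<le> P k"
      if "\<rho> \<in> P2" "sqrt (m2 \<rho>) \<le> B" "W2 \<mu>0 \<rho> \<le> B" for \<rho> k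
      using net[OF \<mu>0 that(1) B(5) that(2), of k] mult_left_mono[OF that(3) c[of k]]
      unfolding P_def by linarith
    have summand: "\<bar>Lt (network \<sigma> \<mu> (x k) - y k) - Lt (network \<sigma> \<nu> (x k) - y k)\<bar>
        \<le> (\<bar>deriv Lt 0\<bar> + \<beta> * P k) * (c k * W2 \<mu> \<nu>)" for k
    proof -
      have "P k \<ge> 0" using bound[OF P2(1) B(1,3), of k] by linarith
      then have "(\<bar>deriv Lt 0\<bar> + \<beta> * P k) * \<bar>network \<sigma> \<mu> (x k) - network \<sigma> \<nu> (x k)\<bar>
          \<le> (\<bar>deriv Lt 0\<bar> + \<beta> * P k) * (c k * W2 \<mu> \<nu>)"
        using \<beta> by (intro mult_left_mono net P2 B) auto
      then show ?thesis
        using local_lipschitz_if_lipschitz_derivative[OF diff Lt' \<beta> bound[OF P2(1) B(1,3)] bound[OF P2(2) B(2,4)], of k]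
        by simp
    qed
    have "\<bar>loss \<sigma> Lt M x y \<mu> - loss \<sigma> Lt M x y \<nu>\<bar>
        = (1 / real M) * \<bar>\<Sum>k=1..M. Lt (network \<sigma> \<mu> (x k) - y k) - Lt (network \<sigma> \<nu> (x k) - y k)\<bar>"
      unfolding loss_def sum_subtractf right_diff_distrib[symmetric] abs_mult by simp
    also have "\<dots> \<le> (1 / real M) * (\<Sum>k=1..M. (\<bar>deriv Lt 0\<bar> + \<beta> * P k) * (c k * W2 \<mu> \<nu>))"
      by (intro mult_left_mono order_trans[OF sum_abs] sum_mono summand) auto
    also have "\<dots> = ((1 / real M) * (\<Sum>k=1..M. (\<bar>deriv Lt 0\<bar> + \<beta> * P k) * c k)) * W2 \<mu> \<nu>"
      by (simp add: sum_distrib_right mult.assoc)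
    finally show "\<bar>loss \<sigma> Lt M x y \<mu> - loss \<sigma> Lt M x y \<nu>\<bar>
        \<le> ((1 / real M) * (\<Sum>k=1..M. (\<bar>deriv Lt 0\<bar> + \<beta> * P k) * c k)) * W2 \<mu> \<nu>" .
  qed
qed

text \<open>The flow enters twice: the identity for the derivative of \<open>L\<close> makes \<open>G\<^sup>2\<close> integrable with integral at
  most the decrement of \<open>L\<close>, and \<open>|\<mu>'|\<^sup>2 = G\<^sup>2\<close> feeds this into the growth estimate for \<open>m\<^sub>2\<close>.\<close>

lemma gradient_flow_m2_bound:
  fixes \<mu> :: "real \<Rightarrow> 'a::euclidean_space measure" and L G :: "'a measure \<Rightarrow> real"
  assumes flow: "gradient_flow L G \<mu>0 \<mu>" and T: "0 \<le> T"
    and L: "\<And>B. \<exists>C. \<forall>\<nu>\<in>P2. \<forall>\<rho>\<in>P2. sqrt (m2 \<nu>) \<le> B \<longrightarrow> sqrt (m2 \<rho>) \<le> B \<longrightarrow>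
      W2 \<mu>0 \<nu> \<le> B \<longrightarrow> W2 \<mu>0 \<rho> \<le> B \<longrightarrow> sqrt (m2 \<mu>0) \<le> B \<longrightarrow> \<bar>L \<nu> - L \<rho>\<bar> \<le> C * W2 \<nu> \<rho>"
  shows "set_integrable lebesgue {0..T} (\<lambda>t. exp (T - t) * (G (\<mu> t))\<^sup>2)"
    and "m2 (\<mu> T) \<le> exp T * m2 \<mu>0 + (LINT t:{0..T}|lebesgue. exp (T - t) * (G (\<mu> t))\<^sup>2)"
    and "exp T * m2 \<mu>0 + (LINT t:{0..T}|lebesgue. exp (T - t) * (G (\<mu> t))\<^sup>2)
      \<le> exp T * (m2 \<mu>0 + L \<mu>0 - L (\<mu> T))"
proof -
  have AC2: "AC2_loc_curve \<mu>" and start: "\<mu> 0 = \<mu>0"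
    and slope: "AE t in lebesgue. t > 0 \<longrightarrow> (\<exists>v. has_metric_derivative \<mu> v t \<and>
      ((\<lambda>s. L (\<mu> s)) has_real_derivative - (v\<^sup>2)) (at t) \<and> v\<^sup>2 = (G (\<mu> t))\<^sup>2)"
    using flow unfolding gradient_flow_def by blast+
  have P: "\<mu> t \<in> P2" if "t \<ge> 0" for t
    using AC2 that by (simp add: AC2_loc_curve_def)
  obtain m :: "real \<Rightarrow> real" and B where m: "set_integrable lebesgue {0..T} m"
    and W: "\<And>s t. 0 \<le> s \<Longrightarrow> s \<le> t \<Longrightarrow> t \<le> T \<Longrightarrow> W2 (\<mu> s) (\<mu> t) \<le> (LINT u:{s..t}|lebesgue. m u)"
    and B: "\<And>t. 0 \<le> t \<Longrightarrow> t \<le> T \<Longrightarrow> W2 (\<mu> 0) (\<mu> t) \<le> B"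
      "\<And>t. 0 \<le> t \<Longrightarrow> t \<le> T \<Longrightarrow> sqrt (m2 (\<mu> t)) \<le> B"
    by (rule AC2_loc_curve_speed[OF AC2 T]) blast
  obtain C where C: "\<And>\<nu> \<rho>. \<nu> \<in> P2 \<Longrightarrow> \<rho> \<in> P2 \<Longrightarrow> sqrt (m2 \<nu>) \<le> B \<Longrightarrow> sqrt (m2 \<rho>) \<le> B \<Longrightarrow>
      W2 \<mu>0 \<nu> \<le> B \<Longrightarrow> W2 \<mu>0 \<rho> \<le> B \<Longrightarrow> sqrt (m2 \<mu>0) \<le> B \<Longrightarrow> \<bar>L \<nu> - L \<rho>\<bar> \<le> C * W2 \<nu> \<rho>"
    using L[of B] by metis
  have AC: "L (\<mu> t) - L (\<mu> s) \<le> (LINT u:{s..t}|lebesgue. \<bar>C\<bar> * m u)"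
    if st: "0 \<le> s" "s \<le> t" "t \<le> T" for s t
  proof -
    have "\<bar>L (\<mu> s) - L (\<mu> t)\<bar> \<le> C * W2 (\<mu> s) (\<mu> t)"
    proof (rule C)
      show "W2 \<mu>0 (\<mu> s) \<le> B" "W2 \<mu>0 (\<mu> t) \<le> B" "sqrt (m2 \<mu>0) \<le> B"
        using B(1)[of s] B(1)[of t] B(2)[of 0] st T by (simp_all add: start)
    qed (use st in \<open>simp_all add: P B(2)\<close>)
    also have "\<dots> \<le> \<bar>C\<bar> * W2 (\<mu> s) (\<mu> t)"
      using W2_nonneg[OF P P, of s t] st by (intro mult_right_mono) auto
    also have "\<dots> \<le> \<bar>C\<bar> * (LINT u:{s..t}|lebesgue. m u)"
      using W[OF st] by (intro mult_left_mono) auto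
    finally show ?thesis by simp
  qed
  let ?w = "\<lambda>t. (G (\<mu> t))\<^sup>2"
  have decr: "AE t in lebesgue. 0 < t \<and> t < T \<longrightarrow> ((\<lambda>t. L (\<mu> t)) has_real_derivative - ?w t) (at t)"
    using slope
  proof (rule AE_mp, intro AE_I2 impI)
    fix t assume "t > 0 \<longrightarrow> (\<exists>v. has_metric_derivative \<mu> v t \<and>
      ((\<lambda>s. L (\<mu> s)) has_real_derivative - (v\<^sup>2)) (at t) \<and> v\<^sup>2 = ?w t)" "0 < t \<and> t < T"
    then obtain v where "((\<lambda>s. L (\<mu> s)) has_real_derivative - (v\<^sup>2)) (at t)" "v\<^sup>2 = ?w t"
      by blast
    then show "((\<lambda>t. L (\<mu> t)) has_real_derivative - ?w t) (at t)"
      by (simp only:)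
  qed
  have w: "set_integrable lebesgue {0..T} ?w" "(LINT t:{0..T}|lebesgue. ?w t) \<le> L (\<mu> 0) - L (\<mu> T)"
    using decreasing_AC_derivative_integrable[OF T _ AC _ decr] m by simp_all
  have weighted: "set_integrable lebesgue {0..T} (\<lambda>t. f t * ?w t)"
    if f: "continuous_on {0..T} f" "\<And>t. t \<in> {0..T} \<Longrightarrow> \<bar>f t\<bar> \<le> K" for f K
  proof -
    have "set_borel_measurable lebesgue {0..T} f"
      unfolding set_borel_measurable_def
      using borel_measurable_continuous_on_indicator[OF _ f(1)]
      by (intro measurable_completion) simp
    then have "(\<lambda>t. (indicator {0..T} t *\<^sub>R f t) * (indicator {0..T} t *\<^sub>R ?w t)) \<in> borel_measurable lebesgue"
      using borel_measurable_integrable[OF w(1)[unfolded set_integrable_def]]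
      unfolding set_borel_measurable_def by (rule borel_measurable_times)
    moreover have "(\<lambda>t. (indicator {0..T} t *\<^sub>R f t) * (indicator {0..T} t *\<^sub>R ?w t))
        = (\<lambda>t. indicator {0..T} t *\<^sub>R (f t * ?w t))"
      by (simp add: fun_eq_iff indicator_def)
    ultimately have meas: "(\<lambda>t. indicator {0..T} t *\<^sub>R (f t * ?w t)) \<in> borel_measurable lebesgue"
      by (simp only:)
    have "norm (indicator {0..T} t *\<^sub>R (f t * ?w t)) \<le> norm (K * (indicator {0..T} t *\<^sub>R ?w t))" for t
    proof (cases "t \<in> {0..T}")
      case True
      then have "\<bar>f t\<bar> * ?w t \<le> \<bar>K\<bar> * ?w t"
        using f(2)[OF True] by (intro mult_right_mono) auto
      then show ?thesis using True by (simp add: abs_mult)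
    qed simp
    moreover have "integrable lebesgue (\<lambda>t. K * (indicator {0..T} t *\<^sub>R ?w t))"
      using w(1) unfolding set_integrable_def by (rule integrable_mult_right)
    ultimately show ?thesis
      unfolding set_integrable_def
      by (intro Bochner_Integration.integrable_bound[OF _ meas] AE_I2)
  qed
  have e1: "set_integrable lebesgue {0..T} (\<lambda>t. exp (- t) * ?w t)"
    by (rule weighted[where K=1]) (auto intro!: continuous_intros)
  show e2: "set_integrable lebesgue {0..T} (\<lambda>t. exp (T - t) * ?w t)"
    by (rule weighted[where K="exp T"]) (auto intro!: continuous_intros)
  have eq: "(LINT t:{0..T}|lebesgue. exp (T - t) * ?w t) = exp T * (LINT t:{0..T}|lebesgue. exp (- t) * ?w t)"
  proof -
    have "exp (T - t) * ?w t = exp T * (exp (- t) * ?w t)" for t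
      using exp_add[of T "- t"] by simp
    then show ?thesis by (simp only: set_integral_mult_right)
  qed
  have "exp (- T) * m2 (\<mu> T) - m2 (\<mu> 0) \<le> (LINT t:{0..T}|lebesgue. exp (- t) * ?w t)"
  proof (rule m2_growth_along_AC2_curve[OF AC2 T _ e1])
    show "AE t in lebesgue. 0 < t \<longrightarrow> (\<exists>v. has_metric_derivative \<mu> v t \<and> v\<^sup>2 = ?w t)"
      using slope by (rule AE_mp) (intro AE_I2, blast)
  qed
  then have "exp T * (exp (- T) * m2 (\<mu> T)) \<le> exp T * (m2 (\<mu> 0) + (LINT t:{0..T}|lebesgue. exp (- t) * ?w t))"
    by (intro mult_left_mono) auto
  moreover have "exp T * (exp (- T) * m2 (\<mu> T)) = m2 (\<mu> T)"
    by (simp add: exp_minus)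
  ultimately show "m2 (\<mu> T) \<le> exp T * m2 \<mu>0 + (LINT t:{0..T}|lebesgue. exp (T - t) * ?w t)"
    unfolding eq start by (simp only: distrib_left)
  have "(LINT t:{0..T}|lebesgue. exp (T - t) * ?w t) \<le> (LINT t:{0..T}|lebesgue. exp T * ?w t)"
    using e2 w(1) by (intro set_integral_mono mult_right_mono) auto
  also have "\<dots> = exp T * (LINT t:{0..T}|lebesgue. ?w t)"
    by simp
  also have "\<dots> \<le> exp T * (L \<mu>0 - L (\<mu> T))"
    using w(2) unfolding start by (intro mult_left_mono) auto
  finally show "exp T * m2 \<mu>0 + (LINT t:{0..T}|lebesgue. exp (T - t) * ?w t)
      \<le> exp T * (m2 \<mu>0 + L \<mu>0 - L (\<mu> T))"
    unfolding right_diff_distrib distrib_left by linarith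
qed

section \<open>Smooth functions\<close>

text \<open>\<open>Ck\<close> is phrased with the chosen derivative \<open>frechet_derivative\<close>; this rule admits any function that
  is known to be the derivative.\<close>

lemma Ck_SucI:
  fixes f :: "'a::euclidean_space \<Rightarrow> real"
  assumes "\<And>z. (f has_derivative f' z) (at z)" "\<And>i. i \<in> Basis \<Longrightarrow> Ck n (\<lambda>z. f' z i)"
  shows "Ck (Suc n) f"
proof -
  have "frechet_derivative f (at z) = f' z" for z
    using frechet_derivative_at[OF assms(1)] by metis
  then show ?thesis
    using assms by (auto simp: differentiable_def)
qed

lemma Ck_Suc_has_derivative:
  "Ck (Suc n) f \<Longrightarrow> (f has_derivative frechet_derivative f (at z)) (at z)"
  by (simp add: frechet_derivative_works)

lemma Ck_Suc_imp_Ck: "Ck (Suc n) f \<Longrightarrow> Ck n f"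
proof (induction n arbitrary: f)
  case 0
  then show ?case
    by (auto intro!: differentiable_imp_continuous_on simp: differentiable_on_def
        intro: differentiable_at_withinI)
next
  case (Suc n)
  from Suc.prems have "\<forall>z. f differentiable (at z)"
    and "\<forall>i\<in>Basis. Ck (Suc n) (\<lambda>z. frechet_derivative f (at z) i)"
    by simp_all
  with Suc.IH show ?case by simp
qed

lemma Ck_bounded_linear:
  assumes "bounded_linear f"
  shows "Ck n (\<lambda>z. f z + c)"
proof (cases n)
  case 0
  with assms show ?thesis
    by (simp add: continuous_on_add linear_continuous_on)
next
  case (Suc m)
  have const: "Ck k (\<lambda>z::'a. d)" for k and d :: real
  proof (induction k arbitrary: d)
    case (Suc k)
    show ?case by (rule Ck_SucI[where f'="\<lambda>_ _. 0"]) (auto intro: Suc)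
  qed simp
  show ?thesis
    unfolding Suc using assms
    by (intro Ck_SucI[where f'="\<lambda>_. f"] const)
       (auto intro!: derivative_eq_intros bounded_linear_imp_has_derivative)
qed

lemma Ck_const: "Ck n (\<lambda>z. c)"
  using Ck_bounded_linear[OF bounded_linear_zero, of n c] by simp

lemma Ck_add: "Ck n f \<Longrightarrow> Ck n g \<Longrightarrow> Ck n (\<lambda>z. f z + g z)"
proof (induction n arbitrary: f g)
  case 0
  then show ?case by (auto intro: continuous_intros)
next
  case (Suc n)
  show ?case
    by (rule Ck_SucI[OF has_derivative_add[OF Suc.prems[THEN Ck_Suc_has_derivative]]])
       (use Suc in auto)
qed

lemma Ck_mult: "Ck n f \<Longrightarrow> Ck n g \<Longrightarrow> Ck n (\<lambda>z. f z * g z)"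
proof (induction n arbitrary: f g)
  case 0
  then show ?case by (auto intro: continuous_intros)
next
  case (Suc n)
  show ?case
  proof (rule Ck_SucI[OF has_derivative_mult[OF Suc.prems[THEN Ck_Suc_has_derivative]]])
    fix i :: 'a assume i: "i \<in> Basis"
    show "Ck n (\<lambda>z. f z * frechet_derivative g (at z) i + frechet_derivative f (at z) i * g z)"
      using i Suc.prems by (intro Ck_add Suc.IH Ck_Suc_imp_Ck[of n f] Ck_Suc_imp_Ck[of n g]) auto
  qed
qed

lemma Ck_compose:
  fixes g :: "real \<Rightarrow> real" and f :: "'a::euclidean_space \<Rightarrow> real"
  shows "Ck n g \<Longrightarrow> Ck n f \<Longrightarrow> Ck n (\<lambda>z. g (f z))"
proof (induction n arbitrary: g f)
  case 0
  then show ?case by (auto intro: continuous_on_compose2)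
next
  case (Suc n)
  have "((\<lambda>z. g (f z)) has_derivative
      (\<lambda>i. frechet_derivative g (at (f z)) 1 * frechet_derivative f (at z) i)) (at z)" for z
  proof -
    have "linear (frechet_derivative g (at (f z)))"
      using Suc.prems(1) by (auto intro: linear_frechet_derivative)
    then have *: "frechet_derivative g (at (f z)) r = frechet_derivative g (at (f z)) 1 * r" for r
      using linear_cmul[of "frechet_derivative g (at (f z))" r 1] by (simp add: mult.commute)
    show ?thesis
      using has_derivative_compose[OF Suc.prems(2,1)[THEN Ck_Suc_has_derivative], of z]
      by (subst (asm) *)
  qed
  then show ?case
  proof (rule Ck_SucI)
    fix i :: 'a assume "i \<in> Basis"
    then show "Ck n (\<lambda>z. frechet_derivative g (at (f z)) 1 * frechet_derivative f (at z) i)"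
      using Suc.prems
      by (intro Ck_mult Suc.IH[of "\<lambda>r. frechet_derivative g (at r) 1"] Ck_Suc_imp_Ck[of n f]) auto
  qed
qed

lemma Ck_norm_square_snd: "Ck n (\<lambda>z::real \<times> 'a::euclidean_space. (norm (snd z))\<^sup>2)"
proof (cases n)
  case 0
  then show ?thesis by (auto intro!: continuous_intros)
next
  case (Suc m)
  show ?thesis unfolding Suc
  proof (rule Ck_SucI)
    fix z :: "real \<times> 'a"
    show "((\<lambda>z. (norm (snd z))\<^sup>2) has_derivative (\<lambda>i. 2 * (snd z \<bullet> snd i))) (at z)"
      unfolding power2_norm_eq_inner
      by (auto intro!: derivative_eq_intros simp: inner_commute)
  next
    fix i :: "real \<times> 'a"
    have "bounded_linear (\<lambda>z::real \<times> 'a. 2 * (snd z \<bullet> snd i))"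
      by (intro bounded_linear_const_mult bounded_linear_inner_left_comp bounded_linear_snd)
    from Ck_bounded_linear[OF this, of m 0]
    show "Ck m (\<lambda>z::real \<times> 'a. 2 * (snd z \<bullet> snd i))" by simp
  qed
qed

lemma Ck_SucI_real:
  assumes "\<And>x. (f has_real_derivative f' x) (at x)" "Ck n f'"
  shows "Ck (Suc n) f"
  by (rule Ck_SucI[where f'="\<lambda>x h. h * f' x"])
     (use assms in \<open>auto simp: has_field_derivative_def mult_commute_abs\<close>)

lemma Ck_exp_minus: "Ck n (\<lambda>x::real. exp (- x))"
proof -
  have "Ck n (\<lambda>x::real. c * exp (- x))" for c
  proof (induction n arbitrary: c)
    case 0
    show ?case by (auto intro!: continuous_intros)
  next
    case (Suc n)
    show ?case
      by (rule Ck_SucI_real[OF _ Suc[of "- c"]]) (auto intro!: derivative_eq_intros)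
  qed
  from this[of 1] show ?thesis by simp
qed

text \<open>The polynomial factor makes the family closed under differentiation, which turns the smoothness of
  \<open>exp (- 1 / x)\<close> at the origin into an induction over all polynomials at once.\<close>

definition flat_exp :: "real poly \<Rightarrow> real \<Rightarrow> real" where
  "flat_exp p x = (if x > 0 then poly p (1 / x) * exp (- (1 / x)) else 0)"

lemma poly_times_exp_minus_tendsto_0: "((\<lambda>y::real. poly p y * exp (- y)) \<longlongrightarrow> 0) at_top"
proof -
  have "((\<lambda>y::real. \<Sum>i\<le>degree p. coeff p i * (y ^ i / exp y)) \<longlongrightarrow> (\<Sum>i\<le>degree p. coeff p i * 0)) at_top"
    by (intro tendsto_intros tendsto_power_div_exp_0)
  then show ?thesis
    by (simp add: poly_altdef sum_distrib_right exp_minus divide_inverse mult.assoc)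
qed

lemma has_real_derivative_flat_exp:
  "(flat_exp p has_real_derivative flat_exp ([:0, 0, 1:] * (p - pderiv p)) x) (at x)"
proof -
  consider "x < 0" | "x > 0" | "x = 0" by linarith
  then show ?thesis
  proof cases
    case 1
    have "((\<lambda>_. 0::real) has_real_derivative flat_exp ([:0, 0, 1:] * (p - pderiv p)) x) (at x)"
      using 1 by (simp add: flat_exp_def)
    then show ?thesis
      by (rule has_field_derivative_transform_within_open[where S="{..<0}"])
         (use 1 in \<open>auto simp: flat_exp_def\<close>)
  next
    case 2
    have "((\<lambda>x. poly p (1 / x)) has_real_derivative poly (pderiv p) (1 / x) * (- (1 / x\<^sup>2))) (at x)"
      using 2 by (intro DERIV_chain2[OF poly_DERIV])
        (auto intro!: derivative_eq_intros simp: power2_eq_square)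
    moreover have "((\<lambda>x. exp (- (1 / x))) has_real_derivative exp (- (1 / x)) * (1 / x\<^sup>2)) (at x)"
      using 2 by (auto intro!: derivative_eq_intros simp: power2_eq_square)
    ultimately have "((\<lambda>x. poly p (1 / x) * exp (- (1 / x))) has_real_derivative
        poly (pderiv p) (1 / x) * (- (1 / x\<^sup>2)) * exp (- (1 / x))
        + exp (- (1 / x)) * (1 / x\<^sup>2) * poly p (1 / x)) (at x)"
      by (rule DERIV_mult)
    also have "poly (pderiv p) (1 / x) * (- (1 / x\<^sup>2)) * exp (- (1 / x))
        + exp (- (1 / x)) * (1 / x\<^sup>2) * poly p (1 / x)
      = flat_exp ([:0, 0, 1:] * (p - pderiv p)) x"
      using 2 by (simp add: flat_exp_def power2_eq_square algebra_simps)
    finally show ?thesis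
      by (rule has_field_derivative_transform_within_open[where S="{0<..}"])
         (use 2 in \<open>auto simp: flat_exp_def\<close>)
  next
    case 3
    have "((\<lambda>h. flat_exp p h / h) \<longlongrightarrow> 0) (at_right 0)"
    proof -
      have "((\<lambda>y. poly ([:0, 1:] * p) y * exp (- y)) \<longlongrightarrow> 0) at_top"
        by (rule poly_times_exp_minus_tendsto_0)
      then have "((\<lambda>h. poly ([:0, 1:] * p) (inverse h) * exp (- inverse h)) \<longlongrightarrow> 0) (at_right 0)"
        unfolding at_top_to_right filterlim_filtermap .
      moreover have "eventually (\<lambda>h. poly ([:0, 1:] * p) (inverse h) * exp (- inverse h)
          = flat_exp p h / h) (at_right 0)"
        by (auto simp: flat_exp_def eventually_at_filter divide_inverse)
      ultimately show ?thesis by (rule Lim_transform_eventually)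
    qed
    moreover have "((\<lambda>h. flat_exp p h / h) \<longlongrightarrow> 0) (at_left 0)"
      by (rule tendsto_eventually) (auto simp: flat_exp_def eventually_at_filter)
    ultimately show ?thesis
      unfolding 3 DERIV_def filterlim_at_split by (simp add: flat_exp_def[of _ 0])
  qed
qed

lemma Ck_flat_exp: "Ck n (flat_exp p)"
proof (induction n arbitrary: p)
  case 0
  have "isCont (flat_exp p) x" for x
    by (rule DERIV_isCont[OF has_real_derivative_flat_exp])
  then show ?case
    by (simp add: continuous_at_imp_continuous_on)
next
  case (Suc n)
  show ?case by (rule Ck_SucI_real[OF has_real_derivative_flat_exp Suc])
qed

lemma Ck_antiderivative_exists:
  fixes f :: "real \<Rightarrow> real"
  assumes "\<And>n. Ck n f"
  shows "\<exists>F. (\<forall>n. Ck n F) \<and> (\<forall>x. (F has_real_derivative f x) (at x))"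
proof -
  have "isCont f x" for x
    using assms[of 0] by (simp add: continuous_on_eq_continuous_at)
  then obtain F where F: "\<And>x. (F has_vector_derivative f x) (at x)"
    using einterval_antiderivative[of "-\<infinity>" \<infinity> f] by auto
  have "Ck n F" for n
    by (rule Ck_Suc_imp_Ck[OF Ck_SucI_real[OF _ assms]])
       (simp add: F has_real_derivative_iff_has_vector_derivative)
  then show ?thesis
    using F by (auto simp: has_real_derivative_iff_has_vector_derivative)
qed

text \<open>The normalised antiderivative of the bump \<open>exp (- 1 / x) exp (- 1 / (1 - x))\<close> on \<open>[0, 1]\<close>.\<close>

lemma smooth_step_exists:
  obtains S :: "real \<Rightarrow> real" where
    "\<And>n. Ck n S" "\<And>x. x \<le> 0 \<Longrightarrow> S x = 0" "\<And>x. x \<ge> 1 \<Longrightarrow> S x = 1"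
proof -
  define bump where "bump x = flat_exp 1 x * flat_exp 1 (1 + - 1 * x)" for x
  have lin: "Ck n (\<lambda>x::real. c * x + d)" for n c d
    by (intro Ck_bounded_linear bounded_linear_mult_right)
  have "Ck n bump" for n
    unfolding bump_def
    using Ck_compose[OF Ck_flat_exp lin[of n "-1" 1]]
    by (intro Ck_mult Ck_flat_exp) (simp add: algebra_simps)
  from Ck_antiderivative_exists[OF this]
  obtain F where F: "\<And>n. Ck n F" and F': "\<And>x. (F has_real_derivative bump x) (at x)"
    by blast
  have out: "bump x = 0" if "x \<le> 0 \<or> 1 \<le> x" for x
    using that by (auto simp: bump_def flat_exp_def)
  have pos: "bump x > 0" if "0 < x" "x < 1" for x
    using that by (auto simp: bump_def flat_exp_def)
  have below: "F x = F 0" if "x \<le> 0" for x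
  proof (cases "x < 0")
    case True
    obtain z where "x < z" "z < 0" "F 0 - F x = (0 - x) * bump z"
      using MVT2[OF True, of F bump] F' by auto
    then show ?thesis using out[of z] by simp
  qed (use that in auto)
  have above: "F x = F 1" if "x \<ge> 1" for x
  proof (cases "x > 1")
    case True
    obtain z where "1 < z" "z < x" "F x - F 1 = (x - 1) * bump z"
      using MVT2[OF True, of F bump] F' by auto
    then show ?thesis using out[of z] by simp
  qed (use that in auto)
  obtain z where "0 < z" "z < 1" "F 1 - F 0 = bump z"
    using MVT2[of 0 1 F bump] F' by auto
  then have less: "F 0 < F 1" using pos[of z] by simp
  let ?S = "\<lambda>x. F x * (1 / (F 1 - F 0)) + - (F 0 / (F 1 - F 0))"
  show ?thesis
  proof
    show "Ck n ?S" for n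
      by (intro Ck_add Ck_mult Ck_const F)
    show "?S x = 0" if "x \<le> 0" for x
      using below[OF that] by simp
    show "?S x = 1" if "x \<ge> 1" for x
      using above[OF that] less by (simp flip: diff_divide_distrib)
  qed
qed

section \<open>Smooth cutoffs and test functions\<close>

lemma Ck_Suc_real_deriv:
  fixes f :: "real \<Rightarrow> real"
  assumes "Ck (Suc n) f"
  shows "(f has_real_derivative deriv f x) (at x)" and "Ck n (deriv f)"
proof -
  have D: "(f has_real_derivative deriv f x) (at x)" for x
    using assms by (simp add: DERIV_deriv_iff_real_differentiable)
  then show "(f has_real_derivative deriv f x) (at x)" .
  have "frechet_derivative f (at x) 1 = deriv f x" for x
    using fun_cong[OF frechet_derivative_at[OF D[of x, unfolded has_field_derivative_def]], of 1]
    by simp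
  then show "Ck n (deriv f)"
    using assms by simp
qed

lemma deriv_eq_0_if_locally_constant:
  fixes f :: "real \<Rightarrow> real"
  assumes "open A" "x \<in> A" "\<And>y. y \<in> A \<Longrightarrow> f y = c"
  shows "deriv f x = 0"
proof -
  have "((\<lambda>_. c) has_real_derivative 0) (at x)" by simp
  then have "(f has_real_derivative 0) (at x)"
    by (rule has_field_derivative_transform_within_open[OF _ assms(1,2)]) (simp add: assms(3))
  then show ?thesis by (rule DERIV_imp_deriv)
qed

lemma gradient_eqI:
  fixes f :: "'a::real_inner \<Rightarrow> real"
  assumes "GDERIV f z :> D"
  shows "gradient f z = D"
  unfolding gradient_def
proof (rule the_equality)
  show "GDERIV f z :> D" by (rule assms)
  fix D' assume "GDERIV f z :> D'"
  from this assms have "(\<lambda>h. h \<bullet> D') = (\<lambda>h. h \<bullet> D)"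
    unfolding gderiv_def by (rule has_derivative_unique)
  then have "h \<bullet> D' = h \<bullet> D" for h by (rule fun_cong)
  then show "D' = D" using vector_eq_ldot[of D' D] by blast
qed

locale smooth_step =
  fixes S :: "real \<Rightarrow> real"
  assumes Ck_S: "\<And>n. Ck n S"
    and S_0: "\<And>x. x \<le> 0 \<Longrightarrow> S x = 0"
    and S_1: "\<And>x. 1 \<le> x \<Longrightarrow> S x = 1"
begin

lemma S_has_derivative: "(S has_real_derivative deriv S x) (at x)"
  by (rule Ck_Suc_real_deriv[OF Ck_S])

lemma continuous_S: "continuous_on UNIV S"
  using Ck_S[of 0] by simp

lemma continuous_deriv_S: "continuous_on UNIV (deriv S)"
  using Ck_Suc_real_deriv(2)[OF Ck_S[of "Suc 0"]] by simp

lemma deriv_S_outside: "x \<notin> {0..1} \<Longrightarrow> deriv S x = 0"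
  using deriv_eq_0_if_locally_constant[of "{..<0}" x S 0]
    deriv_eq_0_if_locally_constant[of "{1<..}" x S 1] S_0 S_1
  by (cases "x < 0") auto

lemma S_bounded: obtains K where "\<And>x. \<bar>S x\<bar> \<le> K"
proof -
  have "bounded (S ` {0..1})"
    by (intro compact_imp_bounded compact_continuous_image continuous_on_subset[OF continuous_S]) auto
  then obtain K where K: "\<And>x. x \<in> {0..1} \<Longrightarrow> \<bar>S x\<bar> \<le> K"
    unfolding bounded_iff real_norm_def by blast
  have "\<bar>S x\<bar> \<le> K + 1" for x
    using K[of 0] K[of x] S_0[of x] S_1[of x] by (cases "x \<le> 0"; cases "1 \<le> x") auto
  then show ?thesis by (rule that)
qed

definition trunc :: "real \<Rightarrow> real" where
  "trunc r = r * (1 - S (r - 1))"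

lemma Ck_affine_real: "Ck n (\<lambda>t::real. c * t + d)"
  by (intro Ck_bounded_linear bounded_linear_mult_right)

lemma Ck_trunc: "Ck n trunc"
proof -
  have "Ck n (\<lambda>r. (1 * r + 0) * (1 + (- 1) * S (1 * r + (- 1))))"
    by (intro Ck_mult Ck_add Ck_const Ck_compose[OF Ck_S] Ck_affine_real)
  then show ?thesis by (simp add: trunc_def[abs_def])
qed

lemma trunc_has_derivative: "(trunc has_real_derivative deriv trunc r) (at r)"
  by (rule Ck_Suc_real_deriv[OF Ck_trunc])

lemma continuous_deriv_trunc: "continuous_on UNIV (deriv trunc)"
  using Ck_Suc_real_deriv(2)[OF Ck_trunc[of "Suc 0"]] by simp

lemma trunc_eq_self: "r \<le> 1 \<Longrightarrow> trunc r = r" and trunc_eq_0: "2 \<le> r \<Longrightarrow> trunc r = 0"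
  by (simp_all add: trunc_def S_0 S_1)

lemma deriv_trunc_eq_1: "r < 1 \<Longrightarrow> deriv trunc r = 1"
  by (intro DERIV_imp_deriv has_field_derivative_transform_within_open[OF DERIV_ident, of "{..<1}"])
     (auto simp: trunc_eq_self)

lemma deriv_trunc_bounded:
  obtains C where "C \<ge> 1" "\<And>r. 0 \<le> r \<Longrightarrow> \<bar>deriv trunc r\<bar> \<le> C"
    "\<And>r s. 0 \<le> r \<Longrightarrow> 0 \<le> s \<Longrightarrow> \<bar>trunc r - trunc s\<bar> \<le> C * \<bar>r - s\<bar>"
proof -
  have "bounded (deriv trunc ` {0..2})"
    by (intro compact_imp_bounded compact_continuous_image continuous_on_subset[OF continuous_deriv_trunc]) auto
  then obtain K where K: "\<And>r. r \<in> {0..2} \<Longrightarrow> \<bar>deriv trunc r\<bar> \<le> K"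
    unfolding bounded_iff real_norm_def by blast
  have C: "\<bar>deriv trunc r\<bar> \<le> max 1 K" if "0 \<le> r" for r
  proof (cases "r \<le> 2")
    case True
    then show ?thesis using K[of r] that by auto
  next
    case False
    then have "deriv trunc r = 0"
      by (intro deriv_eq_0_if_locally_constant[of "{2<..}" r trunc 0]) (auto simp: trunc_eq_0)
    then show ?thesis by simp
  qed
  have "norm (trunc r - trunc s) \<le> max 1 K * norm (r - s)" if "0 \<le> r" "0 \<le> s" for r s
  proof (rule field_differentiable_bound[where S="{0..}" and f'="deriv trunc"])
    show "(trunc has_field_derivative deriv trunc u) (at u within {0..})" for u
      by (rule has_field_derivative_at_within[OF trunc_has_derivative])
  qed (use that C in auto)
  then show ?thesis
    using that[of "max 1 K"] C by simp
qed

text \<open>A smooth function of compact support that equals \<open>|\<theta>|\<^sup>2\<close> on the ball of radius \<open>\<surd>c\<close>.  Dilating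
  one fixed profile keeps all bounds uniform in \<open>c\<close>.\<close>

definition trunc_sq :: "real \<Rightarrow> 'a::euclidean_space \<Rightarrow> real" where
  "trunc_sq c \<theta> = c * trunc ((norm \<theta>)\<^sup>2 / c)"

definition grad_trunc_sq :: "real \<Rightarrow> 'a::euclidean_space \<Rightarrow> 'a" where
  "grad_trunc_sq c \<theta> = (2 * deriv trunc ((norm \<theta>)\<^sup>2 / c)) *\<^sub>R \<theta>"

lemma GDERIV_trunc_sq:
  assumes "c > 0"
  shows "GDERIV (trunc_sq c) \<theta> :> grad_trunc_sq c \<theta>"
proof -
  have "((\<lambda>\<theta>. (norm \<theta>)\<^sup>2 / c) has_derivative (\<lambda>h. 2 * (h \<bullet> \<theta>) / c)) (at \<theta>)"
    unfolding power2_norm_eq_inner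
    using assms by (auto intro!: derivative_eq_intros simp: inner_commute)
  from has_derivative_compose[OF this trunc_has_derivative[unfolded has_field_derivative_def]]
  have "((\<lambda>\<theta>. c * trunc ((norm \<theta>)\<^sup>2 / c)) has_derivative
      (\<lambda>h. c * (deriv trunc ((norm \<theta>)\<^sup>2 / c) * (2 * (h \<bullet> \<theta>) / c)))) (at \<theta>)"
    by (rule has_derivative_mult_right)
  then show ?thesis
    unfolding gderiv_def trunc_sq_def[abs_def] grad_trunc_sq_def
    using assms by (simp add: mult_ac)
qed

lemma trunc_sq_measurable: "(trunc_sq c :: 'a::euclidean_space \<Rightarrow> real) \<in> borel_measurable borel"
  unfolding trunc_sq_def[abs_def]
proof -
  have [measurable]: "trunc \<in> borel_measurable borel"
    using Ck_trunc[of 0] by (intro borel_measurable_continuous_onI) simp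
  show "(\<lambda>\<theta>::'a. c * trunc ((norm \<theta>)\<^sup>2 / c)) \<in> borel_measurable borel"
    by measurable
qed

lemma grad_trunc_sq_measurable: "(grad_trunc_sq c :: 'a::euclidean_space \<Rightarrow> 'a) \<in> borel_measurable borel"
  unfolding grad_trunc_sq_def[abs_def]
proof -
  define d where "d = deriv trunc"
  have [measurable]: "d \<in> borel_measurable borel"
    unfolding d_def by (intro borel_measurable_continuous_onI continuous_deriv_trunc)
  show "(\<lambda>\<theta>::'a. (2 * deriv trunc ((norm \<theta>)\<^sup>2 / c)) *\<^sub>R \<theta>) \<in> borel_measurable borel"
    unfolding d_def[symmetric] by measurable
qed

lemma trunc_sq_bounds:
  obtains C where "C \<ge> 1"
    "\<And>c (x::'a::euclidean_space) y. c > 0 \<Longrightarrow>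
      \<bar>trunc_sq c x - trunc_sq c y\<bar> \<le> (0 + C * (norm x + norm y)) * dist x y"
    "\<And>c (x::'a). c > 0 \<Longrightarrow> \<bar>trunc_sq c x\<bar> \<le> C * (norm x)\<^sup>2"
    "\<And>c (x::'a). c > 0 \<Longrightarrow> norm (grad_trunc_sq c x) \<le> 2 * C * norm x"
proof -
  obtain C where C: "C \<ge> 1" "\<And>r. 0 \<le> r \<Longrightarrow> \<bar>deriv trunc r\<bar> \<le> C"
    "\<And>r s. 0 \<le> r \<Longrightarrow> 0 \<le> s \<Longrightarrow> \<bar>trunc r - trunc s\<bar> \<le> C * \<bar>r - s\<bar>"
    by (rule deriv_trunc_bounded) blast
  have lip: "\<bar>trunc_sq c x - trunc_sq c y\<bar> \<le> C * \<bar>(norm x)\<^sup>2 - (norm y)\<^sup>2\<bar>"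
    if c: "c > 0" for c and x y :: 'a
  proof -
    have "\<bar>trunc_sq c x - trunc_sq c y\<bar> = c * \<bar>trunc ((norm x)\<^sup>2 / c) - trunc ((norm y)\<^sup>2 / c)\<bar>"
      using c by (simp add: trunc_sq_def abs_mult flip: right_diff_distrib)
    also have "\<dots> \<le> c * (C * \<bar>(norm x)\<^sup>2 / c - (norm y)\<^sup>2 / c\<bar>)"
      using c by (intro mult_left_mono C) auto
    also have "\<dots> = C * \<bar>(norm x)\<^sup>2 - (norm y)\<^sup>2\<bar>"
      using c by (simp add: abs_divide flip: diff_divide_distrib)
    finally show ?thesis .
  qed
  show ?thesis
  proof (rule that[OF C(1)])
    fix c :: real and x y :: 'a assume c: "c > 0"
    have "C * \<bar>(norm x)\<^sup>2 - (norm y)\<^sup>2\<bar> \<le> C * ((norm x + norm y) * dist x y)"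
      using C(1) by (intro mult_left_mono abs_square_norm_diff_le) auto
    with lip[OF c, of x y] show "\<bar>trunc_sq c x - trunc_sq c y\<bar> \<le> (0 + C * (norm x + norm y)) * dist x y"
      by (simp add: mult.assoc)
    show "\<bar>trunc_sq c x\<bar> \<le> C * (norm x)\<^sup>2"
      using lip[OF c, of x 0] by (simp add: trunc_sq_def[of c 0] trunc_eq_self)
    show "norm (grad_trunc_sq c x) \<le> 2 * C * norm x"
      using C(2)[of "(norm x)\<^sup>2 / c"] c by (simp add: grad_trunc_sq_def abs_mult mult_right_mono)
  qed
qed

text \<open>A difference of steps rather than a product, so that the derivative is a difference of two
  mollifiers, one concentrating at \<open>0\<close> and one at \<open>T\<close>.  The shift by \<open>1\<close> keeps the support inside the
  open half line, as a test function requires.\<close>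

definition time_cutoff :: "real \<Rightarrow> real \<Rightarrow> real \<Rightarrow> real" where
  "time_cutoff n T t = S (n * t - 1) - S (n * (t - T))"

definition deriv_time_cutoff :: "real \<Rightarrow> real \<Rightarrow> real \<Rightarrow> real" where
  "deriv_time_cutoff n T t = n * deriv S (n * t - 1) - n * deriv S (n * (t - T))"

lemma time_cutoff_has_derivative:
  "(time_cutoff n T has_real_derivative deriv_time_cutoff n T t) (at t)"
  unfolding time_cutoff_def deriv_time_cutoff_def
  by (auto intro!: derivative_eq_intros DERIV_chain2[OF S_has_derivative])

lemma Ck_time_cutoff: "Ck m (time_cutoff n T)"
proof -
  have "Ck m (\<lambda>t. S (n * t + (- 1)) + (- 1) * S (n * t + (- n * T)))"
    by (intro Ck_add Ck_mult Ck_const Ck_compose[OF Ck_S] Ck_affine_real)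
  then show ?thesis by (simp add: time_cutoff_def[abs_def] algebra_simps)
qed

lemma time_cutoff_eq_0:
  assumes "n > 0" "T > 0" "t \<le> 1 / n \<or> T + 1 / n \<le> t" "1 / n \<le> T"
  shows "time_cutoff n T t = 0"
  using assms(3)
proof
  assume "t \<le> 1 / n"
  then have "t \<le> T" "n * t - 1 \<le> 0"
    using assms by (linarith, simp add: pos_le_divide_eq mult.commute)
  moreover from this(1) have "n * (t - T) \<le> 0"
    using assms by (simp add: mult_le_0_iff)
  ultimately show ?thesis by (simp add: time_cutoff_def S_0)
next
  assume t: "T + 1 / n \<le> t"
  then have "1 \<le> n * (t - T)"
    using mult_left_mono[OF t, of n] assms by (simp add: distrib_left right_diff_distrib)
  moreover have "1 \<le> n * t - 1"
    using assms t mult_left_mono[of "1 / n + 1 / n" t n] by (simp add: distrib_left)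
  ultimately show ?thesis by (simp add: time_cutoff_def S_1)
qed

definition product_test :: "real \<Rightarrow> real \<Rightarrow> real \<Rightarrow> real \<times> 'a::euclidean_space \<Rightarrow> real" where
  "product_test n T c z = exp (- fst z) * time_cutoff n T (fst z) * trunc_sq c (snd z)"

lemma test_function_product_test:
  assumes n: "n > 0" and T: "T > 0" "1 / n \<le> T" and c: "c > 0"
  shows "test_function (product_test n T c :: real \<times> 'a::euclidean_space \<Rightarrow> real)"
proof -
  have fst: "Ck m (\<lambda>z::real \<times> 'a. fst z)" for m
    using Ck_bounded_linear[OF bounded_linear_fst, of m 0] by simp
  have "Ck m (\<lambda>z::real \<times> 'a. exp (- fst z) * time_cutoff n T (fst z) * (c * trunc ((norm (snd z))\<^sup>2 * (1 / c))))" for m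
    by (intro Ck_mult Ck_const Ck_compose[OF Ck_trunc] Ck_compose[OF Ck_time_cutoff]
        Ck_compose[OF Ck_exp_minus] fst Ck_norm_square_snd)
  then have smooth: "Ck m (product_test n T c :: real \<times> 'a \<Rightarrow> real)" for m
    by (simp add: product_test_def[abs_def] trunc_sq_def)
  let ?K = "{1 / n..T + 1 / n} \<times> cball (0::'a) (sqrt (2 * c))"
  have "{z. product_test n T c z \<noteq> 0} \<subseteq> ?K"
  proof (rule subsetI, rule ccontr)
    fix z :: "real \<times> 'a" assume z: "z \<in> {z. product_test n T c z \<noteq> 0}" "z \<notin> ?K"
    have "time_cutoff n T (fst z) = 0 \<or> trunc_sq c (snd z) = 0"
    proof (cases "fst z \<in> {1 / n..T + 1 / n}")
      case True
      then have "sqrt (2 * c) < norm (snd z)"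
        using z(2) by (cases z) auto
      then have "2 * c \<le> (norm (snd z))\<^sup>2"
        using power_mono[of "sqrt (2 * c)" "norm (snd z)" 2] c by simp
      then have "2 \<le> (norm (snd z))\<^sup>2 / c"
        using c by (simp add: field_simps)
      then show ?thesis by (simp add: trunc_sq_def trunc_eq_0)
    next
      case False
      then show ?thesis using time_cutoff_eq_0[OF n T(1) _ T(2), of "fst z"] by auto
    qed
    then show False using z(1) by (auto simp: product_test_def)
  qed
  moreover have K: "compact ?K" by (intro compact_Times) auto
  ultimately have cl: "closure {z. product_test n T c z \<noteq> 0} \<subseteq> ?K"
    by (intro closure_minimal compact_imp_closed)
  then have "compact (closure {z :: real \<times> 'a. product_test n T c z \<noteq> 0})"
    using compact_Int_closed[OF K closed_closure[of "{z. product_test n T c z \<noteq> 0}"]]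
    by (simp only: Int_absorb1)
  moreover have "?K \<subseteq> {0<..} \<times> UNIV"
    using n by (auto intro: less_le_trans[of 0 "1 / n"])
  ultimately show ?thesis
    using smooth cl unfolding test_function_def by blast
qed

lemma deriv_product_test:
  "deriv (\<lambda>s. product_test n T c (s, \<theta>)) t
    = exp (- t) * (deriv_time_cutoff n T t - time_cutoff n T t) * trunc_sq c \<theta>"
  unfolding product_test_def fst_conv snd_conv
  by (rule DERIV_imp_deriv)
     (auto intro!: derivative_eq_intros time_cutoff_has_derivative simp: algebra_simps)

lemma gradient_product_test:
  assumes "c > 0"
  shows "gradient (\<lambda>\<eta>. product_test n T c (t, \<eta>)) \<theta>
    = (exp (- t) * time_cutoff n T t) *\<^sub>R grad_trunc_sq c \<theta>"
proof (rule gradient_eqI)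
  have "((\<lambda>\<eta>. (exp (- t) * time_cutoff n T t) * trunc_sq c \<eta>) has_derivative
      (\<lambda>h. (exp (- t) * time_cutoff n T t) * (h \<bullet> grad_trunc_sq c \<theta>))) (at \<theta>)"
    using GDERIV_trunc_sq[OF assms, of \<theta>] unfolding gderiv_def by (rule has_derivative_mult_right)
  then show "GDERIV (\<lambda>\<eta>. product_test n T c (t, \<eta>)) \<theta> :> (exp (- t) * time_cutoff n T t) *\<^sub>R grad_trunc_sq c \<theta>"
    unfolding gderiv_def product_test_def fst_conv snd_conv inner_scaleR_right .
qed

end

section \<open>Limits of the time cutoffs\<close>

lemma integrable_continuous_compact_support:
  fixes f :: "real \<Rightarrow> real"
  assumes "continuous_on UNIV f" and zero: "\<And>t. t \<notin> {a..b} \<Longrightarrow> f t = 0"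
  shows "integrable lborel f"
proof -
  have "integrable lborel (\<lambda>t. indicator {a..b} t *\<^sub>R f t)"
    by (intro borel_integrable_compact compact_Icc continuous_on_subset[OF assms(1)]) simp
  moreover have "(\<lambda>t. indicator {a..b} t *\<^sub>R f t) = f"
    using zero by (auto simp: indicator_def fun_eq_iff)
  ultimately show ?thesis by simp
qed

lemma mollifier_tendsto:
  fixes \<eta> g :: "real \<Rightarrow> real"
  assumes \<eta>: "continuous_on UNIV \<eta>" "\<And>x. x \<notin> {0..1} \<Longrightarrow> \<eta> x = 0" "(\<integral>x. \<eta> x \<partial>lborel) = 1"
    and g: "continuous_on UNIV g"
    and d: "\<And>n. 0 \<le> d n" "\<And>n. d n \<le> 1" "d \<longlonglongrightarrow> 0"
  shows "(\<lambda>n. \<integral>t. real (Suc n) * \<eta> (real (Suc n) * (t - (s + d n))) * g t \<partial>lborel) \<longlonglongrightarrow> g s"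
proof -
  have scale: "(\<integral>t. real (Suc n) * \<eta> (real (Suc n) * (t - (s + d n))) * g t \<partial>lborel)
      = (\<integral>x. \<eta> x * g (s + d n + 1 / real (Suc n) * x) \<partial>lborel)" for n
  proof -
    have "(\<integral>t. real (Suc n) * \<eta> (real (Suc n) * (t - (s + d n))) * g t \<partial>lborel)
      = \<bar>1 / real (Suc n)\<bar> *\<^sub>R (\<integral>x. real (Suc n) * \<eta> (real (Suc n) * ((s + d n + 1 / real (Suc n) * x) - (s + d n)))
          * g (s + d n + 1 / real (Suc n) * x) \<partial>lborel)"
      by (rule lborel_integral_real_affine) simp
    also have "\<dots> = (\<integral>x. \<bar>1 / real (Suc n)\<bar> * (real (Suc n) * \<eta> (real (Suc n) * ((s + d n + 1 / real (Suc n) * x) - (s + d n)))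
          * g (s + d n + 1 / real (Suc n) * x)) \<partial>lborel)"
      by (simp only: real_scaleR_def integral_mult_right_zero)
    also have "\<dots> = (\<integral>x. \<eta> x * g (s + d n + 1 / real (Suc n) * x) \<partial>lborel)"
      by (rule Bochner_Integration.integral_cong) (simp_all del: of_nat_Suc)
    finally show ?thesis .
  qed
  have "bounded (g ` {s..s + 2})"
    by (intro compact_imp_bounded compact_continuous_image continuous_on_subset[OF g]) auto
  then obtain B where B: "\<And>t. t \<in> {s..s + 2} \<Longrightarrow> \<bar>g t\<bar> \<le> B"
    unfolding bounded_iff real_norm_def by blast
  have \<eta>_int: "integrable lborel \<eta>"
    by (rule integrable_continuous_compact_support[OF \<eta>(1,2)])
  have [measurable]: "\<eta> \<in> borel_measurable borel" "g \<in> borel_measurable borel"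
    using \<eta>(1) g by (auto intro: borel_measurable_continuous_onI)
  have "(\<lambda>n. \<integral>x. \<eta> x * g (s + d n + 1 / real (Suc n) * x) \<partial>lborel) \<longlonglongrightarrow> (\<integral>x. \<eta> x * g s \<partial>lborel)"
  proof (rule integral_dominated_convergence[where w="\<lambda>x. \<bar>\<eta> x\<bar> * B"])
    show "integrable lborel (\<lambda>x. \<bar>\<eta> x\<bar> * B)"
      by (intro integrable_mult_left integrable_abs \<eta>_int)
    have "isCont g s" using g by (simp add: continuous_on_eq_continuous_at)
    moreover have "(\<lambda>n. s + d n + 1 / real (Suc n) * x) \<longlonglongrightarrow> s + 0 + 0 * x" for x
      by (intro tendsto_intros d LIMSEQ_Suc[OF lim_1_over_n])
    ultimately have "(\<lambda>n. g (s + d n + 1 / real (Suc n) * x)) \<longlonglongrightarrow> g s" for x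
      by (intro isCont_tendsto_compose[of s g]) auto
    then show "AE x in lborel. (\<lambda>n. \<eta> x * g (s + d n + 1 / real (Suc n) * x)) \<longlonglongrightarrow> \<eta> x * g s"
      by (intro AE_I2 tendsto_mult tendsto_const)
    show "AE x in lborel. norm (\<eta> x * g (s + d n + 1 / real (Suc n) * x)) \<le> \<bar>\<eta> x\<bar> * B" for n
    proof (rule AE_I2)
      fix x
      show "norm (\<eta> x * g (s + d n + 1 / real (Suc n) * x)) \<le> \<bar>\<eta> x\<bar> * B"
      proof (cases "x \<in> {0..1}")
        case True
        then have "0 \<le> 1 / real (Suc n) * x" "1 / real (Suc n) * x \<le> 1"
          using mult_mono[of "1 / real (Suc n)" 1 x 1] by (auto simp del: of_nat_Suc)
        then have "s + d n + 1 / real (Suc n) * x \<in> {s..s + 2}"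
          using d(1)[of n] d(2)[of n] unfolding atLeastAtMost_iff by linarith
        from B[OF this] show ?thesis
          unfolding real_norm_def abs_mult by (intro mult_left_mono) auto
      qed (simp add: \<eta>(2))
    qed
  qed measurable
  then show ?thesis
    unfolding scale by (simp add: \<eta>(3))
qed

context smooth_step
begin

lemma integral_deriv_S: "(\<integral>x. deriv S x \<partial>lborel) = 1"
proof -
  have "(\<integral>x. deriv S x * indicator {0..1} x \<partial>lborel) = S 1 - S 0"
    by (rule integral_FTC_Icc_real)
       (use S_has_derivative continuous_deriv_S in \<open>auto simp: continuous_on_eq_continuous_at\<close>)
  moreover have "(\<lambda>x. deriv S x * indicator {0..1} x) = deriv S"
    using deriv_S_outside by (auto simp: indicator_def fun_eq_iff)
  ultimately show ?thesis by (simp add: S_0 S_1)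
qed

text \<open>The first mollifier is supported on \<open>[1 / n, 2 / n]\<close>, so the value at \<open>0\<close> is reached in a single limit
  although the support of the cutoff avoids \<open>0\<close>.\<close>

lemma integral_deriv_time_cutoff_tendsto:
  assumes g: "continuous_on UNIV g" and T: "T > 0"
  shows "(\<lambda>n. \<integral>t. deriv_time_cutoff (real (Suc n)) T t * g t \<partial>lborel) \<longlonglongrightarrow> g 0 - g T"
proof -
  have supp: "integrable lborel (\<lambda>t. N * deriv S (N * (t - r)) * g t)" if N: "N \<ge> 1" for N r
  proof (rule integrable_continuous_compact_support[where a=r and b="r + 1"])
    show "continuous_on UNIV (\<lambda>t. N * deriv S (N * (t - r)) * g t)"
      by (intro continuous_on_mult continuous_on_const g continuous_on_compose2[OF continuous_deriv_S]
          continuous_on_diff continuous_on_id) simp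
    fix t assume t: "t \<notin> {r..r + 1}"
    have "N * (t - r) \<notin> {0..1}"
    proof (cases "t < r")
      case True
      then show ?thesis using N by (simp add: mult_le_0_iff zero_le_mult_iff)
    next
      case False
      then have "1 < t - r" using t by auto
      then have "1 * 1 < N * (t - r)"
        using N by (intro mult_le_less_imp_less) auto
      then show ?thesis by simp
    qed
    then show "N * deriv S (N * (t - r)) * g t = 0"
      by (simp add: deriv_S_outside)
  qed
  have eq: "deriv_time_cutoff (real (Suc n)) T t * g t
      = real (Suc n) * deriv S (real (Suc n) * (t - (0 + 1 / real (Suc n)))) * g t
        - real (Suc n) * deriv S (real (Suc n) * (t - (T + 0))) * g t" for n t
  proof -
    have "real (Suc n) * (t - (0 + 1 / real (Suc n))) = real (Suc n) * t - 1"
      by (simp add: right_diff_distrib del: of_nat_Suc)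
    then show ?thesis
      unfolding deriv_time_cutoff_def by (simp only: left_diff_distrib add_0_right)
  qed
  have "(\<integral>t. deriv_time_cutoff (real (Suc n)) T t * g t \<partial>lborel)
      = (\<integral>t. real (Suc n) * deriv S (real (Suc n) * (t - (0 + 1 / real (Suc n)))) * g t \<partial>lborel)
        - (\<integral>t. real (Suc n) * deriv S (real (Suc n) * (t - (T + 0))) * g t \<partial>lborel)" for n
    unfolding eq by (intro Bochner_Integration.integral_diff supp) simp_all
  moreover have "(\<lambda>n. \<integral>t. real (Suc n) * deriv S (real (Suc n) * (t - (0 + 1 / real (Suc n)))) * g t \<partial>lborel) \<longlonglongrightarrow> g 0"
    by (rule mollifier_tendsto[OF continuous_deriv_S deriv_S_outside integral_deriv_S g])
       (use LIMSEQ_Suc[OF lim_1_over_n] in auto)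
  moreover have "(\<lambda>n. \<integral>t. real (Suc n) * deriv S (real (Suc n) * (t - (T + 0))) * g t \<partial>lborel) \<longlonglongrightarrow> g T"
    by (rule mollifier_tendsto[OF continuous_deriv_S deriv_S_outside integral_deriv_S g, of "\<lambda>_. 0"]) auto
  ultimately show ?thesis
    by (simp only:) (rule tendsto_diff)
qed

lemma time_cutoff_tendsto:
  assumes T: "T > 0"
  shows "(\<lambda>n. time_cutoff (real (Suc n)) T t) \<longlonglongrightarrow> indicator {0<..T} t"
proof -
  have large: "\<forall>\<^sub>F n in sequentially. 2 \<le> real (Suc n) * r" if "r > 0" for r
  proof -
    have "filterlim (\<lambda>n. r * real (Suc n)) at_top sequentially"
      using that by (intro filterlim_tendsto_pos_mult_at_top[OF tendsto_const]
          filterlim_compose[OF filterlim_real_sequentially filterlim_Suc])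
    then show ?thesis by (simp add: filterlim_at_top mult.commute del: of_nat_Suc)
  qed
  consider "t \<le> 0" | "0 < t" "t \<le> T" | "T < t" by linarith
  then show ?thesis
  proof cases
    case 1
    then have "real (Suc n) * t - 1 \<le> 0" "real (Suc n) * (t - T) \<le> 0" for n
      using T mult_nonneg_nonpos[of "real (Suc n)" t] mult_nonneg_nonpos[of "real (Suc n)" "t - T"]
      by (simp_all del: of_nat_Suc)
    then show ?thesis using 1 by (simp add: time_cutoff_def S_0 del: of_nat_Suc)
  next
    case 2
    have "\<forall>\<^sub>F n in sequentially. time_cutoff (real (Suc n)) T t = 1"
      using large[OF 2(1)]
    proof eventually_elim
      case (elim n)
      have "real (Suc n) * (t - T) \<le> 0"
        using 2 by (intro mult_nonneg_nonpos) auto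
      with elim show ?case by (simp add: time_cutoff_def S_0 S_1 del: of_nat_Suc)
    qed
    then show ?thesis using 2 by (intro tendsto_eventually) simp
  next
    case 3
    have "0 < t" "0 < t - T" using 3 T by auto
    from large[OF this(1)] large[OF this(2)]
    have "\<forall>\<^sub>F n in sequentially. time_cutoff (real (Suc n)) T t = 0"
      by eventually_elim (simp add: time_cutoff_def S_1 del: of_nat_Suc)
    then show ?thesis using 3 by (intro tendsto_eventually) simp
  qed
qed

end

section \<open>Velocity fields of finite action\<close>

text \<open>The curve is constant before time \<open>0\<close>, so that measurability and continuity can be stated on the
  whole real line.\<close>

locale finite_action_curve =
  fixes \<nu> :: "real \<Rightarrow> 'a::euclidean_space measure" and a :: "real \<Rightarrow> 'a \<Rightarrow> 'a"
  assumes curve: "continuous_P2_curve \<nu>"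
    and const: "\<And>t. \<nu> (max 0 t) = \<nu> t"
    and a_measurable: "(\<lambda>(t, \<theta>). a t \<theta>) \<in> borel_measurable borel"
    and action: "(\<integral>\<^sup>+t\<in>{0..}. ennreal (exp (- t)) * L2_norm_sq (\<nu> t) (a t) \<partial>lborel) < \<infinity>"
begin

lemma in_P2: "\<nu> t \<in> P2"
  using curve const[of t] by (metis continuous_P2_curve_def max.cobounded1)

lemma kernel: "\<nu> \<in> borel \<rightarrow>\<^sub>M prob_algebra borel"
  using P2_curve_measurable_kernel[OF curve] by (simp add: const)

lemma subprob_kernel: "\<nu> \<in> borel \<rightarrow>\<^sub>M subprob_algebra borel"
  by (rule measurable_prob_algebraD[OF kernel])

lemma continuous_integral:
  assumes "g \<in> borel_measurable borel" "A \<ge> 0" "B \<ge> 0"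
    and "\<And>x y. \<bar>g x - g y\<bar> \<le> (A + B * (norm x + norm y)) * dist x y"
  shows "continuous_on UNIV (\<lambda>t. \<integral>x. g x \<partial>\<nu> t)"
  using continuous_extend_left[OF continuous_on_integral_P2_curve[OF curve assms]]
  by (simp add: const)

lemma continuous_m2: "continuous_on UNIV (\<lambda>t. m2 (\<nu> t))"
  unfolding m2_def
  by (rule continuous_integral[where A=0 and B=1]) (simp_all add: abs_square_norm_diff_le)

lemma a_measurable_pair: "(\<lambda>(t, \<theta>). a t \<theta>) \<in> borel_measurable (borel \<Otimes>\<^sub>M borel)"
  using a_measurable by (simp add: borel_prod)

lemma a_section_measurable: "a t \<in> borel_measurable borel"
  using measurable_compose[OF measurable_Pair1' a_measurable_pair, of t] by simp

lemma L2_norm_sq_measurable: "(\<lambda>t. L2_norm_sq (\<nu> t) (a t)) \<in> borel_measurable borel"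
proof -
  note [measurable] = a_measurable_pair
  have "(\<lambda>(t, \<theta>). ennreal ((norm (a t \<theta>))\<^sup>2)) \<in> borel_measurable (borel \<Otimes>\<^sub>M borel)"
    by measurable
  then show ?thesis
    unfolding L2_norm_sq_def
    by (rule nn_integral_measurable_subprob_algebra2[OF _ subprob_kernel])
qed

lemma AE_finite_action: "AE t in lborel. 0 \<le> t \<longrightarrow> L2_norm_sq (\<nu> t) (a t) < \<infinity>"
proof -
  note [measurable] = L2_norm_sq_measurable
  have "AE t in lborel. ennreal (exp (- t)) * L2_norm_sq (\<nu> t) (a t) * indicator {0..} t \<noteq> \<infinity>"
    using action by (intro nn_integral_noteq_infinite) auto
  then show ?thesis
  proof (rule AE_mp, intro AE_I2 impI)
    fix t :: real
    assume "ennreal (exp (- t)) * L2_norm_sq (\<nu> t) (a t) * indicator {0..} t \<noteq> \<infinity>" "0 \<le> t"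
    then show "L2_norm_sq (\<nu> t) (a t) < \<infinity>"
      by (auto simp: ennreal_mult_eq_top_iff less_top)
  qed
qed

definition speed_sq :: "real \<Rightarrow> real" where
  "speed_sq t = enn2real (L2_norm_sq (\<nu> t) (a t))"

lemma speed_sq_measurable: "speed_sq \<in> borel_measurable borel"
  unfolding speed_sq_def[abs_def] using L2_norm_sq_measurable by measurable

lemma speed_sq_nonneg: "0 \<le> speed_sq t"
  by (simp add: speed_sq_def)

lemma ennreal_speed_sq: "L2_norm_sq (\<nu> t) (a t) < \<infinity> \<Longrightarrow> ennreal (speed_sq t) = L2_norm_sq (\<nu> t) (a t)"
  by (simp add: speed_sq_def less_top)

lemma integrable_speed_sq: "integrable lborel (\<lambda>t. indicator {0..K} t * speed_sq t)"
proof -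
  note [measurable] = L2_norm_sq_measurable speed_sq_measurable
  have "(\<integral>\<^sup>+t. ennreal (indicator {0..K} t * speed_sq t) \<partial>lborel)
      \<le> (\<integral>\<^sup>+t. ennreal (exp K) * (ennreal (exp (- t)) * L2_norm_sq (\<nu> t) (a t) * indicator {0..} t) \<partial>lborel)"
  proof (rule nn_integral_mono)
    fix t
    show "ennreal (indicator {0..K} t * speed_sq t)
        \<le> ennreal (exp K) * (ennreal (exp (- t)) * L2_norm_sq (\<nu> t) (a t) * indicator {0..} t)"
    proof (cases "t \<in> {0..K}")
      case True
      have "ennreal (speed_sq t) \<le> 1 * L2_norm_sq (\<nu> t) (a t)"
        unfolding speed_sq_def by (cases "L2_norm_sq (\<nu> t) (a t)" rule: ennreal_cases) auto
      also have "\<dots> \<le> ennreal (exp K * exp (- t)) * L2_norm_sq (\<nu> t) (a t)"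
        using True by (intro mult_right_mono) (auto simp: mult_exp_exp simp flip: ennreal_1 intro!: ennreal_leI)
      finally show ?thesis
        using True by (simp add: ennreal_mult mult.assoc)
    qed simp
  qed
  also have "\<dots> = ennreal (exp K) * (\<integral>\<^sup>+t\<in>{0..}. ennreal (exp (- t)) * L2_norm_sq (\<nu> t) (a t) \<partial>lborel)"
    by (rule nn_integral_cmult) measurable
  also have "\<dots> < \<infinity>"
    using action by (simp add: ennreal_mult_less_top)
  finally show ?thesis
    by (intro integrableI_nonneg) (auto simp: speed_sq_nonneg)
qed

definition drift :: "('a \<Rightarrow> 'a) \<Rightarrow> real \<Rightarrow> real" where
  "drift p t = (\<integral>\<theta>. p \<theta> \<bullet> a t \<theta> \<partial>\<nu> t)"

lemma drift_measurable:
  assumes [measurable]: "p \<in> borel_measurable borel"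
  shows "drift p \<in> borel_measurable borel"
proof -
  note [measurable] = a_measurable_pair
  have "(\<lambda>(t, \<theta>). p \<theta> \<bullet> a t \<theta>) \<in> borel_measurable (borel \<Otimes>\<^sub>M borel)"
    by measurable
  then show ?thesis
    unfolding drift_def[abs_def] by (rule borel_measurable_integral_kernel[OF _ subprob_kernel])
qed

lemma drift_bounds:
  assumes fin: "L2_norm_sq (\<nu> t) (a t) < \<infinity>" and p: "p \<in> borel_measurable borel"
    and K: "K \<ge> 0" and lin: "\<And>\<theta>. norm (p \<theta>) \<le> K * norm \<theta>"
  shows "integrable (\<nu> t) (\<lambda>\<theta>. (norm (p \<theta>))\<^sup>2)"
    and "integrable (\<nu> t) (\<lambda>\<theta>. p \<theta> \<bullet> a t \<theta>)"
    and "drift p t \<le> (\<integral>\<theta>. (norm (p \<theta>))\<^sup>2 / 4 \<partial>\<nu> t) + speed_sq t"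
    and "\<bar>drift p t\<bar> \<le> K\<^sup>2 * m2 (\<nu> t) + speed_sq t"
proof -
  have [measurable]: "p \<in> borel_measurable (\<nu> t)" "a t \<in> borel_measurable (\<nu> t)"
    using p a_section_measurable[of t]
      measurable_cong_sets[OF P2_D(2)[OF in_P2[of t]] refl, of "borel :: 'a measure"] by simp_all
  have a_int: "integrable (\<nu> t) (\<lambda>\<theta>. (norm (a t \<theta>))\<^sup>2)"
    using fin unfolding L2_norm_sq_def by (intro integrableI_nonneg) auto
  have speed: "speed_sq t = (\<integral>\<theta>. (norm (a t \<theta>))\<^sup>2 \<partial>\<nu> t)"
    unfolding speed_sq_def L2_norm_sq_def by (intro integral_eq_nn_integral[symmetric]) auto
  have sq: "(norm (p \<theta>))\<^sup>2 \<le> K\<^sup>2 * (norm \<theta>)\<^sup>2" for \<theta>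
    using power_mono[OF lin, of \<theta> 2] by (simp add: power_mult_distrib)
  show p_int: "integrable (\<nu> t) (\<lambda>\<theta>. (norm (p \<theta>))\<^sup>2)"
  proof (rule Bochner_Integration.integrable_bound)
    show "integrable (\<nu> t) (\<lambda>\<theta>. K\<^sup>2 * (norm \<theta>)\<^sup>2)"
      using P2_D(3)[OF in_P2] by (rule integrable_mult_right)
    show "AE \<theta> in \<nu> t. norm ((norm (p \<theta>))\<^sup>2) \<le> norm (K\<^sup>2 * (norm \<theta>)\<^sup>2)"
      using sq by (intro AE_I2) (simp add: abs_mult)
  qed measurable
  \<comment> \<open>The weights are chosen so that \<open>p \<theta> = 2 \<theta>\<close>, the gradient of \<open>|\<theta>|\<^sup>2\<close>, contributes exactly
    \<open>|\<theta>|\<^sup>2\<close>; this fixes the growth rate \<open>e\<^sup>T\<close>.\<close>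
  have young: "\<bar>p \<theta> \<bullet> a t \<theta>\<bar> \<le> (norm (p \<theta>))\<^sup>2 / 4 + (norm (a t \<theta>))\<^sup>2" for \<theta>
  proof -
    have "\<bar>p \<theta> \<bullet> a t \<theta>\<bar> \<le> norm (p \<theta>) * norm (a t \<theta>)"
      by (rule Cauchy_Schwarz_ineq2)
    moreover have "0 \<le> (norm (p \<theta>) / 2 - norm (a t \<theta>))\<^sup>2" by simp
    ultimately show ?thesis by (simp add: power2_diff power_divide)
  qed
  have sum_int: "integrable (\<nu> t) (\<lambda>\<theta>. (norm (p \<theta>))\<^sup>2 / 4 + (norm (a t \<theta>))\<^sup>2)"
    using p_int a_int by simp
  show pa: "integrable (\<nu> t) (\<lambda>\<theta>. p \<theta> \<bullet> a t \<theta>)"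
  proof (rule Bochner_Integration.integrable_bound[OF sum_int])
    show "AE \<theta> in \<nu> t. norm (p \<theta> \<bullet> a t \<theta>) \<le> norm ((norm (p \<theta>))\<^sup>2 / 4 + (norm (a t \<theta>))\<^sup>2)"
      using order_trans[OF young abs_ge_self] by (intro AE_I2) (simp only: real_norm_def)
  qed measurable
  have sum_eq: "(\<integral>\<theta>. (norm (p \<theta>))\<^sup>2 / 4 + (norm (a t \<theta>))\<^sup>2 \<partial>\<nu> t)
      = (\<integral>\<theta>. (norm (p \<theta>))\<^sup>2 / 4 \<partial>\<nu> t) + speed_sq t"
    unfolding speed using p_int a_int by (intro Bochner_Integration.integral_add) simp_all
  have abs_le: "\<bar>drift p t\<bar> \<le> (\<integral>\<theta>. (norm (p \<theta>))\<^sup>2 / 4 \<partial>\<nu> t) + speed_sq t"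
    unfolding drift_def sum_eq[symmetric]
    by (rule order_trans[OF integral_abs_bound]) (intro integral_mono integrable_abs pa sum_int young)
  then show "drift p t \<le> (\<integral>\<theta>. (norm (p \<theta>))\<^sup>2 / 4 \<partial>\<nu> t) + speed_sq t"
    by linarith
  have "(\<integral>\<theta>. (norm (p \<theta>))\<^sup>2 / 4 \<partial>\<nu> t) \<le> (\<integral>\<theta>. K\<^sup>2 * (norm \<theta>)\<^sup>2 \<partial>\<nu> t)"
  proof (rule integral_mono)
    show "integrable (\<nu> t) (\<lambda>\<theta>. (norm (p \<theta>))\<^sup>2 / 4)" using p_int by simp
    show "integrable (\<nu> t) (\<lambda>\<theta>. K\<^sup>2 * (norm \<theta>)\<^sup>2)"
      using P2_D(3)[OF in_P2] by (rule integrable_mult_right)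
    show "(norm (p \<theta>))\<^sup>2 / 4 \<le> K\<^sup>2 * (norm \<theta>)\<^sup>2" for \<theta>
      using sq[of \<theta>] zero_le_power2[of "norm (p \<theta>)"] by linarith
  qed
  also have "\<dots> = K\<^sup>2 * m2 (\<nu> t)"
    unfolding m2_def by (rule integral_mult_right_zero)
  finally show "\<bar>drift p t\<bar> \<le> K\<^sup>2 * m2 (\<nu> t) + speed_sq t"
    using abs_le by linarith
qed

end

section \<open>The second moment along the continuity equation\<close>

locale cutoff_flow = finite_action_curve \<nu> a + smooth_step S
  for \<nu> :: "real \<Rightarrow> 'a::euclidean_space measure" and a :: "real \<Rightarrow> 'a \<Rightarrow> 'a" and S :: "real \<Rightarrow> real" +
  assumes continuity_eq: "continuity_equation \<nu> a"
begin

definition trunc_moment :: "real \<Rightarrow> real \<Rightarrow> real" where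
  "trunc_moment c t = (\<integral>\<theta>. trunc_sq c \<theta> \<partial>\<nu> t)"

lemma continuous_trunc_moment: "c > 0 \<Longrightarrow> continuous_on UNIV (trunc_moment c)"
proof -
  assume c: "c > 0"
  obtain C where "C \<ge> 1" and C: "\<And>c (x::'a::euclidean_space) y. c > 0 \<Longrightarrow>
      \<bar>trunc_sq c x - trunc_sq c y\<bar> \<le> (0 + C * (norm x + norm y)) * dist x y"
    by (rule trunc_sq_bounds[where 'a='a]) blast
  then show ?thesis
    unfolding trunc_moment_def[abs_def] using c
    by (intro continuous_integral[where A=0 and B=C, OF trunc_sq_measurable]) auto
qed

lemma continuous_time_cutoff: "continuous_on UNIV (time_cutoff n T)"
  using Ck_time_cutoff[of 0 n T] by simp

lemma continuous_deriv_time_cutoff: "continuous_on UNIV (deriv_time_cutoff n T)"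
  unfolding deriv_time_cutoff_def[abs_def]
  by (intro continuous_on_diff continuous_on_mult continuous_on_const continuous_on_id
      continuous_on_compose2[OF continuous_deriv_S]) auto

lemma deriv_time_cutoff_eq_0:
  assumes "n > 0" "T > 0" "t < 0 \<or> T + 1 / n < t" "1 / n \<le> T"
  shows "deriv_time_cutoff n T t = 0"
proof -
  have "n * t - 1 \<notin> {0..1} \<and> n * (t - T) \<notin> {0..1}"
    using assms(3)
  proof
    assume t: "t < 0"
    then have "n * t < 0" "n * (t - T) < 0"
      using assms by (simp_all add: mult_less_0_iff)
    then show ?thesis by auto
  next
    assume t: "T + 1 / n < t"
    then have "n * (T + 1 / n) < n * t" "n * (1 / n) \<le> n * T"
      using assms by (simp_all del: times_divide_eq_right)
    then show ?thesis using assms by (simp add: distrib_left right_diff_distrib)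
  qed
  then show ?thesis by (simp add: deriv_time_cutoff_def deriv_S_outside)
qed

text \<open>The continuity equation for one test function.  The inner integral splits only where \<open>a t\<close> is square
  integrable, which by finiteness of the action is almost every time.\<close>

lemma weak_identity:
  assumes n: "n > 0" and T: "T > 0" "1 / n \<le> T" and c: "c > 0"
  shows "(\<integral>t. deriv_time_cutoff n T t * (exp (- t) * trunc_moment c t)
      - time_cutoff n T t * (exp (- t) * (trunc_moment c t - drift (grad_trunc_sq c) t)) \<partial>lborel) = 0"
proof -
  let ?\<chi> = "time_cutoff n T" and ?\<chi>' = "deriv_time_cutoff n T" and ?F = "drift (grad_trunc_sq c)"
  let ?I = "\<lambda>t. \<integral>\<theta>. deriv (\<lambda>s. product_test n T c (s, \<theta>)) t
      + gradient (\<lambda>\<eta>. product_test n T c (t, \<eta>)) \<theta> \<bullet> a t \<theta> \<partial>\<nu> t"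
  let ?J = "\<lambda>t. ?\<chi>' t * (exp (- t) * trunc_moment c t) - ?\<chi> t * (exp (- t) * (trunc_moment c t - ?F t))"
  obtain C where C: "C \<ge> 1" "\<And>c (x::'a::euclidean_space). c > 0 \<Longrightarrow> \<bar>trunc_sq c x\<bar> \<le> C * (norm x)\<^sup>2"
    "\<And>c (x::'a). c > 0 \<Longrightarrow> norm (grad_trunc_sq c x) \<le> 2 * C * norm x"
    by (rule trunc_sq_bounds[where 'a='a]) blast
  have slice: "?I t = ?J t" if fin: "L2_norm_sq (\<nu> t) (a t) < \<infinity>" for t
  proof -
    have drift: "integrable (\<nu> t) (\<lambda>\<theta>. grad_trunc_sq c \<theta> \<bullet> a t \<theta>)"
      by (rule drift_bounds(2)[OF fin grad_trunc_sq_measurable _ C(3)[OF c]]) (use C(1) in simp)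
    have mom: "integrable (\<nu> t) (trunc_sq c)"
      by (rule P2_integrable_quadratic_growth[OF in_P2 trunc_sq_measurable, of _ 0 C]) (use C(2)[OF c] in simp)
    have "?I t = (\<integral>\<theta>. exp (- t) * (?\<chi>' t - ?\<chi> t) * trunc_sq c \<theta>
        + exp (- t) * ?\<chi> t * (grad_trunc_sq c \<theta> \<bullet> a t \<theta>) \<partial>\<nu> t)"
      unfolding deriv_product_test gradient_product_test[OF c] inner_scaleR_left ..
    also have "\<dots> = exp (- t) * (?\<chi>' t - ?\<chi> t) * trunc_moment c t + exp (- t) * ?\<chi> t * ?F t"
      unfolding trunc_moment_def drift_def using drift mom by simp
    also have "\<dots> = ?J t" by (simp add: algebra_simps)
    finally show ?thesis .
  qed
  have [measurable]: "?\<chi> \<in> borel_measurable borel" "?\<chi>' \<in> borel_measurable borel"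
      "trunc_moment c \<in> borel_measurable borel" "?F \<in> borel_measurable borel"
    using continuous_time_cutoff continuous_deriv_time_cutoff continuous_trunc_moment[OF c]
    by (auto intro: borel_measurable_continuous_onI drift_measurable grad_trunc_sq_measurable)
  have J[measurable]: "?J \<in> borel_measurable borel" by measurable
  have neg: "?J t = 0" if "t < 0" for t
    using time_cutoff_eq_0[OF n T(1) _ T(2), of t] deriv_time_cutoff_eq_0[OF n T(1) _ T(2), of t]
      that n by (simp add: order_trans[of t 0])
  have ae: "AE t in lebesgue. ?J t = indicator {0..} t *\<^sub>R ?I t"
    using AE_completion[OF AE_finite_action]
  proof (rule AE_mp, intro AE_I2 impI)
    fix t assume "0 \<le> t \<longrightarrow> L2_norm_sq (\<nu> t) (a t) < \<infinity>"
    then show "?J t = indicator {0..} t *\<^sub>R ?I t"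
      using slice[of t] neg[of t] by (cases "0 \<le> t") auto
  qed
  have "(\<integral>t. ?J t \<partial>lborel) = (\<integral>t. ?J t \<partial>lebesgue)"
    by (rule integral_completion[symmetric]) simp
  also have "\<dots> = (\<integral>t. indicator {0..} t *\<^sub>R ?I t \<partial>lebesgue)"
    using ae by (intro integral_cong_AE borel_measurable_AE[OF _ ae] measurable_completion) auto
  also have "\<dots> = 0"
    using continuity_eq test_function_product_test[OF n T c, where 'a='a]
    unfolding continuity_equation_def set_lebesgue_integral_def by blast
  finally show ?thesis .
qed

lemma drift_dominated:
  assumes c: "c > 0"
  obtains K where "AE t in lborel. 0 \<le> t \<longrightarrow>
    \<bar>trunc_moment c t - drift (grad_trunc_sq c) t\<bar> \<le> \<bar>trunc_moment c t\<bar> + (K * m2 (\<nu> t) + speed_sq t)"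
proof -
  obtain C where C: "C \<ge> 1" "\<And>c (x::'a). c > 0 \<Longrightarrow> norm (grad_trunc_sq c x) \<le> 2 * C * norm x"
    by (rule trunc_sq_bounds[where 'a='a]) blast
  have "AE t in lborel. 0 \<le> t \<longrightarrow>
      \<bar>trunc_moment c t - drift (grad_trunc_sq c) t\<bar> \<le> \<bar>trunc_moment c t\<bar> + ((2 * C)\<^sup>2 * m2 (\<nu> t) + speed_sq t)"
    using AE_finite_action
  proof (rule AE_mp, intro AE_I2 impI)
    fix t :: real assume "0 \<le> t \<longrightarrow> L2_norm_sq (\<nu> t) (a t) < \<infinity>" "0 \<le> t"
    then have "\<bar>drift (grad_trunc_sq c) t\<bar> \<le> (2 * C)\<^sup>2 * m2 (\<nu> t) + speed_sq t"
      using C(1) by (intro drift_bounds(4)[OF _ grad_trunc_sq_measurable _ C(2)[OF c]]) auto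
    then show "\<bar>trunc_moment c t - drift (grad_trunc_sq c) t\<bar> \<le> \<bar>trunc_moment c t\<bar> + ((2 * C)\<^sup>2 * m2 (\<nu> t) + speed_sq t)"
      by linarith
  qed
  then show ?thesis by (rule that)
qed

lemma integrable_dominating:
  assumes c: "c > 0"
  shows "integrable lborel (\<lambda>t. indicator {0..b} t * (\<bar>trunc_moment c t\<bar> + (K * m2 (\<nu> t) + speed_sq t)))"
proof -
  have "integrable lborel (\<lambda>t. indicator {0..b} t *\<^sub>R (\<bar>trunc_moment c t\<bar> + K * m2 (\<nu> t)))"
    by (intro borel_integrable_compact compact_Icc continuous_on_add continuous_on_mult continuous_on_const
        continuous_on_rabs continuous_on_subset[OF continuous_trunc_moment[OF c]]
        continuous_on_subset[OF continuous_m2]) auto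
  then have "integrable lborel (\<lambda>t. indicator {0..b} t *\<^sub>R (\<bar>trunc_moment c t\<bar> + K * m2 (\<nu> t))
      + indicator {0..b} t * speed_sq t)"
    by (rule Bochner_Integration.integrable_add[OF _ integrable_speed_sq])
  then show ?thesis by (simp add: distrib_left add.assoc)
qed

text \<open>Sharpening the time cutoff turns the distributional equation into an identity between the times
  \<open>0\<close> and \<open>T\<close>: the left-hand side comes from the derivative of the cutoff, the right-hand side by
  dominated convergence, for which the finite action supplies the bound.\<close>

lemma weighted_moment_identity:
  assumes T: "T > 0" and c: "c > 0"
  shows "trunc_moment c 0 - exp (- T) * trunc_moment c T
    = (\<integral>t. indicator {0<..T} t * (exp (- t) * (trunc_moment c t - drift (grad_trunc_sq c) t)) \<partial>lborel)"
proof -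
  let ?\<chi> = "\<lambda>n. time_cutoff (real (Suc n)) T" and ?\<chi>' = "\<lambda>n. deriv_time_cutoff (real (Suc n)) T"
  let ?g = "\<lambda>t. exp (- t) * trunc_moment c t"
  let ?f = "\<lambda>t. exp (- t) * (trunc_moment c t - drift (grad_trunc_sq c) t)"
  obtain K where K: "AE t in lborel. 0 \<le> t \<longrightarrow>
    \<bar>trunc_moment c t - drift (grad_trunc_sq c) t\<bar> \<le> \<bar>trunc_moment c t\<bar> + (K * m2 (\<nu> t) + speed_sq t)"
    by (rule drift_dominated[OF c])
  obtain B where B: "\<And>x. \<bar>S x\<bar> \<le> B" by (rule S_bounded) blast
  let ?D = "\<lambda>t. (2 * B) * (indicator {0..T + 1} t * (\<bar>trunc_moment c t\<bar> + (K * m2 (\<nu> t) + speed_sq t)))"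
  have D: "integrable lborel ?D"
    by (intro integrable_mult_right integrable_dominating c)
  have [measurable]: "?\<chi> n \<in> borel_measurable borel" "trunc_moment c \<in> borel_measurable borel"
      "drift (grad_trunc_sq c) \<in> borel_measurable borel" for n
    using continuous_time_cutoff continuous_trunc_moment[OF c]
    by (auto intro: borel_measurable_continuous_onI drift_measurable grad_trunc_sq_measurable)
  have g: "continuous_on UNIV ?g"
    by (intro continuous_intros continuous_trunc_moment c)
  have small: "\<forall>\<^sub>F n in sequentially. 1 / real (Suc n) \<le> T \<and> 1 / real (Suc n) \<le> 1"
  proof -
    have "\<forall>\<^sub>F n in sequentially. 1 / real (Suc n) < T"
      using order_tendstoD(2)[OF LIMSEQ_Suc[OF lim_1_over_n] T] .
    then show ?thesis by eventually_elim simp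
  qed
  have bound: "AE t in lborel. norm (?\<chi> n t * ?f t) \<le> ?D t"
    if "1 / real (Suc n) \<le> T" for n
    using K
  proof (rule AE_mp, intro AE_I2 impI)
    fix t
    assume Kt: "0 \<le> t \<longrightarrow> \<bar>trunc_moment c t - drift (grad_trunc_sq c) t\<bar>
        \<le> \<bar>trunc_moment c t\<bar> + (K * m2 (\<nu> t) + speed_sq t)"
    show "norm (?\<chi> n t * ?f t) \<le> ?D t"
    proof (cases "t \<in> {0..T + 1}")
      case True
      have "\<bar>?f t\<bar> = exp (- t) * \<bar>trunc_moment c t - drift (grad_trunc_sq c) t\<bar>"
        by (simp add: abs_mult)
      also have "\<dots> \<le> 1 * (\<bar>trunc_moment c t\<bar> + (K * m2 (\<nu> t) + speed_sq t))"
        using True Kt by (intro mult_mono) auto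
      finally have "\<bar>?f t\<bar> \<le> \<bar>trunc_moment c t\<bar> + (K * m2 (\<nu> t) + speed_sq t)" by simp
      moreover have "\<bar>?\<chi> n t\<bar> \<le> 2 * B"
        unfolding time_cutoff_def
        using B[of "real (Suc n) * t - 1"] B[of "real (Suc n) * (t - T)"] by linarith
      ultimately have "\<bar>?\<chi> n t\<bar> * \<bar>?f t\<bar> \<le> (2 * B) * (\<bar>trunc_moment c t\<bar> + (K * m2 (\<nu> t) + speed_sq t))"
        by (intro mult_mono) auto
      then show ?thesis using True by (simp add: abs_mult)
    next
      case False
      moreover have "1 / real (Suc n) \<le> 1" "0 \<le> 1 / real (Suc n)" by simp_all
      ultimately have "t \<le> 1 / real (Suc n) \<or> T + 1 / real (Suc n) \<le> t"
        unfolding atLeastAtMost_iff by linarith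
      then have "?\<chi> n t = 0"
        using that T by (intro time_cutoff_eq_0) (simp_all del: of_nat_Suc)
      then show ?thesis using False by simp
    qed
  qed
  have int_f: "integrable lborel (\<lambda>t. ?\<chi> n t * ?f t)" if "1 / real (Suc n) \<le> T" for n
  proof (rule Bochner_Integration.integrable_bound[OF D])
    show "AE t in lborel. norm (?\<chi> n t * ?f t) \<le> norm (?D t)"
      using bound[OF that] by eventually_elim simp
  qed measurable
  have int_g: "integrable lborel (\<lambda>t. ?\<chi>' n t * ?g t)" if "1 / real (Suc n) \<le> T" for n
  proof (rule integrable_continuous_compact_support[where a=0 and b="T + 1"])
    show "continuous_on UNIV (\<lambda>t. ?\<chi>' n t * ?g t)"
      by (intro continuous_on_mult g continuous_deriv_time_cutoff)
    fix t assume t: "t \<notin> {0..T + 1}"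
    have "1 / real (Suc n) \<le> 1" by simp
    with t have "t < 0 \<or> T + 1 / real (Suc n) < t"
      unfolding atLeastAtMost_iff by linarith
    then show "?\<chi>' n t * ?g t = 0"
      using that T by (subst deriv_time_cutoff_eq_0) (auto simp del: of_nat_Suc)
  qed
  have eq: "\<forall>\<^sub>F n in sequentially. (\<integral>t. ?\<chi>' n t * ?g t \<partial>lborel) = (\<integral>t. ?\<chi> n t * ?f t \<partial>lborel)"
    using small
  proof eventually_elim
    case (elim n)
    then have "0 = (\<integral>t. ?\<chi>' n t * ?g t - ?\<chi> n t * ?f t \<partial>lborel)"
      using weak_identity[of "real (Suc n)" T c] T c by (simp del: of_nat_Suc)
    also have "\<dots> = (\<integral>t. ?\<chi>' n t * ?g t \<partial>lborel) - (\<integral>t. ?\<chi> n t * ?f t \<partial>lborel)"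
      using elim by (intro Bochner_Integration.integral_diff int_f int_g) auto
    finally show ?case by simp
  qed
  obtain N where N: "\<And>n. n \<ge> N \<Longrightarrow> 1 / real (Suc n) \<le> T"
    using small unfolding eventually_sequentially by blast
  have "(\<lambda>n. \<integral>t. ?\<chi> (n + N) t * ?f t \<partial>lborel) \<longlonglongrightarrow> (\<integral>t. indicator {0<..T} t * ?f t \<partial>lborel)"
  proof (rule integral_dominated_convergence[OF _ _ D])
    show "AE t in lborel. (\<lambda>n. ?\<chi> (n + N) t * ?f t) \<longlonglongrightarrow> indicator {0<..T} t * ?f t"
      by (intro AE_I2 tendsto_mult tendsto_const LIMSEQ_ignore_initial_segment time_cutoff_tendsto T)
    show "AE t in lborel. norm (?\<chi> (n + N) t * ?f t) \<le> ?D t" for n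
      by (rule bound[OF N]) simp
  qed measurable
  then have lim: "(\<lambda>n. \<integral>t. ?\<chi> n t * ?f t \<partial>lborel) \<longlonglongrightarrow> (\<integral>t. indicator {0<..T} t * ?f t \<partial>lborel)"
    by (rule LIMSEQ_offset)
  have "(\<lambda>n. \<integral>t. ?\<chi>' n t * ?g t \<partial>lborel) \<longlonglongrightarrow> ?g 0 - ?g T"
    by (rule integral_deriv_time_cutoff_tendsto[OF g T])
  then have "(\<lambda>n. \<integral>t. ?\<chi> n t * ?f t \<partial>lborel) \<longlonglongrightarrow> ?g 0 - ?g T"
    by (rule Lim_transform_eventually[OF _ eq])
  from LIMSEQ_unique[OF this lim] show ?thesis by simp
qed

end

context cutoff_flow
begin

lemma trunc_sq_tendsto: "(\<lambda>k. trunc_sq (real (Suc k)) \<theta>) \<longlonglongrightarrow> (norm \<theta>)\<^sup>2"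
  and norm_grad_trunc_sq_tendsto:
    "(\<lambda>k. (norm (grad_trunc_sq (real (Suc k)) \<theta>))\<^sup>2 / 4) \<longlonglongrightarrow> (norm \<theta>)\<^sup>2"
  for \<theta> :: "'b::euclidean_space"
proof -
  obtain N :: nat where N: "(norm \<theta>)\<^sup>2 < real N" using reals_Archimedean2 by blast
  have small: "(norm \<theta>)\<^sup>2 / real (Suc k) < 1" if "k \<ge> N" for k
  proof -
    have "real N \<le> real (Suc k)" using that by simp
    with N show ?thesis by (simp add: divide_less_eq del: of_nat_Suc)
  qed
  have "trunc_sq (real (Suc k)) \<theta> = (norm \<theta>)\<^sup>2" if "k \<ge> N" for k
    using trunc_eq_self[OF less_imp_le[OF small[OF that]]] by (simp add: trunc_sq_def del: of_nat_Suc)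
  then show "(\<lambda>k. trunc_sq (real (Suc k)) \<theta>) \<longlonglongrightarrow> (norm \<theta>)\<^sup>2"
    by (intro tendsto_eventually) (auto simp: eventually_sequentially)
  have "(norm (grad_trunc_sq (real (Suc k)) \<theta>))\<^sup>2 / 4 = (norm \<theta>)\<^sup>2" if "k \<ge> N" for k
    using deriv_trunc_eq_1[OF small[OF that]]
    by (simp add: grad_trunc_sq_def power_mult_distrib del: of_nat_Suc)
  then show "(\<lambda>k. (norm (grad_trunc_sq (real (Suc k)) \<theta>))\<^sup>2 / 4) \<longlonglongrightarrow> (norm \<theta>)\<^sup>2"
    by (intro tendsto_eventually) (auto simp: eventually_sequentially)
qed

text \<open>The amount by which Young's inequality for the truncated moment fails to close.\<close>

definition defect :: "real \<Rightarrow> 'a \<Rightarrow> real" where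
  "defect c \<theta> = (norm (grad_trunc_sq c \<theta>))\<^sup>2 / 4 - trunc_sq c \<theta>"

lemma defect_measurable: "defect c \<in> borel_measurable borel"
proof -
  note [measurable] = trunc_sq_measurable grad_trunc_sq_measurable
  show ?thesis unfolding defect_def[abs_def] by measurable
qed

lemma defect_bounded:
  obtains C where "C \<ge> 0" "\<And>c \<theta>. c > 0 \<Longrightarrow> \<bar>defect c \<theta>\<bar> \<le> C * (norm \<theta>)\<^sup>2"
proof -
  obtain C where C: "C \<ge> 1" "\<And>c (x::'a). c > 0 \<Longrightarrow> \<bar>trunc_sq c x\<bar> \<le> C * (norm x)\<^sup>2"
    "\<And>c (x::'a). c > 0 \<Longrightarrow> norm (grad_trunc_sq c x) \<le> 2 * C * norm x"
    by (rule trunc_sq_bounds[where 'a='a]) blast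
  have "\<bar>defect c \<theta>\<bar> \<le> (C\<^sup>2 + C) * (norm \<theta>)\<^sup>2" if c: "c > 0" for c \<theta>
  proof -
    have "(norm (grad_trunc_sq c \<theta>))\<^sup>2 \<le> 4 * (C\<^sup>2 * (norm \<theta>)\<^sup>2)"
      using power_mono[OF C(3)[OF c, of \<theta>], of 2] by (simp add: power_mult_distrib)
    with C(2)[OF c, of \<theta>] zero_le_power2[of "norm (grad_trunc_sq c \<theta>)"]
    show ?thesis unfolding defect_def distrib_right by linarith
  qed
  then show ?thesis using C(1) by (intro that[of "C\<^sup>2 + C"]) auto
qed

text \<open>Young's inequality bounds the drift by \<open>defect\<close>, the truncated moment, and the squared speed.  The
  truncated moment cancels against the one produced by the weight, and the defect disappears in the
  limit, so no limit has to be taken in the term that contains the velocity field.\<close>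

lemma weighted_m2_le_speed:
  assumes T: "T > 0"
  shows "exp (- T) * m2 (\<nu> T) - m2 (\<nu> 0)
    \<le> (\<integral>t. indicator {0..T} t * (exp (- t) * speed_sq t) \<partial>lborel)"
proof -
  let ?c = "\<lambda>k. real (Suc k)"
  let ?q = "\<lambda>k t. \<integral>\<theta>. defect (?c k) \<theta> \<partial>\<nu> t"
  let ?A = "\<integral>t. indicator {0..T} t * (exp (- t) * speed_sq t) \<partial>lborel"
  obtain C where C: "C \<ge> 1" "\<And>c (x::'a). c > 0 \<Longrightarrow> \<bar>trunc_sq c x\<bar> \<le> C * (norm x)\<^sup>2"
    "\<And>c (x::'a). c > 0 \<Longrightarrow> norm (grad_trunc_sq c x) \<le> 2 * C * norm x"
    by (rule trunc_sq_bounds[where 'a='a]) blast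
  obtain D where D: "D \<ge> 0" "\<And>c \<theta>. c > 0 \<Longrightarrow> \<bar>defect c \<theta>\<bar> \<le> D * (norm \<theta>)\<^sup>2"
    by (rule defect_bounded) blast
  have meas: "f \<in> borel_measurable (\<nu> t)" if "f \<in> borel_measurable borel" for f :: "'a \<Rightarrow> real" and t
    using that by (simp add: measurable_cong_sets[OF P2_D(2)[OF in_P2[of t]] refl])
  have dom: "integrable (\<nu> t) (\<lambda>\<theta>. K * (norm \<theta>)\<^sup>2)" for K t
    using P2_D(3)[OF in_P2] by (rule integrable_mult_right)
  have mom_lim: "(\<lambda>k. trunc_moment (?c k) t) \<longlonglongrightarrow> m2 (\<nu> t)" for t
    unfolding trunc_moment_def m2_def
  proof (rule integral_dominated_convergence[OF _ _ dom[of t C]])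
    show "AE \<theta> in \<nu> t. norm (trunc_sq (?c k) \<theta>) \<le> C * (norm \<theta>)\<^sup>2" for k
      using C(2)[of "?c k"] by (intro AE_I2) simp
  qed (use trunc_sq_tendsto in \<open>auto intro!: meas trunc_sq_measurable simp del: of_nat_Suc\<close>)
  have q_lim: "(\<lambda>k. ?q k t) \<longlonglongrightarrow> 0" for t
  proof -
    have "(\<lambda>k. ?q k t) \<longlonglongrightarrow> (\<integral>\<theta>. 0 \<partial>\<nu> t)"
    proof (rule integral_dominated_convergence[OF _ _ dom[of t D]])
      show "AE \<theta> in \<nu> t. norm (defect (?c k) \<theta>) \<le> D * (norm \<theta>)\<^sup>2" for k
        using D(2)[of "?c k"] by (intro AE_I2) simp
      show "AE \<theta> in \<nu> t. (\<lambda>k. defect (?c k) \<theta>) \<longlonglongrightarrow> 0"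
      proof (rule AE_I2)
        fix \<theta> :: 'a
        show "(\<lambda>k. defect (?c k) \<theta>) \<longlonglongrightarrow> 0"
          using tendsto_diff[OF norm_grad_trunc_sq_tendsto[of \<theta>] trunc_sq_tendsto[of \<theta>]]
          by (simp only: defect_def diff_self)
      qed
    qed (auto intro!: meas defect_measurable)
    then show ?thesis by simp
  qed
  have q_bound: "\<bar>?q k t\<bar> \<le> D * m2 (\<nu> t)" for k t
  proof -
    have "\<bar>?q k t\<bar> \<le> (\<integral>\<theta>. \<bar>defect (?c k) \<theta>\<bar> \<partial>\<nu> t)" by (rule integral_abs_bound)
    also have "\<dots> \<le> (\<integral>\<theta>. D * (norm \<theta>)\<^sup>2 \<partial>\<nu> t)"
    proof (rule integral_mono[OF _ dom])
      show "integrable (\<nu> t) (\<lambda>\<theta>. \<bar>defect (?c k) \<theta>\<bar>)"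
        using D(2)[of "?c k"]
        by (intro integrable_abs P2_integrable_quadratic_growth[OF in_P2 defect_measurable, of _ 0 D]) simp
    qed (use D(2)[of "?c k"] in simp)
    also have "\<dots> = D * m2 (\<nu> t)" unfolding m2_def by (rule integral_mult_right_zero)
    finally show ?thesis .
  qed
  have q_meas: "?q k \<in> borel_measurable borel" for k
  proof (rule borel_measurable_integral_kernel[OF _ subprob_kernel])
    have "(\<lambda>z. defect (?c k) (snd z)) \<in> borel_measurable ((borel :: real measure) \<Otimes>\<^sub>M borel)"
      by (rule measurable_compose[OF measurable_snd defect_measurable])
    then show "(\<lambda>(t, \<theta>). defect (?c k) \<theta>) \<in> borel_measurable ((borel :: real measure) \<Otimes>\<^sub>M borel)"
      by (simp add: case_prod_beta)
  qed
  have q_dom: "integrable lborel (\<lambda>t. indicator {0..T} t * (D * m2 (\<nu> t)))"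
    using borel_integrable_compact[of "{0..T}" "\<lambda>t. D * m2 (\<nu> t)"]
    by (simp add: continuous_on_mult continuous_on_subset[OF continuous_m2])
  have q_le: "\<bar>indicator {0..T} t * (exp (- t) * ?q k t)\<bar> \<le> indicator {0..T} t * (D * m2 (\<nu> t))" for k t
  proof (cases "t \<in> {0..T}")
    case True
    then have "exp (- t) * \<bar>?q k t\<bar> \<le> 1 * (D * m2 (\<nu> t))"
      using q_bound by (intro mult_mono) auto
    then show ?thesis using True by (simp add: abs_mult)
  qed simp
  have q_int: "integrable lborel (\<lambda>t. indicator {0..T} t * (exp (- t) * ?q k t))" for k
  proof (rule Bochner_Integration.integrable_bound[OF q_dom])
    show "(\<lambda>t. indicator {0..T} t * (exp (- t) * ?q k t)) \<in> borel_measurable lborel"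
      using q_meas[of k] by measurable
    show "AE t in lborel. norm (indicator {0..T} t * (exp (- t) * ?q k t)) \<le> norm (indicator {0..T} t * (D * m2 (\<nu> t)))"
      using order_trans[OF q_le abs_ge_self] by (intro AE_I2) (simp only: real_norm_def)
  qed
  have A_int: "integrable lborel (\<lambda>t. indicator {0..T} t * (exp (- t) * speed_sq t))"
  proof (rule Bochner_Integration.integrable_bound[OF integrable_speed_sq[of T]])
    show "(\<lambda>t. indicator {0..T} t * (exp (- t) * speed_sq t)) \<in> borel_measurable lborel"
      using speed_sq_measurable by measurable
    show "AE t in lborel. norm (indicator {0..T} t * (exp (- t) * speed_sq t)) \<le> norm (indicator {0..T} t * speed_sq t)"
    proof (rule AE_I2)
      fix t
      show "norm (indicator {0..T} t * (exp (- t) * speed_sq t)) \<le> norm (indicator {0..T} t * speed_sq t)"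
        using speed_sq_nonneg[of t] by (cases "t \<in> {0..T}") (simp_all add: abs_mult mult_left_le_one_le)
    qed
  qed
  have step: "exp (- T) * trunc_moment (?c k) T - trunc_moment (?c k) 0
      \<le> (\<integral>t. indicator {0..T} t * (exp (- t) * ?q k t) \<partial>lborel) + ?A" for k
  proof -
    have ck: "?c k > 0" by simp
    let ?f = "\<lambda>t. exp (- t) * (trunc_moment (?c k) t - drift (grad_trunc_sq (?c k)) t)"
    have upper: "AE t in lborel. - (indicator {0<..T} t * ?f t)
        \<le> indicator {0..T} t * (exp (- t) * ?q k t) + indicator {0..T} t * (exp (- t) * speed_sq t)"
      using AE_finite_action AE_lborel_singleton[of 0]
    proof eventually_elim
      case (elim t)
      show ?case
      proof (cases "t \<in> {0<..T}")
        case True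
        then have fin: "L2_norm_sq (\<nu> t) (a t) < \<infinity>" using elim by simp
        have K: "0 \<le> 2 * C" using C(1) by simp
        note bounds = drift_bounds[OF fin grad_trunc_sq_measurable K C(3)[OF ck]]
        have mom: "integrable (\<nu> t) (trunc_sq (?c k))"
          by (rule P2_integrable_quadratic_growth[OF in_P2 trunc_sq_measurable, of _ 0 C])
             (use C(2)[OF ck] in simp)
        have "?q k t = (\<integral>\<theta>. (norm (grad_trunc_sq (?c k) \<theta>))\<^sup>2 / 4 \<partial>\<nu> t) - trunc_moment (?c k) t"
          unfolding defect_def trunc_moment_def
          by (intro Bochner_Integration.integral_diff mom integrable_divide bounds(1))
        with bounds(3) have "drift (grad_trunc_sq (?c k)) t - trunc_moment (?c k) t \<le> ?q k t + speed_sq t"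
          by linarith
        then have "exp (- t) * (drift (grad_trunc_sq (?c k)) t - trunc_moment (?c k) t) \<le> exp (- t) * (?q k t + speed_sq t)"
          by (rule mult_left_mono) simp
        then show ?thesis using True by (simp add: algebra_simps)
      next
        case False
        with elim have "t \<notin> {0..T}" by auto
        then show ?thesis using False by simp
      qed
    qed
    have [measurable]: "trunc_moment (?c k) \<in> borel_measurable borel"
        "drift (grad_trunc_sq (?c k)) \<in> borel_measurable borel"
      by (intro borel_measurable_continuous_onI continuous_trunc_moment ck drift_measurable
          grad_trunc_sq_measurable)+
    obtain K where K: "AE t in lborel. 0 \<le> t \<longrightarrow> \<bar>trunc_moment (?c k) t - drift (grad_trunc_sq (?c k)) t\<bar>
        \<le> \<bar>trunc_moment (?c k) t\<bar> + (K * m2 (\<nu> t) + speed_sq t)"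
      by (rule drift_dominated[OF ck])
    have f_int: "integrable lborel (\<lambda>t. indicator {0<..T} t * ?f t)"
    proof (rule Bochner_Integration.integrable_bound[OF integrable_dominating[OF ck, of T K]])
      show "AE t in lborel. norm (indicator {0<..T} t * ?f t)
          \<le> norm (indicator {0..T} t * (\<bar>trunc_moment (?c k) t\<bar> + (K * m2 (\<nu> t) + speed_sq t)))"
        using K
      proof (rule AE_mp, intro AE_I2 impI)
        fix t assume Kt: "0 \<le> t \<longrightarrow> \<bar>trunc_moment (?c k) t - drift (grad_trunc_sq (?c k)) t\<bar>
          \<le> \<bar>trunc_moment (?c k) t\<bar> + (K * m2 (\<nu> t) + speed_sq t)"
        show "norm (indicator {0<..T} t * ?f t)
          \<le> norm (indicator {0..T} t * (\<bar>trunc_moment (?c k) t\<bar> + (K * m2 (\<nu> t) + speed_sq t)))"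
        proof (cases "t \<in> {0<..T}")
          case True
          have "\<bar>?f t\<bar> = exp (- t) * \<bar>trunc_moment (?c k) t - drift (grad_trunc_sq (?c k)) t\<bar>"
            by (simp add: abs_mult)
          also have "\<dots> \<le> 1 * (\<bar>trunc_moment (?c k) t\<bar> + (K * m2 (\<nu> t) + speed_sq t))"
            using True Kt by (intro mult_mono) auto
          also have "\<dots> \<le> \<bar>\<bar>trunc_moment (?c k) t\<bar> + (K * m2 (\<nu> t) + speed_sq t)\<bar>"
            by simp
          finally show ?thesis using True by (simp add: abs_mult)
        qed simp
      qed
    qed measurable
    have "exp (- T) * trunc_moment (?c k) T - trunc_moment (?c k) 0 = (\<integral>t. - (indicator {0<..T} t * ?f t) \<partial>lborel)"
      using weighted_moment_identity[OF T ck] by simp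
    also have "\<dots> \<le> (\<integral>t. indicator {0..T} t * (exp (- t) * ?q k t) + indicator {0..T} t * (exp (- t) * speed_sq t) \<partial>lborel)"
      by (intro integral_mono_AE integrable_minus f_int Bochner_Integration.integrable_add q_int A_int upper)
    also have "\<dots> = (\<integral>t. indicator {0..T} t * (exp (- t) * ?q k t) \<partial>lborel) + ?A"
      by (intro Bochner_Integration.integral_add q_int A_int)
    finally show ?thesis .
  qed
  have "(\<lambda>k. exp (- T) * trunc_moment (?c k) T - trunc_moment (?c k) 0) \<longlonglongrightarrow> exp (- T) * m2 (\<nu> T) - m2 (\<nu> 0)"
    by (intro tendsto_intros mom_lim)
  moreover have "(\<lambda>k. (\<integral>t. indicator {0..T} t * (exp (- t) * ?q k t) \<partial>lborel) + ?A) \<longlonglongrightarrow> (\<integral>t. (0::real) \<partial>(lborel :: real measure)) + ?A"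
  proof (intro tendsto_add tendsto_const, rule integral_dominated_convergence[OF _ _ q_dom])
    show "(\<lambda>t. indicator {0..T} t * (exp (- t) * ?q k t)) \<in> borel_measurable lborel" for k
      using q_meas[of k] by measurable
    show "AE t in lborel. norm (indicator {0..T} t * (exp (- t) * ?q k t)) \<le> indicator {0..T} t * (D * m2 (\<nu> t))" for k
      using q_le by (intro AE_I2) (simp only: real_norm_def)
    show "AE t in lborel. (\<lambda>k. indicator {0..T} t * (exp (- t) * ?q k t)) \<longlonglongrightarrow> 0"
      by (intro AE_I2 tendsto_mult_right_zero q_lim)
  qed simp
  ultimately have "exp (- T) * m2 (\<nu> T) - m2 (\<nu> 0) \<le> (\<integral>t. (0::real) \<partial>(lborel :: real measure)) + ?A"
    by (rule LIMSEQ_le) (use step in blast)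
  then show ?thesis by simp
qed

end

text \<open>Only the values at times \<open>t \<ge> 0\<close> enter the hypotheses, so the extension inherits all of them.\<close>

lemma finite_action_curve_extend:
  fixes \<mu> :: "real \<Rightarrow> 'a::euclidean_space measure" and \<alpha> :: "real \<Rightarrow> 'a \<Rightarrow> 'a"
  assumes "admissible_pair \<mu>0 \<mu> \<alpha>"
  shows "finite_action_curve (\<lambda>t. \<mu> (max 0 t)) (\<lambda>t. \<alpha> (max 0 t))"
    and "continuity_equation (\<lambda>t. \<mu> (max 0 t)) (\<lambda>t. \<alpha> (max 0 t))"
proof -
  let ?\<nu> = "\<lambda>t. \<mu> (max 0 t)" and ?a = "\<lambda>t. \<alpha> (max 0 t)"
  have curve: "continuous_P2_curve \<mu>"
    and meas: "(\<lambda>(t, \<theta>). \<alpha> t \<theta>) \<in> borel_measurable (restrict_space borel ({0..} \<times> UNIV))"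
    and act: "(\<integral>\<^sup>+t\<in>{0..}. ennreal (exp (- t)) * L2_norm_sq (\<mu> t) (\<alpha> t) \<partial>lebesgue) < \<infinity>"
    and ce: "continuity_equation \<mu> \<alpha>"
    using assms by (simp_all add: admissible_pair_def)
  show "finite_action_curve ?\<nu> ?a"
  proof
    show "continuous_P2_curve ?\<nu>"
      unfolding continuous_P2_curve_def
    proof (intro conjI allI impI)
      fix t :: real assume t: "0 \<le> t"
      show "?\<nu> t \<in> P2" using curve t by (simp add: continuous_P2_curve_def)
      have "((\<lambda>s. W2 (\<mu> s) (\<mu> t)) \<longlongrightarrow> 0) (at t within {0..})"
        using curve t by (simp add: continuous_P2_curve_def)
      then show "((\<lambda>s. W2 (?\<nu> s) (?\<nu> t)) \<longlongrightarrow> 0) (at t within {0..})"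
        by (rule Lim_transform_eventually) (use t in \<open>auto simp: eventually_at_filter\<close>)
    qed
    show "?\<nu> (max 0 t) = ?\<nu> t" for t by simp
    have "(\<lambda>(t, \<theta>). (max 0 t, \<theta>)) \<in> (borel :: (real \<times> 'a) measure) \<rightarrow>\<^sub>M restrict_space borel ({0..} \<times> UNIV)"
    proof (rule measurable_restrict_space2)
      show "(\<lambda>(t, \<theta>). (max 0 t, \<theta>)) \<in> (borel :: (real \<times> 'a) measure) \<rightarrow>\<^sub>M borel"
        unfolding borel_prod[symmetric] by measurable
    qed auto
    from measurable_compose[OF this meas]
    show "(\<lambda>(t, \<theta>). ?a t \<theta>) \<in> borel_measurable borel"
      by (simp add: case_prod_beta)
    have "(\<integral>\<^sup>+t\<in>{0..}. ennreal (exp (- t)) * L2_norm_sq (?\<nu> t) (?a t) \<partial>lborel)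
        = (\<integral>\<^sup>+t\<in>{0..}. ennreal (exp (- t)) * L2_norm_sq (\<mu> t) (\<alpha> t) \<partial>lborel)"
      by (rule nn_integral_cong) (auto simp: indicator_def)
    then show "(\<integral>\<^sup>+t\<in>{0..}. ennreal (exp (- t)) * L2_norm_sq (?\<nu> t) (?a t) \<partial>lborel) < \<infinity>"
      using act by (simp add: nn_integral_completion)
  qed
  show "continuity_equation ?\<nu> ?a"
    unfolding continuity_equation_def
  proof (intro allI impI)
    fix \<phi> :: "real \<times> 'a \<Rightarrow> real" assume "test_function \<phi>"
    with ce have zero: "(LINT t:{0..}|lebesgue. (\<integral>\<theta>. deriv (\<lambda>s. \<phi> (s, \<theta>)) t
        + gradient (\<lambda>\<eta>. \<phi> (t, \<eta>)) \<theta> \<bullet> \<alpha> t \<theta> \<partial>\<mu> t)) = 0"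
      unfolding continuity_equation_def by blast
    have "(LINT t:{0..}|lebesgue. (\<integral>\<theta>. deriv (\<lambda>s. \<phi> (s, \<theta>)) t
        + gradient (\<lambda>\<eta>. \<phi> (t, \<eta>)) \<theta> \<bullet> ?a t \<theta> \<partial>?\<nu> t))
      = (LINT t:{0..}|lebesgue. (\<integral>\<theta>. deriv (\<lambda>s. \<phi> (s, \<theta>)) t
        + gradient (\<lambda>\<eta>. \<phi> (t, \<eta>)) \<theta> \<bullet> \<alpha> t \<theta> \<partial>\<mu> t))"
      unfolding set_lebesgue_integral_def
      by (rule Bochner_Integration.integral_cong) (auto simp: indicator_def)
    with zero show "(LINT t:{0..}|lebesgue. (\<integral>\<theta>. deriv (\<lambda>s. \<phi> (s, \<theta>)) t
        + gradient (\<lambda>\<eta>. \<phi> (t, \<eta>)) \<theta> \<bullet> ?a t \<theta> \<partial>?\<nu> t)) = 0"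
      by simp
  qed
qed

lemma (in finite_action_curve) ennreal_integral_speed_sq:
  "ennreal (\<integral>t. indicator {0..T} t * (exp (T - t) * speed_sq t) \<partial>lborel)
    = (\<integral>\<^sup>+t\<in>{0..T}. ennreal (exp (T - t)) * L2_norm_sq (\<nu> t) (a t) \<partial>lborel)"
proof -
  have int: "integrable lborel (\<lambda>t. indicator {0..T} t * (exp (T - t) * speed_sq t))"
  proof (rule Bochner_Integration.integrable_bound)
    show "integrable lborel (\<lambda>t. exp T * (indicator {0..T} t * speed_sq t))"
      by (intro integrable_mult_right integrable_speed_sq)
    show "(\<lambda>t. indicator {0..T} t * (exp (T - t) * speed_sq t)) \<in> borel_measurable lborel"
      using speed_sq_measurable by measurable
    show "AE t in lborel. norm (indicator {0..T} t * (exp (T - t) * speed_sq t))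
        \<le> norm (exp T * (indicator {0..T} t * speed_sq t))"
    proof (rule AE_I2)
      fix t
      show "norm (indicator {0..T} t * (exp (T - t) * speed_sq t)) \<le> norm (exp T * (indicator {0..T} t * speed_sq t))"
        using speed_sq_nonneg[of t] by (cases "t \<in> {0..T}") (simp_all add: abs_mult mult_right_mono)
    qed
  qed
  have "ennreal (\<integral>t. indicator {0..T} t * (exp (T - t) * speed_sq t) \<partial>lborel)
      = (\<integral>\<^sup>+t. ennreal (indicator {0..T} t * (exp (T - t) * speed_sq t)) \<partial>lborel)"
    using speed_sq_nonneg by (intro nn_integral_eq_integral[symmetric] int AE_I2) simp
  also have "\<dots> = (\<integral>\<^sup>+t\<in>{0..T}. ennreal (exp (T - t)) * L2_norm_sq (\<nu> t) (a t) \<partial>lborel)"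
    using AE_finite_action
  proof (intro nn_integral_cong_AE, elim AE_mp, intro AE_I2 impI)
    fix t :: real assume fin: "0 \<le> t \<longrightarrow> L2_norm_sq (\<nu> t) (a t) < \<infinity>"
    show "ennreal (indicator {0..T} t * (exp (T - t) * speed_sq t))
        = ennreal (exp (T - t)) * L2_norm_sq (\<nu> t) (a t) * indicator {0..T} t"
      using ennreal_speed_sq[of t] fin
      by (cases "t \<in> {0..T}") (simp_all add: ennreal_mult speed_sq_nonneg)
  qed
  finally show ?thesis .
qed

lemma (in cutoff_flow) m2_le_action:
  assumes T: "T > 0"
  shows "ennreal (m2 (\<nu> T)) \<le> ennreal (exp T * m2 (\<nu> 0))
    + (\<integral>\<^sup>+t\<in>{0..T}. ennreal (exp (T - t)) * L2_norm_sq (\<nu> t) (a t) \<partial>lborel)"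
proof -
  let ?I = "\<integral>t. indicator {0..T} t * (exp (T - t) * speed_sq t) \<partial>lborel"
  have "exp T * (exp (- T) * m2 (\<nu> T) - m2 (\<nu> 0))
      \<le> exp T * (\<integral>t. indicator {0..T} t * (exp (- t) * speed_sq t) \<partial>lborel)"
    by (intro mult_left_mono weighted_m2_le_speed T) simp
  also have "\<dots> = (\<integral>t. exp T * (indicator {0..T} t * (exp (- t) * speed_sq t)) \<partial>lborel)"
    by (rule integral_mult_right_zero[symmetric])
  also have "\<dots> = ?I"
  proof (rule Bochner_Integration.integral_cong[OF refl])
    fix t :: real
    show "exp T * (indicator {0..T} t * (exp (- t) * speed_sq t)) = indicator {0..T} t * (exp (T - t) * speed_sq t)"
      using exp_add[of T "- t"] by simp
  qed
  also have "exp T * (exp (- T) * m2 (\<nu> T) - m2 (\<nu> 0)) = m2 (\<nu> T) - exp T * m2 (\<nu> 0)"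
    by (simp add: right_diff_distrib mult.assoc[symmetric] mult_exp_exp)
  finally have "m2 (\<nu> T) \<le> exp T * m2 (\<nu> 0) + ?I" by simp
  then have "ennreal (m2 (\<nu> T)) \<le> ennreal (exp T * m2 (\<nu> 0) + ?I)"
    by (rule ennreal_leI)
  also have "\<dots> = ennreal (exp T * m2 (\<nu> 0)) + ennreal ?I"
    by (intro ennreal_plus Bochner_Integration.integral_nonneg) (simp_all add: m2_nonneg speed_sq_nonneg)
  finally show ?thesis unfolding ennreal_integral_speed_sq .
qed

lemma admissible_pair_m2_bound:
  fixes \<mu> :: "real \<Rightarrow> 'a::euclidean_space measure" and \<alpha> :: "real \<Rightarrow> 'a \<Rightarrow> 'a"
  assumes adm: "admissible_pair \<mu>0 \<mu> \<alpha>" and T: "T > 0"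
  shows "ennreal (m2 (\<mu> T)) \<le> ennreal (exp T * m2 \<mu>0)
    + (\<integral>\<^sup>+t\<in>{0..T}. ennreal (exp (T - t)) * L2_norm_sq (\<mu> t) (\<alpha> t) \<partial>lebesgue)"
proof -
  let ?\<nu> = "\<lambda>t. \<mu> (max 0 t)" and ?a = "\<lambda>t. \<alpha> (max 0 t)"
  obtain S :: "real \<Rightarrow> real" where "\<And>n. Ck n S" "\<And>x. x \<le> 0 \<Longrightarrow> S x = 0" "\<And>x. x \<ge> 1 \<Longrightarrow> S x = 1"
    using smooth_step_exists by blast
  then have "smooth_step S" by unfold_locales
  then interpret cutoff_flow ?\<nu> ?a S
    using finite_action_curve_extend[OF adm]
    by (intro cutoff_flow.intro cutoff_flow_axioms.intro)
  have "(\<integral>\<^sup>+t\<in>{0..T}. ennreal (exp (T - t)) * L2_norm_sq (?\<nu> t) (?a t) \<partial>lborel)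
      = (\<integral>\<^sup>+t\<in>{0..T}. ennreal (exp (T - t)) * L2_norm_sq (\<mu> t) (\<alpha> t) \<partial>lebesgue)"
    unfolding nn_integral_completion by (rule nn_integral_cong) (auto simp: indicator_def)
  moreover have "\<mu> 0 = \<mu>0" using adm by (simp add: admissible_pair_def)
  ultimately show ?thesis
    using m2_le_action[OF T] T by simp
qed

section \<open>The moment bounds\<close>

theorem proposition4p18:
  fixes \<sigma> Lt :: "real \<Rightarrow> real" and M :: nat
    and x :: "nat \<Rightarrow> real ^ 'd::finite" and y :: "nat \<Rightarrow> real"
    and S0 R \<beta> :: real
    and \<mu>0 :: "'d param measure" and \<mu> :: "real \<Rightarrow> 'd param measure"
    and \<alpha> :: "real \<Rightarrow> 'd param \<Rightarrow> 'd param"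
  defines "L \<equiv> loss \<sigma> Lt M x y" and "G \<equiv> loss_slope \<sigma> Lt M x y"
  assumes M: "M \<ge> 1"
    and Lt_nonneg: "\<And>r. 0 \<le> Lt r"
    and min_L: "\<exists>\<nu>\<in>P2. L \<nu> = 0" "\<And>\<nu>. \<nu> \<in> P2 \<Longrightarrow> 0 \<le> L \<nu>"
    and S0: "S0 \<ge> 0"
    and \<sigma>_lipschitz: "\<And>z z'. \<bar>\<sigma> z - \<sigma> z'\<bar> \<le> S0 * \<bar>z - z'\<bar>"
    and \<sigma>_bounded: "\<And>z. \<bar>\<sigma> z\<bar> \<le> S0"
    and \<sigma>_deriv: "\<And>z. \<sigma> differentiable (at z)" "\<And>z. \<bar>deriv \<sigma> z\<bar> \<le> S0"
    and R: "R = (MAX k\<in>{1..M}. norm (x k))"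
    and Lt_C1: "Lt C1_differentiable_on UNIV"
    and Lt_convex: "convex_on UNIV Lt"
    and \<beta>: "\<beta> > 0" "\<And>r s. \<bar>deriv Lt r - deriv Lt s\<bar> \<le> \<beta> * \<bar>r - s\<bar>"
    and min_Lt: "\<exists>r. Lt r = 0"
    and \<mu>0: "\<mu>0 \<in> P2"
  shows "(admissible_pair \<mu>0 \<mu> \<alpha> \<longrightarrow>
            (AE T in lebesgue. T > 0 \<longrightarrow>
               ennreal (m2 (\<mu> T)) \<le> ennreal (exp T * m2 \<mu>0)
                 + (\<integral>\<^sup>+t\<in>{0..T}. ennreal (exp (T - t)) * L2_norm_sq (\<mu> t) (\<alpha> t) \<partial>lebesgue)))
       \<and> (gradient_flow L G \<mu>0 \<mu> \<longrightarrow>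
            (AE T in lebesgue. T > 0 \<longrightarrow>
               set_integrable lebesgue {0..T} (\<lambda>t. exp (T - t) * (G (\<mu> t))\<^sup>2) \<and>
               m2 (\<mu> T) \<le> exp T * m2 \<mu>0
                 + (LINT t:{0..T}|lebesgue. exp (T - t) * (G (\<mu> t))\<^sup>2) \<and>
               exp T * m2 \<mu>0 + (LINT t:{0..T}|lebesgue. exp (T - t) * (G (\<mu> t))\<^sup>2)
                 \<le> exp T * (m2 \<mu>0 + L \<mu>0 - L (\<mu> T))))"
proof (intro conjI impI)
  assume "admissible_pair \<mu>0 \<mu> \<alpha>"
  then show "AE T in lebesgue. T > 0 \<longrightarrow> ennreal (m2 (\<mu> T)) \<le> ennreal (exp T * m2 \<mu>0)
      + (\<integral>\<^sup>+t\<in>{0..T}. ennreal (exp (T - t)) * L2_norm_sq (\<mu> t) (\<alpha> t) \<partial>lebesgue)"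
    by (intro AE_I2 impI admissible_pair_m2_bound)
next
  assume flow: "gradient_flow L G \<mu>0 \<mu>"
  have Lt_diff: "Lt differentiable (at r)" for r
    using Lt_C1 by (auto simp: C1_differentiable_on_eq)
  have "\<beta> \<ge> 0" using \<beta>(1) by simp
  note lipschitz = loss_increment_le_W2[OF S0 \<sigma>_lipschitz \<sigma>_bounded Lt_diff \<beta>(2) this \<mu>0, of _ M x y,
    folded L_def]
  show "AE T in lebesgue. T > 0 \<longrightarrow>
      set_integrable lebesgue {0..T} (\<lambda>t. exp (T - t) * (G (\<mu> t))\<^sup>2) \<and>
      m2 (\<mu> T) \<le> exp T * m2 \<mu>0 + (LINT t:{0..T}|lebesgue. exp (T - t) * (G (\<mu> t))\<^sup>2) \<and>
      exp T * m2 \<mu>0 + (LINT t:{0..T}|lebesgue. exp (T - t) * (G (\<mu> t))\<^sup>2)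
        \<le> exp T * (m2 \<mu>0 + L \<mu>0 - L (\<mu> T))"
    by (intro AE_I2 impI conjI gradient_flow_m2_bound[OF flow _ lipschitz]) simp_all
qed

end
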